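(* Let $\tau\in\mathfrak M_{1,c}(\mathrm{Rat})$ with $J_{\ker}(G_\tau)=\emptyset$, $J(G_\tau)\ne\emptyset$ and $S_\tau\subset F(G_\tau)$, and let $\alpha\in(0,1)$, $\lambda\in(0,1)$ be constants as in the exponential-convergence theorem (so that, for some $C>0$, $\|M_\tau^n(\varphi-\pi_\tau(\varphi))\|_\alpha\le C\lambda^n\|\varphi\|_\alpha$ for all $\varphi\in C^\alpha(\hat{\mathbb C})$, $n\in\mathbb N$, and $\mathrm{LS}(\mathcal U_{f,\tau}(\hat{\mathbb C}))\subset C^\alpha(\hat{\mathbb C})$). Let $\mathrm{Spec}_\alpha(M_\tau)$ be the spectrum of $M_\tau:C^\alpha(\hat{\mathbb C})\to C^\alpha(\hat{\mathbb C})$. Then: (1) $\mathrm{Spec}_\alpha(M_\tau)\subset\{z\in\mathbb C:|z|\le\lambda\}\cup\mathcal U_{v,\tau}(\hat{\mathbb C})$; (2) for every $\zeta\in\mathbb C\setminus(\{|z|\le\lambda\}\cup\mathcal U_{v,\tau}(\hat{\mathbb C}))$, $$(\zeta I-M_\tau)^{-1}=(\zeta I-M_\tau)|_{\mathrm{LS}(\mathcal U_{f,\tau}(\hat{\mathbb C}))}^{-1}\circ\pi_\tau+\sum_{n=0}^\infty\frac{M_\tau^n}{\zeta^{n+1}}(I-\pi_\tau)$$ as operators on $C^\alpha(\hat{\mathbb C})$, where $I$ is the identity.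
   Context: $\hat{\mathbb C}$, spherical distance $d$; $\mathrm{Rat}$ with $\kappa(f,g)=\sup_zd(f(z),g(z))$; $\langle\Gamma\rangle$, $F(G)$ (equicontinuity set), $J(G)$, $J_{\ker}(G)=\bigcap_{g\in G}g^{-1}(J(G))$, $\mathrm{Min}(G,\hat{\mathbb C})$ (inclusion-minimal non-empty compact $G$-forward-invariant sets). $\Gamma_\tau=\mathrm{supp}\,\tau$, $G_\tau=\langle\Gamma_\tau\rangle$, $S_\tau=\bigcup_{L\in\mathrm{Min}(G_\tau,\hat{\mathbb C})}L$, $M_\tau\varphi(z)=\int\varphi(g(z))d\tau(g)$. $\mathcal U_{f,\tau}(\hat{\mathbb C})$ = non-zero $\varphi\in C(\hat{\mathbb C})$ with $M_\tau\varphi=a\varphi$, $|a|=1$; $\mathcal U_{v,\tau}(\hat{\mathbb C})$ = the set of such $a$; LS = linear span. Known: $C(\hat{\mathbb C})=\mathrm{LS}(\mathcal U_{f,\tau}(\hat{\mathbb C}))\oplus\{\varphi:\|M^n_\tau\varphi\|_\infty\to0\}$, first summand finite-dimensional; $\pi_\tau$ = projection onto it. $C^\alpha(\hat{\mathbb C})$ = $\alpha$-Hölder functions with $\|\varphi\|_\alpha=\sup|\varphi|+\sup_{x\ne y}|\varphi(x)-\varphi(y)|/d(x,y)^\alpha$. *)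

theory Defs
  imports "HOL-Analysis.Analysis" "HOL-Probability.Probability"
    "HOL-Computational_Algebra.Polynomial"
begin

typedef rsphere = "{x :: real \<times> real \<times> real. norm x = 1}"
  by (rule exI[of _ "(1,0,0)"]) (simp add: norm_Pair)

instantiation rsphere :: metric_space
begin
definition dist_rsphere :: "rsphere \<Rightarrow> rsphere \<Rightarrow> real" where
  "dist_rsphere x y = dist (Rep_rsphere x) (Rep_rsphere y)"
definition uniformity_rsphere :: "(rsphere \<times> rsphere) filter" where
  "uniformity_rsphere = (INF e\<in>{0<..}. principal {(x, y). dist x y < e})"
definition open_rsphere :: "rsphere set \<Rightarrow> bool" where
  "open_rsphere U = (\<forall>x\<in>U. \<forall>\<^sub>F (x', y) in uniformity. x' = x \<longrightarrow> y \<in> U)"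
instance
  by standard (auto simp: dist_rsphere_def uniformity_rsphere_def open_rsphere_def
      Rep_rsphere_inject dist_triangle2)
end

text \<open>Stereographic identification of the unit sphere with \<open>complex option\<close>
  (\<open>None\<close> = \<infinity> = north pole (0,0,1)).\<close>
definition to_ext :: "real \<times> real \<times> real \<Rightarrow> complex option" where
  "to_ext x = (case x of (x1, x2, x3) \<Rightarrow>
     if x3 = 1 then None else Some (Complex (x1 / (1 - x3)) (x2 / (1 - x3))))"

definition of_ext :: "complex option \<Rightarrow> real \<times> real \<times> real" where
  "of_ext w = (case w of None \<Rightarrow> (0, 0, 1)
     | Some z \<Rightarrow> (2 * Re z / (1 + (cmod z)\<^sup>2), 2 * Im z / (1 + (cmod z)\<^sup>2),
                 ((cmod z)\<^sup>2 - 1) / ((cmod z)\<^sup>2 + 1)))"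

definition rat_eval :: "complex poly \<Rightarrow> complex poly \<Rightarrow> complex option \<Rightarrow> complex option" where
  "rat_eval p q w = (case w of
       Some z \<Rightarrow> (if poly q z \<noteq> 0 then Some (poly p z / poly q z) else None)
     | None \<Rightarrow> (if degree p > degree q then None
                else if degree p = degree q then Some (lead_coeff p / lead_coeff q)
                else Some 0))"

definition rat_map :: "complex poly \<Rightarrow> complex poly \<Rightarrow> rsphere \<Rightarrow> rsphere" where
  "rat_map p q x = Abs_rsphere (of_ext (rat_eval p q (to_ext (Rep_rsphere x))))"

definition Rat :: "(rsphere \<Rightarrow> rsphere) set" where
  "Rat = {g. \<exists>p q. q \<noteq> 0 \<and> coprime p q \<and> max (degree p) (degree q) \<ge> 1 \<and> g = rat_map p q}"

definition kappa :: "(rsphere \<Rightarrow> rsphere) \<Rightarrow> (rsphere \<Rightarrow> rsphere) \<Rightarrow> real" where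
  "kappa f g = (SUP z. dist (f z) (g z))"

definition Rat_topology :: "(rsphere \<Rightarrow> rsphere) topology" where
  "Rat_topology = Metric_space.mtopology Rat kappa"

definition supp_meas :: "(rsphere \<Rightarrow> rsphere) measure \<Rightarrow> (rsphere \<Rightarrow> rsphere) set" where
  "supp_meas \<tau> = {f \<in> Rat. \<forall>e>0. emeasure \<tau> {g \<in> Rat. kappa f g < e} > 0}"

definition prob_meas_cpt :: "(rsphere \<Rightarrow> rsphere) measure set" where
  "prob_meas_cpt = {\<tau>. prob_space \<tau> \<and> space \<tau> = Rat
      \<and> sets \<tau> = sigma_sets Rat {U. openin Rat_topology U}
      \<and> compactin Rat_topology (supp_meas \<tau>)}"

inductive_set gen_semigroup :: "(rsphere \<Rightarrow> rsphere) set \<Rightarrow> (rsphere \<Rightarrow> rsphere) set"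
  for \<Gamma> where
  base: "g \<in> \<Gamma> \<Longrightarrow> g \<in> gen_semigroup \<Gamma>"
| comp: "f \<in> gen_semigroup \<Gamma> \<Longrightarrow> g \<in> gen_semigroup \<Gamma> \<Longrightarrow> f \<circ> g \<in> gen_semigroup \<Gamma>"

definition equicont_on :: "(rsphere \<Rightarrow> rsphere) set \<Rightarrow> rsphere set \<Rightarrow> bool" where
  "equicont_on G U = (\<forall>x\<in>U. \<forall>e>0. \<exists>d>0. \<forall>y\<in>U. \<forall>g\<in>G. dist x y < d \<longrightarrow> dist (g x) (g y) < e)"

definition Fatou :: "(rsphere \<Rightarrow> rsphere) set \<Rightarrow> rsphere set" where
  "Fatou G = {z. \<exists>U. open U \<and> z \<in> U \<and> equicont_on G U}"

definition Julia :: "(rsphere \<Rightarrow> rsphere) set \<Rightarrow> rsphere set" where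
  "Julia G = - Fatou G"

definition Julia_ker :: "(rsphere \<Rightarrow> rsphere) set \<Rightarrow> rsphere set" where
  "Julia_ker G = {z. \<forall>g\<in>G. g z \<in> Julia G}"

definition fwd_inv :: "(rsphere \<Rightarrow> rsphere) set \<Rightarrow> rsphere set \<Rightarrow> bool" where
  "fwd_inv G L = (L \<noteq> {} \<and> compact L \<and> (\<forall>g\<in>G. g ` L \<subseteq> L))"

definition Min_sets :: "(rsphere \<Rightarrow> rsphere) set \<Rightarrow> rsphere set set" where
  "Min_sets G = {L. fwd_inv G L \<and> (\<forall>K. fwd_inv G K \<and> K \<subseteq> L \<longrightarrow> K = L)}"

definition G_of :: "(rsphere \<Rightarrow> rsphere) measure \<Rightarrow> (rsphere \<Rightarrow> rsphere) set" where
  "G_of \<tau> = gen_semigroup (supp_meas \<tau>)"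

definition S_of :: "(rsphere \<Rightarrow> rsphere) measure \<Rightarrow> rsphere set" where
  "S_of \<tau> = \<Union> (Min_sets (G_of \<tau>))"

definition Mop :: "(rsphere \<Rightarrow> rsphere) measure \<Rightarrow> (rsphere \<Rightarrow> complex) \<Rightarrow> rsphere \<Rightarrow> complex" where
  "Mop \<tau> \<phi> z = (\<integral>g. \<phi> (g z) \<partial>\<tau>)"

definition Ccont :: "(rsphere \<Rightarrow> complex) set" where
  "Ccont = {\<phi>. continuous_on UNIV \<phi>}"

definition sup_norm :: "(rsphere \<Rightarrow> complex) \<Rightarrow> real" where
  "sup_norm \<phi> = (SUP z. cmod (\<phi> z))"

definition Uf :: "(rsphere \<Rightarrow> rsphere) measure \<Rightarrow> (rsphere \<Rightarrow> complex) set" where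
  "Uf \<tau> = {\<phi> \<in> Ccont. \<phi> \<noteq> (\<lambda>_. 0) \<and> (\<exists>a. cmod a = 1 \<and> Mop \<tau> \<phi> = (\<lambda>z. a * \<phi> z))}"

definition Uv :: "(rsphere \<Rightarrow> rsphere) measure \<Rightarrow> complex set" where
  "Uv \<tau> = {a. cmod a = 1 \<and> (\<exists>\<phi>\<in>Ccont. \<phi> \<noteq> (\<lambda>_. 0) \<and> Mop \<tau> \<phi> = (\<lambda>z. a * \<phi> z))}"

definition LS :: "(rsphere \<Rightarrow> complex) set \<Rightarrow> (rsphere \<Rightarrow> complex) set" where
  "LS U = {(\<lambda>z. \<Sum>i\<in>A. c i * u i z) | (A :: nat set) c u. finite A \<and> (\<forall>i\<in>A. u i \<in> U)}"

definition Zsp :: "(rsphere \<Rightarrow> rsphere) measure \<Rightarrow> (rsphere \<Rightarrow> complex) set" where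
  "Zsp \<tau> = {\<phi> \<in> Ccont. (\<lambda>n. sup_norm ((Mop \<tau> ^^ n) \<phi>)) \<longlonglongrightarrow> 0}"

text \<open>Projection onto LS(U_f) along Zsp (the known direct sum decomposition of C).\<close>
definition proj :: "(rsphere \<Rightarrow> rsphere) measure \<Rightarrow> (rsphere \<Rightarrow> complex) \<Rightarrow> rsphere \<Rightarrow> complex" where
  "proj \<tau> \<phi> = (THE \<psi>. \<psi> \<in> LS (Uf \<tau>) \<and> (\<lambda>z. \<phi> z - \<psi> z) \<in> Zsp \<tau>)"

definition holder_const :: "real \<Rightarrow> (rsphere \<Rightarrow> complex) \<Rightarrow> real" where
  "holder_const \<alpha> \<phi> = (SUP (x, y)\<in>{(x, y). x \<noteq> y}. cmod (\<phi> x - \<phi> y) / dist x y powr \<alpha>)"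

definition holder_norm :: "real \<Rightarrow> (rsphere \<Rightarrow> complex) \<Rightarrow> real" where
  "holder_norm \<alpha> \<phi> = sup_norm \<phi> + holder_const \<alpha> \<phi>"

definition Calpha :: "real \<Rightarrow> (rsphere \<Rightarrow> complex) set" where
  "Calpha \<alpha> = {\<phi>. bdd_above (range (\<lambda>z. cmod (\<phi> z)))
      \<and> bdd_above ((\<lambda>(x, y). cmod (\<phi> x - \<phi> y) / dist x y powr \<alpha>) ` {(x, y). x \<noteq> y})}"

definition bdd_inverse_on ::
  "(rsphere \<Rightarrow> complex) set \<Rightarrow> ((rsphere \<Rightarrow> complex) \<Rightarrow> real)
   \<Rightarrow> ((rsphere \<Rightarrow> complex) \<Rightarrow> rsphere \<Rightarrow> complex)
   \<Rightarrow> ((rsphere \<Rightarrow> complex) \<Rightarrow> rsphere \<Rightarrow> complex) \<Rightarrow> bool" where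
  "bdd_inverse_on X nrm T R = ((\<forall>\<phi>\<in>X. R \<phi> \<in> X \<and> T (R \<phi>) = \<phi> \<and> R (T \<phi>) = \<phi>)
      \<and> (\<exists>K. \<forall>\<phi>\<in>X. nrm (R \<phi>) \<le> K * nrm \<phi>))"

definition shift_op :: "complex \<Rightarrow> (rsphere \<Rightarrow> rsphere) measure
    \<Rightarrow> (rsphere \<Rightarrow> complex) \<Rightarrow> rsphere \<Rightarrow> complex" where
  "shift_op \<zeta> \<tau> \<phi> = (\<lambda>z. \<zeta> * \<phi> z - Mop \<tau> \<phi> z)"

definition spec_alpha :: "real \<Rightarrow> (rsphere \<Rightarrow> rsphere) measure \<Rightarrow> complex set" where
  "spec_alpha \<alpha> \<tau> = {\<zeta>. \<not> (\<exists>R. bdd_inverse_on (Calpha \<alpha>) (holder_norm \<alpha>) (shift_op \<zeta> \<tau>) R)}"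

end

(* The decomposition of C into LS(U_f) and the functions with M^n phi -> 0 has to be proved, since
   "proj" is a definite description.  By a maximum principle, the set where the asymptotic
   oscillation of (M^n phi) is maximal is forward invariant; as the kernel Julia set is empty, the
   orbit (M^n phi) is equicontinuous.  On a minimal set L in the Fatou set, the Ellis-Numakura lemma
   gives, for each g in the semigroup, an idempotent limit e = p o g fixing a given point z of L.
   Near z, e is holomorphic, hence constant or the identity.  If it were the identity for all g, a boundary
   point of the Fatou component of z would belong to the kernel Julia set.  So the semigroup contracts
   neighbourhoods of minimal sets, and recurrent functions are determined by their values at
   finitely many points.  An eigenvalue argument places recurrent functions in LS(U_f).
   The resolvent then splits into its part on LS(U_f) and a Neumann series. *)
theory Submission
  imports Defs "HOL-Complex_Analysis.Complex_Analysis"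
begin

section \<open>Stereographic coordinates\<close>

text \<open>The semigroup is equicontinuous only on the Fatou set, so limits are taken pointwise, in
  the product topology on all self-maps, where Tychonoff gives compactness. Such a limit may be
  discontinuous elsewhere; holomorphy is recovered only near a fixed point at which the
  approximating family is equicontinuous, where values stay bounded in a chart and Montel's theorem
  for bounded families applies. The maximum principle is stated for pairs of points because it
  serves three times: on the diagonal (equicontinuity of orbits), on the orbit closure of one pair
  of nearby points (functions become locally constant near minimal sets), and on all pairs with a
  function of the first coordinate only (a function vanishing on the minimal sets decays). The
  dynamical hypotheses enter separately: the empty kernel Julia set in the diagonal case and in the
  contraction argument, the nonempty Julia set to give a Fatou component a boundary point, and
  \<open>S_of \<tau> \<subseteq> Fatou G\<close> for equicontinuity at minimal sets.\<close>

definition emb :: "complex \<Rightarrow> rsphere" where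
  "emb z = Abs_rsphere (of_ext (Some z))"

definition infty :: rsphere where
  "infty = Abs_rsphere (0, 0, 1)"

text \<open>At \<open>infty\<close> the divisors vanish and \<open>co\<close> takes the default
  value 0, so a value of \<open>co\<close> is meaningful only after the point is known to differ
  from \<open>infty\<close>.\<close>

definition co :: "rsphere \<Rightarrow> complex" where
  "co x = (case Rep_rsphere x of (a, b, c) \<Rightarrow> Complex (a / (1 - c)) (b / (1 - c)))"

text \<open>The rotation by pi about the first axis, which is 1 / z in the chart. Being an isometric
  involution, it transports statements near finite points to \<open>infty\<close>.\<close>

definition flip :: "rsphere \<Rightarrow> rsphere" where
  "flip x = Abs_rsphere (case Rep_rsphere x of (a, b, c) \<Rightarrow> (a, - b, - c))"

lemma norm_triple: "norm (a, b, c) = sqrt (a\<^sup>2 + b\<^sup>2 + c\<^sup>2)" for a b c :: real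
  by (simp add: norm_Pair add.assoc)

lemma Rep_rsphere_eq: "Rep_rsphere x = (a, b, c) \<Longrightarrow> a\<^sup>2 + b\<^sup>2 + c\<^sup>2 = 1"
  using Rep_rsphere[of x] by (simp add: norm_triple)

lemma norm_of_ext: "norm (of_ext w) = 1"
proof (cases w)
  case None
  then show ?thesis by (simp add: of_ext_def norm_triple)
next
  case (Some z)
  let ?n = "(cmod z)\<^sup>2"
  have n: "1 + ?n > 0" by (simp add: add_pos_nonneg)
  have "(2 * Re z / (1 + ?n))\<^sup>2 + (2 * Im z / (1 + ?n))\<^sup>2 + ((?n - 1) / (?n + 1))\<^sup>2
      = (4 * ((Re z)\<^sup>2 + (Im z)\<^sup>2) + (?n - 1)\<^sup>2) / (1 + ?n)\<^sup>2"
    by (simp add: power_divide power_mult_distrib add_divide_distrib add.commute)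
  also have "4 * ((Re z)\<^sup>2 + (Im z)\<^sup>2) + (?n - 1)\<^sup>2 = (1 + ?n)\<^sup>2"
    unfolding cmod_power2[symmetric] by (simp add: power2_eq_square algebra_simps)
  also have "(1 + ?n)\<^sup>2 / (1 + ?n)\<^sup>2 = 1" using n by simp
  finally show ?thesis using Some by (simp add: of_ext_def norm_triple)
qed

lemma Rep_emb: "Rep_rsphere (emb z) = (2 * Re z / (1 + (cmod z)\<^sup>2), 2 * Im z / (1 + (cmod z)\<^sup>2),
                 ((cmod z)\<^sup>2 - 1) / ((cmod z)\<^sup>2 + 1))"
  using norm_of_ext[of "Some z"] by (simp add: emb_def Abs_rsphere_inverse) (simp add: of_ext_def)

lemma Rep_infty: "Rep_rsphere infty = (0, 0, 1)"
  by (simp add: infty_def Abs_rsphere_inverse norm_triple)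

lemma emb_neq_infty [simp]: "emb z \<noteq> infty" "infty \<noteq> emb z"
proof -
  have "((cmod z)\<^sup>2 - 1) / ((cmod z)\<^sup>2 + 1) \<noteq> 1"
    by (auto simp: divide_eq_eq add_nonneg_eq_0_iff split: if_splits)
  then show "emb z \<noteq> infty" "infty \<noteq> emb z"
    by (metis Rep_emb Rep_infty prod.inject)+
qed

lemma co_emb [simp]: "co (emb z) = z"
proof -
  let ?n = "(cmod z)\<^sup>2"
  have n: "1 + ?n > 0" by (simp add: add_pos_nonneg)
  have "1 - (?n - 1) / (?n + 1) = 2 / (1 + ?n)"
    using n by (simp add: field_simps)
  moreover have "2 * t / (1 + ?n) / (2 / (1 + ?n)) = t" for t
    using n by (simp add: divide_simps)
  ultimately show ?thesis by (simp only: co_def Rep_emb split complex_eq_iff complex.sel)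
qed

lemma Rep_rsphere_third: "Rep_rsphere x = (a, b, c) \<Longrightarrow> x \<noteq> infty \<Longrightarrow> c < 1"
proof -
  assume a: "Rep_rsphere x = (a, b, c)" and x: "x \<noteq> infty"
  have e: "a\<^sup>2 + b\<^sup>2 + c\<^sup>2 = 1" by (rule Rep_rsphere_eq[OF a])
  have "c\<^sup>2 \<le> 1" using e by (smt (verit) zero_le_power2)
  then have "c \<le> 1" by (simp add: abs_square_le_1)
  moreover have "c \<noteq> 1"
  proof
    assume "c = 1"
    then have "a = 0" "b = 0" using e by (auto simp: sum_power2_eq_zero_iff)
    then show False using x a \<open>c = 1\<close> Rep_infty by (metis Rep_rsphere_inject)
  qed
  ultimately show "c < 1" by simp
qed

lemma emb_co: assumes "x \<noteq> infty" shows "emb (co x) = x"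
proof -
  obtain a b c where R: "Rep_rsphere x = (a, b, c)" by (metis prod_cases3)
  have e: "a\<^sup>2 + b\<^sup>2 + c\<^sup>2 = 1" by (rule Rep_rsphere_eq[OF R])
  have c: "c < 1" by (rule Rep_rsphere_third[OF R assms])
  have "(cmod (co x))\<^sup>2 = (a\<^sup>2 + b\<^sup>2) / (1 - c)\<^sup>2"
    by (simp add: co_def R cmod_power2 power_divide add_divide_distrib)
  also have "a\<^sup>2 + b\<^sup>2 = (1 - c) * (1 + c)" using e by (simp add: power2_eq_square algebra_simps)
  finally have n: "(cmod (co x))\<^sup>2 = (1 + c) / (1 - c)" using c by (simp add: power2_eq_square)
  have n1: "1 + (cmod (co x))\<^sup>2 = 2 / (1 - c)" unfolding n using c by (simp add: field_simps)
  have n2: "(cmod (co x))\<^sup>2 + 1 = 2 / (1 - c)" using n1 by simp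
  have n3: "(cmod (co x))\<^sup>2 - 1 = 2 * c / (1 - c)" unfolding n using c by (simp add: field_simps)
  have "Rep_rsphere (emb (co x)) = (a, b, c)"
    unfolding Rep_emb n1 n2 n3 using c by (simp add: co_def R)
  then show ?thesis using R by (metis Rep_rsphere_inject)
qed

lemma Rep_flip: "Rep_rsphere x = (a, b, c) \<Longrightarrow> Rep_rsphere (flip x) = (a, - b, - c)"
  using Rep_rsphere_eq[of x a b c] by (simp add: flip_def Abs_rsphere_inverse norm_triple)

lemma flip_flip [simp]: "flip (flip x) = x"
  by (metis Rep_flip Rep_rsphere_inject minus_minus prod_cases3)

lemma dist_flip [simp]: "dist (flip x) (flip y) = dist x y"
proof -
  obtain a b c a' b' c' where "Rep_rsphere x = (a, b, c)" "Rep_rsphere y = (a', b', c')"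
    by (metis prod_cases3)
  then show ?thesis
    by (simp add: dist_rsphere_def Rep_flip dist_Pair_Pair dist_real_def power2_commute)
qed

lemma flip_infty [simp]: "flip infty = emb 0"
proof -
  have "Rep_rsphere (flip infty) = Rep_rsphere (emb 0)"
    by (simp add: Rep_flip[OF Rep_infty] Rep_emb)
  then show ?thesis by (simp add: Rep_rsphere_inject)
qed

lemma flip_emb_0 [simp]: "flip (emb 0) = infty"
  by (metis flip_flip flip_infty)

lemma flip_emb: assumes "z \<noteq> 0" shows "flip (emb z) = emb (1 / z)"
proof -
  let ?n = "(cmod z)\<^sup>2"
  have n: "?n > 0" using assms by simp
  have n1: "1 + ?n > 0" by (simp add: add_pos_nonneg)
  have m: "(cmod (1 / z))\<^sup>2 = 1 / ?n" by (simp add: norm_divide power_divide)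
  have re: "Re (1 / z) = Re z / ?n" "Im (1 / z) = - Im z / ?n"
    by (simp_all add: Re_divide Im_divide cmod_power2)
  have p1: "1 + 1 / ?n = (1 + ?n) / ?n" "1 / ?n + 1 = (1 + ?n) / ?n" "1 / ?n - 1 = (1 - ?n) / ?n"
    using n by (simp_all add: add_divide_distrib diff_divide_distrib)
  have q: "2 * (t / ?n) / ((1 + ?n) / ?n) = 2 * t / (1 + ?n)" "t / ?n / ((1 + ?n) / ?n) = t / (1 + ?n)" for t
    using n n1 by simp_all
  have "- (2 * Im z / (1 + ?n)) = 2 * - Im z / (1 + ?n)" "- ((?n - 1) / (?n + 1)) = (1 - ?n) / (1 + ?n)"
    by (simp_all only: minus_divide_left minus_diff_eq add.commute mult_minus_right)
  then have "Rep_rsphere (flip (emb z)) = Rep_rsphere (emb (1 / z))"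
    unfolding Rep_flip[OF Rep_emb] Rep_emb[of "1 / z"] m re p1 q by (simp only:)
  then show ?thesis by (simp add: Rep_rsphere_inject)
qed

lemma dist_rsphere_sq: "Rep_rsphere x = (a, b, c) \<Longrightarrow> Rep_rsphere y = (a', b', c') \<Longrightarrow>
  (dist x y)\<^sup>2 = 2 - 2 * (a * a' + b * b' + c * c')"
proof -
  assume x: "Rep_rsphere x = (a, b, c)" and y: "Rep_rsphere y = (a', b', c')"
  have "(dist x y)\<^sup>2 = (a - a')\<^sup>2 + (b - b')\<^sup>2 + (c - c')\<^sup>2"
    by (simp add: dist_rsphere_def x y dist_Pair_Pair dist_real_def)
  also have "\<dots> = 2 - 2 * (a * a' + b * b' + c * c')"
    using Rep_rsphere_eq[OF x] Rep_rsphere_eq[OF y] by (simp add: power2_eq_square algebra_simps)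
  finally show ?thesis .
qed

lemma dist_emb: "dist (emb z) (emb w) = 2 * cmod (z - w) / (sqrt (1 + (cmod z)\<^sup>2) * sqrt (1 + (cmod w)\<^sup>2))"
proof -
  let ?n = "(cmod z)\<^sup>2" and ?m = "(cmod w)\<^sup>2"
  have n: "1 + ?n > 0" and m: "1 + ?m > 0" by (simp_all add: add_pos_nonneg)
  have c: "(cmod (z - w))\<^sup>2 = ?n + ?m - 2 * (Re z * Re w + Im z * Im w)"
    unfolding cmod_power2 by (simp add: power2_eq_square algebra_simps)
  have "(dist (emb z) (emb w))\<^sup>2 = 2 - 2 * ((4 * (Re z * Re w + Im z * Im w) + (?n - 1) * (?m - 1)) / ((1 + ?n) * (1 + ?m)))"
    unfolding dist_rsphere_sq[OF Rep_emb Rep_emb]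
    by (simp add: add_divide_distrib add.commute[of _ 1] distrib_left mult.assoc)
  also have "\<dots> = (2 * ((1 + ?n) * (1 + ?m)) - 2 * (4 * (Re z * Re w + Im z * Im w) + (?n - 1) * (?m - 1))) / ((1 + ?n) * (1 + ?m))"
    using n m by (simp add: diff_divide_distrib)
  also have "2 * ((1 + ?n) * (1 + ?m)) - 2 * (4 * (Re z * Re w + Im z * Im w) + (?n - 1) * (?m - 1)) = 4 * (cmod (z - w))\<^sup>2"
    unfolding c by (simp add: algebra_simps)
  also have "4 * (cmod (z - w))\<^sup>2 / ((1 + ?n) * (1 + ?m)) = (2 * cmod (z - w) / (sqrt (1 + ?n) * sqrt (1 + ?m)))\<^sup>2"
    using n m by (simp add: power_divide power_mult_distrib)
  finally show ?thesis
    by (subst (asm) power2_eq_iff_nonneg) (use n m in auto)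
qed

lemma dist_emb_infty: "dist (emb z) infty = 2 / sqrt (1 + (cmod z)\<^sup>2)"
proof -
  let ?n = "(cmod z)\<^sup>2"
  have n: "1 + ?n > 0" by (simp add: add_pos_nonneg)
  have "(dist (emb z) infty)\<^sup>2 = 2 - 2 * ((?n - 1) / (?n + 1))"
    unfolding dist_rsphere_sq[OF Rep_emb Rep_infty] by simp
  also have "\<dots> = (2 / sqrt (1 + ?n))\<^sup>2" using n by (simp add: power_divide field_simps)
  finally show ?thesis
    by (subst (asm) power2_eq_iff_nonneg) (use n in auto)
qed

lemma dist_le_2: "dist x y \<le> 2" for x y :: rsphere
proof -
  have "dist x y \<le> norm (Rep_rsphere x) + norm (Rep_rsphere y)"
    unfolding dist_rsphere_def dist_norm by (rule norm_triangle_ineq4)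
  then show ?thesis using Rep_rsphere[of x] Rep_rsphere[of y] by simp
qed

lemma dist_emb_le: "dist (emb z) (emb w) \<le> 2 * dist z w"
proof -
  have "1 \<le> sqrt (1 + (cmod z)\<^sup>2) * sqrt (1 + (cmod w)\<^sup>2)"
    by (smt (verit) mult_le_cancel_left1 real_sqrt_ge_1_iff zero_le_power2)
  then have "2 * cmod (z - w) / (sqrt (1 + (cmod z)\<^sup>2) * sqrt (1 + (cmod w)\<^sup>2)) \<le> 2 * cmod (z - w) / 1"
    by (intro divide_left_mono) auto
  then show ?thesis by (simp add: dist_emb dist_norm)
qed

text \<open>In the chordal formula the denominator is at most 1 + R^2 on the disc of radius R.
  Together with \<open>dist_emb_le\<close>, the chart is bi-Lipschitz on bounded discs.\<close>

lemma dist_emb_ge: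
  assumes "cmod z \<le> R" "cmod w \<le> R"
  shows "dist z w \<le> (1 + R\<^sup>2) / 2 * dist (emb z) (emb w)"
proof -
  have R: "0 \<le> R" using assms(1) norm_ge_zero order_trans by blast
  have "sqrt (1 + (cmod z)\<^sup>2) * sqrt (1 + (cmod w)\<^sup>2) \<le> sqrt (1 + R\<^sup>2) * sqrt (1 + R\<^sup>2)"
    using assms R by (intro mult_mono) (auto intro!: power_mono simp: add_nonneg_nonneg)
  also have "\<dots> = 1 + R\<^sup>2" by (simp add: add_nonneg_nonneg)
  finally have a: "sqrt (1 + (cmod z)\<^sup>2) * sqrt (1 + (cmod w)\<^sup>2) \<le> 1 + R\<^sup>2" .
  have p: "sqrt (1 + (cmod z)\<^sup>2) * sqrt (1 + (cmod w)\<^sup>2) > 0"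
    by (simp add: add_pos_nonneg)
  have "2 * dist z w = (sqrt (1 + (cmod z)\<^sup>2) * sqrt (1 + (cmod w)\<^sup>2)) * dist (emb z) (emb w)"
    unfolding dist_emb using p
    by (metis (no_types, lifting) dist_norm less_irrefl nonzero_mult_div_cancel_left times_divide_eq_right)
  also have "\<dots> \<le> (1 + R\<^sup>2) * dist (emb z) (emb w)"
    by (rule mult_right_mono[OF a]) simp
  finally show ?thesis by simp
qed

lemma continuous_on_Rep: "continuous_on A Rep_rsphere"
  unfolding continuous_on_iff dist_rsphere_def by blast

lemma continuous_on_emb [continuous_intros]:
  "continuous_on A f \<Longrightarrow> continuous_on A (\<lambda>x. emb (f x))"
proof -
  have "continuous_on UNIV emb"
    unfolding continuous_on_iff
  proof (intro ballI allI impI)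
    fix x :: complex and e :: real assume "e > 0"
    then show "\<exists>d>0. \<forall>x'\<in>UNIV. dist x' x < d \<longrightarrow> dist (emb x') (emb x) < e"
      using dist_emb_le by (intro exI[of _ "e/2"]) (smt (verit) field_sum_of_halves)
  qed
  then show "continuous_on A f \<Longrightarrow> continuous_on A (\<lambda>x. emb (f x))"
    by (metis continuous_on_compose2 subset_UNIV)
qed

lemma continuous_on_flip: "continuous_on A flip"
  unfolding continuous_on_iff by auto

lemma continuous_on_co: "continuous_on {x. x \<noteq> infty} co"
proof -
  let ?f = "\<lambda>x. complex_of_real (fst (Rep_rsphere x) / (1 - snd (snd (Rep_rsphere x)))) +
       \<i> * complex_of_real (fst (snd (Rep_rsphere x)) / (1 - snd (snd (Rep_rsphere x))))"
  have "co = ?f"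
    by (auto simp: co_def fun_eq_iff Complex_eq split: prod.split)
  moreover have "snd (snd (Rep_rsphere x)) \<noteq> 1" if "x \<noteq> infty" for x
    using Rep_rsphere_third[OF _ that] by (metis less_irrefl prod.collapse)
  then have "continuous_on {x. x \<noteq> infty} ?f"
    by (intro continuous_intros continuous_on_Rep) auto
  ultimately show ?thesis by (simp only:)
qed

lemma open_neq_infty: "open {x. x \<noteq> infty}"
  using open_Compl[OF closed_singleton, of infty] by (simp add: Compl_eq)

lemma emb_image_eq: "emb ` U = co -` U \<inter> {x. x \<noteq> infty}"
proof (intro set_eqI iffI)
  fix x assume "x \<in> co -` U \<inter> {x. x \<noteq> infty}"
  then show "x \<in> emb ` U" using emb_co[of x] by (auto intro!: image_eqI[of _ _ "co x"])
qed auto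

lemma open_emb_image: "open U \<Longrightarrow> open (emb ` U)"
  unfolding emb_image_eq
  using continuous_open_preimage[OF continuous_on_co open_neq_infty] by (simp add: Int_commute)

lemma flip_image: "flip ` A = flip -` A"
  by (auto intro!: image_eqI[of _ flip "flip _"])

lemma open_flip_image: "open A \<Longrightarrow> open (flip ` A)"
  unfolding flip_image by (rule open_vimage[OF _ continuous_on_flip])

lemma range_Rep: "range Rep_rsphere = sphere 0 1"
  using type_definition.Rep_range[OF type_definition_rsphere] by (auto simp: sphere_def dist_norm)

lemma Abs_sphere: "UNIV = Abs_rsphere ` sphere 0 1"
  unfolding range_Rep[symmetric] by (auto simp: image_image Rep_rsphere_inverse)

lemma continuous_on_Abs: "continuous_on (sphere 0 1) Abs_rsphere"
  unfolding continuous_on_iff dist_rsphere_def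
  unfolding range_Rep[symmetric] by (auto simp: Rep_rsphere_inverse)

lemma compact_UNIV_rsphere: "compact (UNIV :: rsphere set)"
  unfolding Abs_sphere by (intro compact_continuous_image continuous_on_Abs compact_sphere)

lemma connected_UNIV_rsphere: "connected (UNIV :: rsphere set)"
  unfolding Abs_sphere by (intro connected_continuous_image continuous_on_Abs connected_sphere) simp

text \<open>\<open>flip\<close> negates the height, so a point or its flip lies in the closed lower
  hemisphere, at distance at least sqrt 2 from the north pole. This case distinction lets local
  arguments be carried out in the finite chart only.\<close>

lemma hemisphere: obtains "dist x infty \<ge> sqrt 2" | "dist (flip x) infty \<ge> sqrt 2"
proof -
  obtain a b c where R: "Rep_rsphere x = (a, b, c)" by (metis prod_cases3)
  have "(dist x infty)\<^sup>2 = 2 - 2 * c" "(dist (flip x) infty)\<^sup>2 = 2 + 2 * c"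
    using dist_rsphere_sq[OF R Rep_infty] dist_rsphere_sq[OF Rep_flip[OF R] Rep_infty] by simp_all
  then have "2 \<le> (dist x infty)\<^sup>2 \<or> 2 \<le> (dist (flip x) infty)\<^sup>2" by linarith
  then have "sqrt 2 \<le> dist x infty \<or> sqrt 2 \<le> dist (flip x) infty"
    using real_le_lsqrt zero_le_dist by blast
  then show ?thesis using that by blast
qed

lemma cmod_co_le:
  assumes "dist x infty \<ge> d" "d > 0" shows "x = emb (co x)" "cmod (co x) \<le> 2 / d"
proof -
  have "x \<noteq> infty" using assms by auto
  then show x: "x = emb (co x)" by (simp add: emb_co)
  have p: "0 < sqrt (1 + (cmod (co x))\<^sup>2)" by (simp add: add_pos_nonneg)
  have "d \<le> 2 / sqrt (1 + (cmod (co x))\<^sup>2)" using assms(1) x dist_emb_infty by metis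
  then have "sqrt (1 + (cmod (co x))\<^sup>2) \<le> 2 / d"
    using p assms(2) by (simp add: field_simps)
  moreover have "cmod (co x) \<le> sqrt (1 + (cmod (co x))\<^sup>2)"
    by (simp add: real_le_rsqrt)
  ultimately show "cmod (co x) \<le> 2 / d" by linarith
qed

text \<open>Images of discs under the chart, or their flips. Needed so that Fatou components are
  open and their boundary points lie outside the Fatou set.\<close>

lemma rsphere_locally_connected:
  fixes x :: rsphere
  assumes "open W" "x \<in> W"
  obtains D where "open D" "connected D" "x \<in> D" "D \<subseteq> W"
proof -
  have *: "\<exists>D. open D \<and> connected D \<and> x \<in> D \<and> D \<subseteq> W" if "open W" "x \<in> W" "x \<noteq> infty" for x W
  proof -
    have "open (emb -` W)" by (intro open_vimage that continuous_intros)
    moreover have "co x \<in> emb -` W" using that by (simp add: emb_co)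
    ultimately obtain e where e: "e > 0" "ball (co x) e \<subseteq> emb -` W" by (meson openE)
    have "connected (emb ` ball (co x) e)"
      by (intro connected_continuous_image continuous_intros) simp
    then show ?thesis using e that open_emb_image[OF open_ball] emb_co
      by (intro exI[of _ "emb ` ball (co x) e"]) (auto intro!: image_eqI[of _ _ "co x"])
  qed
  show ?thesis
  proof (cases "x = infty")
    case False
    then show ?thesis using *[OF assms] that by blast
  next
    case True
    have "flip x \<noteq> infty" using True by simp
    moreover have "open (flip ` W)" "flip x \<in> flip ` W" using assms open_flip_image by auto
    ultimately obtain D where D: "open D" "connected D" "flip x \<in> D" "D \<subseteq> flip ` W" using * by blast
    have "flip ` D \<subseteq> W" using D(4) by auto
    moreover have "x \<in> flip ` D" using D(3) by (metis flip_flip image_eqI)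
    ultimately show ?thesis
      using that[of "flip ` D"] D open_flip_image connected_continuous_image[OF continuous_on_flip] by blast
  qed
qed

section \<open>Holomorphic self-maps of the sphere\<close>

lemma to_ext_infty [simp]: "to_ext (Rep_rsphere infty) = None"
  by (simp add: Rep_infty to_ext_def)

lemma to_ext_emb [simp]: "to_ext (Rep_rsphere (emb z)) = Some z"
proof -
  obtain a b c where R: "Rep_rsphere (emb z) = (a, b, c)" by (metis prod_cases3)
  have "c < 1" using Rep_rsphere_third[OF R] by simp
  then have "to_ext (Rep_rsphere (emb z)) = Some (co (emb z))"
    by (simp add: R to_ext_def co_def)
  then show ?thesis by simp
qed

text \<open>The point [a : b] of the projective line. The meaningless [0 : 0] is sent to
  \<open>infty\<close>, which is why later lemmas assume that a and b do not both vanish.\<close>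

definition hom :: "complex \<Rightarrow> complex \<Rightarrow> rsphere" where
  "hom a b = (if b \<noteq> 0 then emb (a / b) else infty)"

lemma flip_hom: "a \<noteq> 0 \<or> b \<noteq> 0 \<Longrightarrow> flip (hom a b) = hom b a"
  by (auto simp: hom_def flip_emb)

lemma continuous_on_hom:
  fixes P Q :: "complex \<Rightarrow> complex"
  assumes P: "continuous_on UNIV P" and Q: "continuous_on UNIV Q" and nz: "\<And>z. P z \<noteq> 0 \<or> Q z \<noteq> 0"
  shows "continuous_on UNIV (\<lambda>z. hom (P z) (Q z))"
proof -
  have *: "continuous_on {z. B z \<noteq> 0} (\<lambda>z. hom (A z) (B z))"
    if "continuous_on UNIV A" "continuous_on UNIV B" for A B :: "complex \<Rightarrow> complex"
  proof -
    have "continuous_on {z. B z \<noteq> 0} (\<lambda>z. emb (A z / B z))"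
      by (intro continuous_intros continuous_on_subset[OF that(1)] continuous_on_subset[OF that(2)]) auto
    then show ?thesis by (rule continuous_on_eq) (auto simp: hom_def)
  qed
  have "continuous_on {z. P z \<noteq> 0} (\<lambda>z. flip (hom (Q z) (P z)))"
    using continuous_on_compose[OF *[OF Q P] continuous_on_flip] by (simp add: o_def)
  then have 1: "continuous_on {z. P z \<noteq> 0} (\<lambda>z. hom (P z) (Q z))"
    by (rule continuous_on_eq) (auto simp: flip_hom)
  have o: "open {z. A z \<noteq> 0}" if "continuous_on UNIV A" for A :: "complex \<Rightarrow> complex"
    using open_Collect_neq[OF that continuous_on_const] .
  have "continuous_on ({z. P z \<noteq> 0} \<union> {z. Q z \<noteq> 0}) (\<lambda>z. hom (P z) (Q z))"
    by (rule continuous_on_open_Un[OF o[OF P] o[OF Q] 1 *[OF P Q]])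
  moreover have "{z. P z \<noteq> 0} \<union> {z. Q z \<noteq> 0} = UNIV" using nz by auto
  ultimately show ?thesis by simp
qed

lemma rsphere_continuousI:
  assumes "continuous_on UNIV (\<lambda>z. f (emb z))" "continuous_on UNIV (\<lambda>z. f (flip (emb z)))"
  shows "continuous_on UNIV f"
proof -
  have *: "continuous_on {x. x \<noteq> infty} h" if "continuous_on UNIV (\<lambda>z. h (emb z))" for h :: "rsphere \<Rightarrow> 'a"
    using continuous_on_compose2[OF that continuous_on_co subset_UNIV]
    by (rule continuous_on_eq) (simp add: emb_co)
  have "continuous_on {x. x \<noteq> emb 0} (\<lambda>x. (\<lambda>y. f (flip y)) (flip x))"
    by (rule continuous_on_compose2[OF *[OF assms(2)] continuous_on_flip])
       (metis (mono_tags) flip_flip flip_infty image_subsetI mem_Collect_eq)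
  then have 2: "continuous_on {x. x \<noteq> emb 0} f" by simp
  have o: "open {x. x \<noteq> y}" for y :: rsphere
    using open_Compl[OF closed_singleton, of y] by (simp add: Compl_eq)
  have "continuous_on ({x. x \<noteq> infty} \<union> {x. x \<noteq> emb 0}) f"
    by (rule continuous_on_open_Un[OF o o *[OF assms(1)] 2])
  moreover have "{x. x \<noteq> infty} \<union> {x. x \<noteq> emb 0} = UNIV"
    by (auto simp del: emb_neq_infty) (metis emb_neq_infty(2))
  ultimately show ?thesis by simp
qed

definition hol0 :: "(rsphere \<Rightarrow> rsphere) \<Rightarrow> bool" where
  "hol0 f = (\<forall>z. f (emb z) \<noteq> infty \<longrightarrow> (\<lambda>w. co (f (emb w))) field_differentiable at z)"

text \<open>Composing with \<open>flip\<close> on either side switches between the charts \<open>z\<close> and \<open>1 / z\<close>.\<close>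

definition Hol :: "(rsphere \<Rightarrow> rsphere) \<Rightarrow> bool" where
  "Hol f = (continuous_on UNIV f \<and> hol0 f \<and> hol0 (flip \<circ> f) \<and> hol0 (f \<circ> flip) \<and> hol0 (flip \<circ> f \<circ> flip))"

lemma flip_o_flip [simp]: "flip \<circ> flip = id" "flip \<circ> (flip \<circ> f) = f" "f \<circ> flip \<circ> flip = f"
  by (auto simp: fun_eq_iff)

lemma Hol_continuous: "Hol f \<Longrightarrow> continuous_on A f"
  using Hol_def continuous_on_subset by blast

lemma Hol_flip: assumes "Hol f" shows "Hol (flip \<circ> f)" "Hol (f \<circ> flip)"
proof -
  have c: "continuous_on UNIV f" using assms by (simp add: Hol_def)
  have "continuous_on UNIV (flip \<circ> f)"
    using continuous_on_compose[OF c continuous_on_flip] .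
  then show "Hol (flip \<circ> f)" using assms by (simp add: Hol_def o_assoc)
  have "continuous_on UNIV (f \<circ> flip)"
    using continuous_on_compose[OF continuous_on_flip continuous_on_subset[OF c]] by blast
  then show "Hol (f \<circ> flip)" using assms by (simp add: Hol_def o_assoc)
qed

lemma field_differentiable_transform_within_open:
  assumes "f field_differentiable at a" "open S" "a \<in> S" "\<And>x. x \<in> S \<Longrightarrow> f x = g x"
  shows "g field_differentiable at a"
  using assms has_field_derivative_transform_within_open unfolding field_differentiable_def by metis

lemma hol0_hom:
  assumes P: "P holomorphic_on UNIV" and Q: "Q holomorphic_on UNIV"
    and f: "\<And>z. f (emb z) = hom (P z) (Q z)"
  shows "hol0 f"
  unfolding hol0_def
proof (intro allI impI)
  fix z assume "f (emb z) \<noteq> infty"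
  then have z: "Q z \<noteq> 0" by (auto simp: f hom_def split: if_splits)
  have 1: "(\<lambda>w. P w / Q w) field_differentiable at z"
    using P Q z by (intro field_differentiable_divide) (auto simp: holomorphic_on_def)
  have 2: "open {w. Q w \<noteq> 0}"
    using open_Collect_neq[OF holomorphic_on_imp_continuous_on[OF Q] continuous_on_const] .
  have 3: "P w / Q w = co (f (emb w))" if "w \<in> {w. Q w \<noteq> 0}" for w
    using that by (simp add: f hom_def)
  show "(\<lambda>w. co (f (emb w))) field_differentiable at z"
    by (rule field_differentiable_transform_within_open[OF 1 2 _ 3]) (use z in auto)
qed

text \<open>Where \<open>g\<close> takes the value \<open>infty\<close>, write
  \<open>f \<circ> g\<close> as \<open>(f \<circ> flip) \<circ> (flip \<circ> g)\<close>; the inner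
  value is then finite. Hence the assumptions on the flipped maps.\<close>

lemma hol0_comp:
  assumes f: "hol0 f" "hol0 (f \<circ> flip)" and g: "hol0 g" "hol0 (flip \<circ> g)" "continuous_on UNIV g"
  shows "hol0 (f \<circ> g)"
proof -
  have *: "(\<lambda>w. co (f' (g' (emb w)))) field_differentiable at z"
    if "hol0 f'" "hol0 g'" "continuous_on UNIV g'" "f' (g' (emb z)) \<noteq> infty" "g' (emb z) \<noteq> infty" for f' g' z
  proof -
    let ?u = "\<lambda>w. co (g' (emb w))"
    have 0: "?u field_differentiable at z" using that by (simp add: hol0_def)
    have "(\<lambda>w. co (f' (emb w))) field_differentiable at (?u z)"
      using that by (simp add: hol0_def emb_co)
    with 0 have 1: "((\<lambda>w. co (f' (emb w))) \<circ> ?u) field_differentiable at z"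
      by (rule field_differentiable_compose)
    have 2: "open {w. g' (emb w) \<noteq> infty}"
    proof -
      have "continuous_on UNIV (\<lambda>w. g' (emb w))"
        by (rule continuous_on_compose2[OF that(3)]) (auto intro!: continuous_intros)
      from open_vimage[OF open_neq_infty this] show ?thesis by (simp add: vimage_def)
    qed
    have 3: "((\<lambda>w. co (f' (emb w))) \<circ> ?u) x = co (f' (g' (emb x)))" if "x \<in> {w. g' (emb w) \<noteq> infty}" for x
      using that by (simp add: emb_co)
    show ?thesis
      by (rule field_differentiable_transform_within_open[OF 1 2 _ 3]) (use that(5) in auto)
  qed
  have c: "continuous_on UNIV (flip \<circ> g)"
    using continuous_on_compose[OF g(3) continuous_on_flip] .
  show ?thesis
    unfolding hol0_def
  proof (intro allI impI)
    fix z assume z: "(f \<circ> g) (emb z) \<noteq> infty"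
    show "(\<lambda>w. co ((f \<circ> g) (emb w))) field_differentiable at z"
    proof (cases "g (emb z) = infty")
      case False
      then show ?thesis using *[OF f(1) g(1,3), of z] z by simp
    next
      case True
      then show ?thesis using *[OF f(2) g(2) c, of z] z by simp
    qed
  qed
qed

lemma Hol_comp: assumes "Hol f" "Hol g" shows "Hol (f \<circ> g)"
proof -
  have c: "hol0 (f \<circ> g)" if "Hol f" "Hol g" for f g
    by (rule hol0_comp) (use that in \<open>simp_all add: Hol_def\<close>)
  have "hol0 (flip \<circ> (f \<circ> g))" "hol0 (f \<circ> g \<circ> flip)" "hol0 (flip \<circ> (f \<circ> g) \<circ> flip)"
    using c[OF Hol_flip(1)[OF assms(1)] assms(2)] c[OF assms(1) Hol_flip(2)[OF assms(2)]]
      c[OF Hol_flip(1)[OF assms(1)] Hol_flip(2)[OF assms(2)]]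
    by (simp_all add: o_assoc)
  moreover have "continuous_on UNIV (f \<circ> g)"
    by (intro continuous_on_compose Hol_continuous assms)
  ultimately show ?thesis using c[OF assms] unfolding Hol_def by simp
qed

lemma Hol_homI:
  assumes P: "P holomorphic_on UNIV" and Q: "Q holomorphic_on UNIV" and nz: "\<And>z. P z \<noteq> 0 \<or> Q z \<noteq> 0"
    and P': "P' holomorphic_on UNIV" and Q': "Q' holomorphic_on UNIV" and nz': "\<And>z. P' z \<noteq> 0 \<or> Q' z \<noteq> 0"
    and f: "\<And>z. f (emb z) = hom (P z) (Q z)" and f': "\<And>z. f (flip (emb z)) = hom (P' z) (Q' z)"
  shows "Hol f"
proof -
  have "continuous_on UNIV f"
    using continuous_on_hom[OF holomorphic_on_imp_continuous_on[OF P] holomorphic_on_imp_continuous_on[OF Q] nz]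
      continuous_on_hom[OF holomorphic_on_imp_continuous_on[OF P'] holomorphic_on_imp_continuous_on[OF Q'] nz']
    by (intro rsphere_continuousI) (simp_all add: f f')
  moreover have "hol0 f" by (rule hol0_hom[OF P Q f])
  moreover have "hol0 (flip \<circ> f)" by (rule hol0_hom[OF Q P]) (simp add: f flip_hom[OF nz])
  moreover have "hol0 (f \<circ> flip)" by (rule hol0_hom[OF P' Q']) (simp add: f')
  moreover have "hol0 (flip \<circ> f \<circ> flip)" by (rule hol0_hom[OF Q' P']) (simp add: f' flip_hom[OF nz'])
  ultimately show ?thesis by (simp add: Hol_def)
qed

lemma coprime_poly_not_both_zero:
  fixes p q :: "complex poly" assumes "coprime p q" shows "poly p z \<noteq> 0 \<or> poly q z \<noteq> 0"
  using coprime_poly_0[OF assms] by blast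

lemma hom_scale: "c \<noteq> 0 \<Longrightarrow> hom (c * a) (c * b) = hom a b"
  by (simp add: hom_def)

lemma Rat_Hol: assumes "g \<in> Rat" shows "Hol g"
proof -
  obtain p q where q: "q \<noteq> 0" and cop: "coprime p q" and deg: "max (degree p) (degree q) \<ge> 1"
    and g: "g = rat_map p q" using assms by (auto simp: Rat_def)
  define n where "n = max (degree p) (degree q)"
  \<comment> \<open>\<open>R s\<close> is z^n s(1/z), the reversal relative to the common degree
    \<open>n\<close>. So \<open>R p\<close> and \<open>R q\<close> represent \<open>g\<close> in the
    chart at infinity, including at z = 0.\<close>
  define R where "R s = monom 1 (n - degree s) * reflect_poly s" for s :: "complex poly"
  have R1: "poly (R s) z = z ^ n * poly s (1 / z)" if "degree s \<le> n" "z \<noteq> 0" for s z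
  proof -
    have "z ^ (n - degree s) * z ^ degree s = z ^ n" using that by (simp flip: power_add)
    then show ?thesis using that
      by (simp add: R_def poly_monom poly_reflect_poly_nz inverse_eq_divide mult.assoc[symmetric])
  qed
  have R0: "poly (R s) 0 = (if degree s = n then lead_coeff s else 0)" if "degree s \<le> n" for s
    using that by (simp add: R_def poly_monom zero_power)
  have g_emb: "g (emb z) = hom (poly p z) (poly q z)" for z
    by (simp add: g rat_map_def rat_eval_def hom_def emb_def[symmetric])
       (simp add: infty_def of_ext_def)
  have dn: "degree p \<le> n" "degree q \<le> n" by (simp_all add: n_def)
  have nz: "poly p z \<noteq> 0 \<or> poly q z \<noteq> 0" for z by (rule coprime_poly_not_both_zero[OF cop])
  have g_infty: "g infty = hom (poly (R p) 0) (poly (R q) 0)"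
    unfolding R0[OF dn(1)] R0[OF dn(2)] using q
    by (auto simp: g rat_map_def rat_eval_def hom_def emb_def[symmetric] n_def max_def)
       (auto simp add: infty_def of_ext_def)
  have g_flip: "g (flip (emb z)) = hom (poly (R p) z) (poly (R q) z)" for z
  proof (cases "z = 0")
    case True
    then show ?thesis using g_infty by simp
  next
    case False
    then show ?thesis
      by (simp add: flip_emb g_emb R1 dn hom_scale)
  qed
  have nz': "poly (R p) z \<noteq> 0 \<or> poly (R q) z \<noteq> 0" for z
  proof (cases "z = 0")
    case True
    \<comment> \<open>The zero polynomial has degree 0, so \<open>deg\<close> is what makes the
      leading coefficient nonzero here.\<close>
    have "p \<noteq> 0" if "degree p = n" using that deg n_def by auto
    then show ?thesis using True q dn by (auto simp: R0 n_def max_def)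
  next
    case False
    then show ?thesis using nz[of "1 / z"] by (simp add: R1 dn)
  qed
  have h: "(\<lambda>z. poly s z) holomorphic_on UNIV" for s :: "complex poly"
    by (intro holomorphic_intros)
  show ?thesis by (rule Hol_homI[OF h h nz h h nz' g_emb g_flip])
qed

section \<open>Cauchy estimates and Lipschitz bounds that are uniform over families of maps\<close>

lemma Hol_holomorphic:
  assumes "Hol f" "\<And>w. w \<in> A \<Longrightarrow> f (emb w) \<noteq> infty"
  shows "(\<lambda>w. co (f (emb w))) holomorphic_on A"
  using assms unfolding holomorphic_on_def Hol_def hol0_def
  by (meson field_differentiable_at_within)

text \<open>Cauchy's estimate on circles of radius r/2 bounds the derivative by B / (r/2).\<close>

lemma bounded_holomorphic_lipschitz:
  assumes r: "r > 0" and f: "f holomorphic_on ball z0 (2 * r)" and B: "\<And>z. z \<in> ball z0 (2 * r) \<Longrightarrow> cmod (f z) \<le> B"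
    and z: "z \<in> ball z0 r" and w: "w \<in> ball z0 r"
  shows "cmod (f z - f w) \<le> 2 * B / r * cmod (z - w)"
proof (rule field_differentiable_bound[of "ball z0 r" f "deriv f"])
  show "(f has_field_derivative deriv f x) (at x within ball z0 r)" if "x \<in> ball z0 r" for x
  proof -
    have "x \<in> ball z0 (2 * r)" using that r by auto
    then show ?thesis using f holomorphic_derivI by blast
  qed
  show "cmod (deriv f x) \<le> 2 * B / r" if x: "x \<in> ball z0 r" for x
  proof -
    have sub: "cball x (r/2) \<subseteq> ball z0 (2 * r)"
    proof
      fix y assume "y \<in> cball x (r/2)"
      then show "y \<in> ball z0 (2 * r)" using x r dist_triangle[of z0 y x] by (auto simp: dist_commute)
    qed
    have "cmod ((deriv ^^ 1) f x) \<le> fact 1 * B / (r/2) ^ 1"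
    proof (rule Cauchy_inequality)
      show "f holomorphic_on ball x (r/2)" using f sub ball_subset_cball holomorphic_on_subset by blast
      show "continuous_on (cball x (r/2)) f"
        using f sub holomorphic_on_imp_continuous_on continuous_on_subset by blast
      show "0 < r / 2" using r by simp
      show "cmod (f y) \<le> B" if "cmod (x - y) = r / 2" for y
        using B sub that by (auto simp: dist_norm)
    qed
    then show ?thesis by (simp add: mult.commute)
  qed
qed (use z w in auto)

lemma emb_ball_nhds:
  assumes "s > 0" obtains r where "r > 0" "ball (emb z0) r \<subseteq> emb ` ball z0 s"
  using open_emb_image[OF open_ball, of z0 s] assms centre_in_ball
  by (meson image_eqI open_contains_ball)

text \<open>Maps staying 1/2 away from \<open>infty\<close> are bounded by 4 in the chart, so
  Cauchy's estimate is uniform over all of them: \<open>r\<close> and \<open>L\<close> are chosen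
  before \<open>g\<close>.\<close>

lemma Hol_equi_lipschitz_emb:
  assumes "\<rho> > 0"
  shows "\<exists>r>0. \<exists>L. \<forall>g. Hol g \<and> (\<forall>x\<in>ball (emb z0) \<rho>. dist (g x) infty \<ge> 1/2) \<longrightarrow>
     (\<forall>x\<in>ball (emb z0) r. \<forall>y\<in>ball (emb z0) r. dist (g x) (g y) \<le> L * dist x y)"
proof -
  \<comment> \<open>\<open>emb\<close> at most doubles distances, so the disc of radius 2 * s is
    mapped into the ball of radius \<rho>.\<close>
  define s where "s = \<rho> / 4"
  have s: "s > 0" using assms by (simp add: s_def)
  obtain r where r: "r > 0" "ball (emb z0) r \<subseteq> emb ` ball z0 s" using emb_ball_nhds[OF s] .
  define R where "R = cmod z0 + s"
  define D where "D = 2 * 4 / s"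
  have D: "D \<ge> 0" using s by (simp add: D_def)
  have "dist (g x) (g y) \<le> 2 * (D * ((1 + R\<^sup>2) / 2)) * dist x y"
    if g: "Hol g" "\<forall>x\<in>ball (emb z0) \<rho>. dist (g x) infty \<ge> 1/2"
      and x: "x \<in> ball (emb z0) r" and y: "y \<in> ball (emb z0) r" for g x y
  proof -
    let ?f = "\<lambda>w. co (g (emb w))"
    have sub: "emb w \<in> ball (emb z0) \<rho>" if "w \<in> ball z0 (2 * s)" for w
      using that dist_emb_le[of z0 w] by (auto simp: s_def)
    have g2: "g (emb w) = emb (?f w)" "cmod (?f w) \<le> 4" if "w \<in> ball z0 (2 * s)" for w
      using cmod_co_le[of "1/2" "g (emb w)"] g(2) sub[OF that] by auto
    have hol: "?f holomorphic_on ball z0 (2 * s)"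
      by (rule Hol_holomorphic[OF g(1)]) (metis g2(1) emb_neq_infty(1))
    obtain z w where zw: "x = emb z" "y = emb w" "z \<in> ball z0 s" "w \<in> ball z0 s"
      using x y r(2) by (meson imageE subsetD)
    then have zw2: "z \<in> ball z0 (2 * s)" "w \<in> ball z0 (2 * s)" using s by auto
    have zR: "cmod u \<le> R" if "u \<in> ball z0 s" for u
      using that norm_triangle_sub[of u z0] by (auto simp: R_def dist_norm norm_minus_commute)
    have "dist (g x) (g y) = dist (emb (?f z)) (emb (?f w))"
      using g2(1) zw zw2 by metis
    also have "\<dots> \<le> 2 * cmod (?f z - ?f w)" using dist_emb_le by (simp add: dist_norm)
    also have "\<dots> \<le> 2 * (D * cmod (z - w))"
      using bounded_holomorphic_lipschitz[OF s hol g2(2) zw(3,4)] by (simp add: D_def)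
    also have "\<dots> \<le> 2 * (D * ((1 + R\<^sup>2) / 2 * dist x y))"
      using dist_emb_ge[OF zR[OF zw(3)] zR[OF zw(4)]] zw D by (intro mult_left_mono) (auto simp: dist_norm)
    finally show ?thesis by (simp add: mult.assoc)
  qed
  then show ?thesis using r(1) by blast
qed

text \<open>One of \<open>y0\<close>, \<open>flip y0\<close> is at least sqrt 2 away from
  \<open>infty\<close>, so values within 1/2 of \<open>y0\<close> keep \<open>g\<close> or
  \<open>flip \<circ> g\<close> at distance at least 1/2 from it. Flipping the source treats
  \<open>x0 = infty\<close>.\<close>

lemma Hol_equi_lipschitz:
  fixes x0 y0 :: rsphere
  assumes "\<rho> > 0"
  shows "\<exists>r>0. \<exists>L. \<forall>g. Hol g \<and> (\<forall>x\<in>ball x0 \<rho>. dist (g x) y0 \<le> 1/2) \<longrightarrow>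
     (\<forall>x\<in>ball x0 r. \<forall>y\<in>ball x0 r. dist (g x) (g y) \<le> L * dist x y)"
proof -
  have *: "\<exists>r>0. \<exists>L. \<forall>g. Hol g \<and> (\<forall>x\<in>ball x0 \<rho>. dist (g x) y0 \<le> 1/2) \<longrightarrow>
     (\<forall>x\<in>ball x0 r. \<forall>y\<in>ball x0 r. dist (g x) (g y) \<le> L * dist x y)" if x0: "x0 \<noteq> infty" for x0
  proof -
    obtain z0 where z0: "x0 = emb z0" using x0 emb_co by metis
    obtain r L where r: "r > 0" and L: "\<And>g x y. Hol g \<Longrightarrow> (\<And>x. x\<in>ball (emb z0) \<rho> \<Longrightarrow> dist (g x) infty \<ge> 1/2) \<Longrightarrow>
     x\<in>ball (emb z0) r \<Longrightarrow> y\<in>ball (emb z0) r \<Longrightarrow> dist (g x) (g y) \<le> L * dist x y"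
      using Hol_equi_lipschitz_emb[OF assms, of z0] by blast
    have s2: "sqrt 2 \<ge> 1" by simp
    show ?thesis unfolding z0
    proof (rule exI[of _ r], rule conjI[OF r], rule exI[of _ L], intro allI impI ballI)
      fix g x y assume g: "Hol g \<and> (\<forall>x\<in>ball (emb z0) \<rho>. dist (g x) y0 \<le> 1/2)"
        and xy: "x\<in>ball (emb z0) r" "y\<in>ball (emb z0) r"
      show "dist (g x) (g y) \<le> L * dist x y"
      proof (rule hemisphere[of y0])
        assume y0: "sqrt 2 \<le> dist y0 infty"
        have "dist (g x) infty \<ge> 1/2" if "x\<in>ball (emb z0) \<rho>" for x
        proof -
          have "dist y0 (g x) \<le> 1/2" using g that by (metis dist_commute)
          then show ?thesis using y0 s2 dist_triangle[of y0 infty "g x"] by linarith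
        qed
        then show ?thesis using L g xy by blast
      next
        assume y0: "sqrt 2 \<le> dist (flip y0) infty"
        have "dist ((flip \<circ> g) x) infty \<ge> 1/2" if "x\<in>ball (emb z0) \<rho>" for x
        proof -
          have "dist (flip (g x)) (flip y0) \<le> 1/2" using g that by simp
          then show ?thesis using y0 s2 dist_triangle[of "flip y0" infty "flip (g x)"] unfolding o_apply dist_commute[of "flip (g x)" "flip y0"]
            by linarith
        qed
        then have "dist ((flip \<circ> g) x) ((flip \<circ> g) y) \<le> L * dist x y" using L[of "flip \<circ> g"] Hol_flip(1) g xy by blast
        then show ?thesis by simp
      qed
    qed
  qed
  show ?thesis
  proof (cases "x0 = infty")
    case False
    then show ?thesis by (rule *)
  next
    case True
    then have "flip x0 \<noteq> infty" by simp
    from *[OF this] obtain r L where r: "r > 0" and L: "\<And>g x y. Hol g \<Longrightarrow> (\<And>x. x\<in>ball (flip x0) \<rho> \<Longrightarrow> dist (g x) y0 \<le> 1/2) \<Longrightarrow>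
     x\<in>ball (flip x0) r \<Longrightarrow> y\<in>ball (flip x0) r \<Longrightarrow> dist (g x) (g y) \<le> L * dist x y" by blast
    have fl: "flip x \<in> ball (flip x0) t \<longleftrightarrow> x \<in> ball x0 t" for x t by simp
    show ?thesis
    proof (rule exI[of _ r], rule conjI[OF r], rule exI[of _ L], intro allI impI ballI)
      fix g x y assume g: "Hol g \<and> (\<forall>x\<in>ball x0 \<rho>. dist (g x) y0 \<le> 1/2)"
        and xy: "x\<in>ball x0 r" "y\<in>ball x0 r"
      have "dist ((g \<circ> flip) (flip x)) ((g \<circ> flip) (flip y)) \<le> L * dist (flip x) (flip y)"
      proof (rule L)
        show "Hol (g \<circ> flip)" using Hol_flip(2) g by blast
        show "dist ((g \<circ> flip) x) y0 \<le> 1/2" if "x\<in>ball (flip x0) \<rho>" for x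
          using g that fl[of "flip x"] by simp
      qed (use xy in auto)
      then show "dist (g x) (g y) \<le> L * dist x y" by simp
    qed
  qed
qed

section \<open>The space of rational maps\<close>

definition lip :: "real \<Rightarrow> (rsphere \<Rightarrow> rsphere) \<Rightarrow> bool" where
  "lip L g = (\<forall>x y. dist (g x) (g y) \<le> L * dist x y)"

lemma lipD: "lip L g \<Longrightarrow> dist (g x) (g y) \<le> L * dist x y"
  by (simp add: lip_def)

lemma lip_mono: "lip L g \<Longrightarrow> L \<le> L' \<Longrightarrow> lip L' g"
  unfolding lip_def by (meson mult_right_mono order_trans zero_le_dist)

lemma dist_le_kappa: "dist (f z) (g z) \<le> kappa f g"
  unfolding kappa_def
  by (rule cSUP_upper2[of _ _ z]) (auto intro!: bdd_aboveI[of _ 2] dist_le_2)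

lemma kappa_le: "(\<And>z. dist (f z) (g z) \<le> c) \<Longrightarrow> kappa f g \<le> c"
  unfolding kappa_def by (rule cSUP_least) auto

lemma kappa_commute: "kappa f g = kappa g f"
  by (simp add: kappa_def dist_commute)

lemma Metric_space_Rat: "Metric_space Rat kappa"
proof
  show "0 \<le> kappa f g" for f g
    using dist_le_kappa[of f infty g] zero_le_dist order_trans by blast
  show "kappa f g = kappa g f" for f g by (rule kappa_commute)
  show "kappa f g = 0 \<longleftrightarrow> f = g" for f g
  proof
    assume k: "kappa f g = 0"
    have "dist (f z) (g z) \<le> 0" for z using dist_le_kappa[of f z g] k by simp
    then show "f = g" by (simp add: fun_eq_iff)
  qed (simp add: kappa_def)
  show "kappa f h \<le> kappa f g + kappa g h" for f g h
  proof (rule kappa_le)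
    fix z
    show "dist (f z) (h z) \<le> kappa f g + kappa g h"
      using dist_triangle[of "f z" "h z" "g z"] dist_le_kappa[of f z g] dist_le_kappa[of g z h] by linarith
  qed
qed

interpretation RM: Metric_space Rat kappa
  by (rule Metric_space_Rat)

text \<open>Where \<open>g0\<close> oscillates by less than 1/4, every map within 1/4 of
  \<open>g0\<close> has values within 1/2 of one point, so the local Cauchy bounds do not depend on
  the map. Compactness makes them global.\<close>

lemma Rat_local_lip:
  assumes g0: "g0 \<in> Rat"
  shows "\<exists>L. \<forall>g\<in>Rat. kappa g0 g < 1/4 \<longrightarrow> lip L g"
proof -
  have "\<exists>r>0. \<exists>L. \<forall>g\<in>Rat. kappa g0 g < 1/4 \<longrightarrow> (\<forall>x\<in>ball x0 r. \<forall>y\<in>ball x0 r. dist (g x) (g y) \<le> L * dist x y)" for x0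
  proof -
    have "continuous_on UNIV g0" by (rule Hol_continuous[OF Rat_Hol[OF g0]])
    then obtain \<rho> where \<rho>: "\<rho> > 0" "\<And>x. dist x x0 < \<rho> \<Longrightarrow> dist (g0 x) (g0 x0) < 1/4"
      unfolding continuous_on_iff by (metis UNIV_I zero_less_divide_1_iff zero_less_numeral)
    obtain r L where r: "r > 0" and L: "\<And>g. Hol g \<Longrightarrow> (\<forall>x\<in>ball x0 \<rho>. dist (g x) (g0 x0) \<le> 1/2) \<Longrightarrow>
        (\<forall>x\<in>ball x0 r. \<forall>y\<in>ball x0 r. dist (g x) (g y) \<le> L * dist x y)"
      using Hol_equi_lipschitz[OF \<rho>(1), of x0 "g0 x0"] by blast
    have "\<forall>x\<in>ball x0 r. \<forall>y\<in>ball x0 r. dist (g x) (g y) \<le> L * dist x y" if g: "g \<in> Rat" "kappa g0 g < 1/4" for g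
    proof (rule L)
      show "Hol g" using g Rat_Hol by blast
      show "\<forall>x\<in>ball x0 \<rho>. dist (g x) (g0 x0) \<le> 1/2"
      proof
        fix x assume "x \<in> ball x0 \<rho>"
        then have "dist (g0 x) (g0 x0) < 1/4" using \<rho>(2)[of x] by (simp only: mem_ball dist_commute)
        then show "dist (g x) (g0 x0) \<le> 1/2"
          using dist_triangle[of "g x" "g0 x0" "g0 x"] dist_le_kappa[of g0 x g] g(2) dist_commute[of "g x" "g0 x"]
          by linarith
      qed
    qed
    then show ?thesis using r by blast
  qed
  then obtain r L where r: "\<And>x0. r x0 > 0" and L: "\<And>x0 g x y. g\<in>Rat \<Longrightarrow> kappa g0 g < 1/4 \<Longrightarrow> x\<in>ball x0 (r x0) \<Longrightarrow> y\<in>ball x0 (r x0) \<Longrightarrow> dist (g x) (g y) \<le> L x0 * dist x y"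
    by metis
  obtain C where C: "finite C" "UNIV \<subseteq> (\<Union>c\<in>C. ball c (r c))"
    by (rule compactE_image[OF compact_UNIV_rsphere, of UNIV "\<lambda>c. ball c (r c)"]) (use r in auto)
  obtain e where e: "e > 0" "\<And>x. \<exists>G\<in>(\<lambda>c. ball c (r c)) ` C. ball x e \<subseteq> G"
    by (rule Heine_Borel_lemma[OF compact_UNIV_rsphere, of "(\<lambda>c. ball c (r c)) ` C"]) (use C in auto)
  \<comment> \<open>The sum serves pairs closer than the Lebesgue number \<open>e\<close>; for all
    others the diameter 2 of the sphere is at most 2 / e times their distance.\<close>
  define K where "K = (\<Sum>c\<in>C. \<bar>L c\<bar>) + 2 / e"
  have "lip K g" if g: "g\<in>Rat" "kappa g0 g < 1/4" for g
    unfolding lip_def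
  proof (intro allI)
    fix x y
    have S0: "0 \<le> (\<Sum>c\<in>C. \<bar>L c\<bar>)" by (simp add: sum_nonneg)
    show "dist (g x) (g y) \<le> K * dist x y"
    proof (cases "dist x y < e")
      case True
      obtain c where c: "c \<in> C" "ball x e \<subseteq> ball c (r c)" using e(2)[of x] by blast
      have "x \<in> ball x e" "y \<in> ball x e" using True e(1) by auto
      then have "x \<in> ball c (r c)" "y \<in> ball c (r c)" using c(2) by blast+
      then have "dist (g x) (g y) \<le> L c * dist x y" by (rule L[OF g])
      also have "L c \<le> K"
        using member_le_sum[OF c(1), of "\<lambda>c. \<bar>L c\<bar>"] C(1) e(1) by (auto simp: K_def) (smt (verit) divide_pos_pos)
      finally show ?thesis by (simp add: mult_right_mono)
    next
      case False
      have "dist (g x) (g y) \<le> 2 / e * e" using dist_le_2 e(1) by simp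
      also have "\<dots> \<le> K * dist x y" using False e(1) S0 by (intro mult_mono) (auto simp: K_def)
      finally show ?thesis .
    qed
  qed
  then show ?thesis by blast
qed

lemma Rat_lip: assumes "g \<in> Rat" shows "\<exists>L. lip L g"
  using Rat_local_lip[OF assms] assms by (metis RM.zero zero_less_divide_1_iff zero_less_numeral)

lemma compactin_Rat_lip:
  assumes "compactin Rat_topology K"
  obtains L where "L > 0" "\<And>g. g \<in> K \<Longrightarrow> lip L g"
proof -
  have K: "K \<subseteq> Rat" using compactin_subset_topspace[OF assms] by (simp add: Rat_topology_def)
  obtain \<Lambda> where \<Lambda>: "\<And>g0 g. g0 \<in> Rat \<Longrightarrow> g \<in> Rat \<Longrightarrow> kappa g0 g < 1/4 \<Longrightarrow> lip (\<Lambda> g0) g"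
    using Rat_local_lip by metis
  have "\<exists>\<F>. finite \<F> \<and> \<F> \<subseteq> (\<lambda>g. RM.mball g (1/4)) ` K \<and> K \<subseteq> \<Union>\<F>"
  proof (rule compactinD[OF assms])
    show "openin Rat_topology U" if "U \<in> (\<lambda>g. RM.mball g (1/4)) ` K" for U
      using that by (auto simp: Rat_topology_def simp del: RM.in_mball)
    have "g \<in> RM.mball g (1/4)" if "g \<in> K" for g
      unfolding RM.centre_in_mball_iff using that K by auto
    then show "K \<subseteq> \<Union>((\<lambda>g. RM.mball g (1/4)) ` K)" by blast
  qed
  then obtain \<F> where F: "finite \<F>" "\<F> \<subseteq> (\<lambda>g. RM.mball g (1/4)) ` K" "K \<subseteq> \<Union>\<F>" by blast
  obtain C where C: "finite C" "C \<subseteq> K" "\<F> = (\<lambda>g. RM.mball g (1/4)) ` C"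
    using finite_subset_image[OF F(1,2)] by blast
  have "lip ((\<Sum>c\<in>C. \<bar>\<Lambda> c\<bar>) + 1) g" if g: "g \<in> K" for g
  proof -
    obtain c where c: "c \<in> C" "g \<in> RM.mball c (1/4)" using F(3) C(3) g by blast
    then have "lip (\<Lambda> c) g" using \<Lambda> by simp
    then show ?thesis
    proof (rule lip_mono)
      have "\<bar>\<Lambda> c\<bar> \<le> (\<Sum>c\<in>C. \<bar>\<Lambda> c\<bar>)"
        by (rule member_le_sum[OF c(1)]) (use C(1) in auto)
      then show "\<Lambda> c \<le> (\<Sum>c\<in>C. \<bar>\<Lambda> c\<bar>) + 1" by linarith
    qed
  qed
  moreover have "(\<Sum>c\<in>C. \<bar>\<Lambda> c\<bar>) + 1 > 0" by (smt (verit) sum_nonneg abs_ge_zero)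
  ultimately show ?thesis using that by blast
qed

text \<open>A uniformly Lipschitz family on a compact space is totally bounded, so \<open>Rat\<close> is separable.\<close>

lemma Rat_separable:
  assumes e: "e > 0"
  shows "\<exists>\<C>. countable \<C> \<and> Rat = \<Union>\<C> \<and> (\<forall>C\<in>\<C>. \<forall>f\<in>C. \<forall>g\<in>C. kappa f g \<le> 4 * e)"
proof -
  have tb: "\<exists>k. finite k \<and> (UNIV :: rsphere set) \<subseteq> (\<Union>x\<in>k. ball x \<epsilon>)" if "\<epsilon> > 0" for \<epsilon>
    using compact_UNIV_rsphere that unfolding compact_eq_totally_bounded by blast
  obtain Y :: "rsphere set" where Y: "finite Y" "UNIV \<subseteq> (\<Union>x\<in>Y. ball x e)" using tb[OF e] by blast
  have "\<exists>k. finite k \<and> (UNIV :: rsphere set) \<subseteq> (\<Union>x\<in>k. ball x (e / (real n + 1)))" for n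
    by (rule tb) (use e in auto)
  then obtain X :: "nat \<Rightarrow> rsphere set" where X: "\<And>n. finite (X n)" "\<And>n. UNIV \<subseteq> (\<Union>x\<in>X n. ball x (e / (real n + 1)))"
    by metis
  \<comment> \<open>A map with Lipschitz constant n moves by at most \<open>e\<close> between points
    of the net \<open>X n\<close>, whose spacing is e / (n + 1). Two maps in one
    \<open>T n s\<close> thus differ by at most 4 * e: two such moves and two errors on the
    net.\<close>
  define T where "T n s = {g \<in> Rat. lip (real n) g \<and> (\<forall>x\<in>X n. dist (s x) (g x) < e)}" for n and s :: "rsphere \<Rightarrow> rsphere"
  define \<C> where "\<C> = (\<Union>n. T n ` (PiE (X n) (\<lambda>_. Y)))"
  show ?thesis
  proof (intro exI[of _ \<C>] conjI ballI)
    show "countable \<C>"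
      unfolding \<C>_def
      by (rule countable_UN[OF countableI_type]) (intro countable_finite finite_imageI finite_PiE X Y)
    have "\<Union>\<C> \<subseteq> Rat" by (auto simp: \<C>_def T_def)
    moreover have "Rat \<subseteq> \<Union>\<C>"
    proof
      fix g assume g: "g \<in> Rat"
      obtain L where L: "lip L g" using Rat_lip[OF g] by blast
      obtain n where "L \<le> real n" using real_arch_simple by blast
      then have n: "lip (real n) g" using lip_mono L by blast
      have "\<forall>x. \<exists>y\<in>Y. dist y (g x) < e" using Y(2) by (auto simp: subset_eq)
      then obtain s where s: "\<And>x. s x \<in> Y" "\<And>x. dist (s x) (g x) < e" by metis
      have "restrict s (X n) \<in> PiE (X n) (\<lambda>_. Y)" using s by auto
      moreover have "g \<in> T n (restrict s (X n))" using g n s by (auto simp: T_def)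
      ultimately show "g \<in> \<Union>\<C>" unfolding \<C>_def by blast
    qed
    ultimately show "Rat = \<Union>\<C>" by blast
    show "kappa f g \<le> 4 * e" if C: "C \<in> \<C>" "f \<in> C" "g \<in> C" for C f g
    proof (rule kappa_le)
      fix z
      obtain n s where ns: "C = T n s" using C by (auto simp: \<C>_def)
      obtain x where x: "x \<in> X n" "dist x z < e / (real n + 1)" using X(2)[of n] by (auto simp: subset_eq)
      have "real n * dist x z \<le> (real n + 1) * (e / (real n + 1))"
        using x(2) by (intro mult_mono) auto
      also have "\<dots> = e" by simp
      finally have nd: "real n * dist x z \<le> e" .
      have f: "dist (f x) (f z) \<le> real n * dist x z" "dist (s x) (f x) < e"
        and g: "dist (g x) (g z) \<le> real n * dist x z" "dist (s x) (g x) < e"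
        using C x(1) by (auto simp: ns T_def lip_def)
      have "dist (f z) (g z) \<le> dist (f x) (f z) + dist (s x) (f x) + (dist (s x) (g x) + dist (g x) (g z))"
        by (smt (verit) dist_triangle dist_commute)
      then show "dist (f z) (g z) \<le> 4 * e" using f g nd by linarith
    qed
  qed
qed

section \<open>Measurability and the support of the random map\<close>

locale random_rational =
  fixes \<tau> :: "(rsphere \<Rightarrow> rsphere) measure"
  assumes tau: "\<tau> \<in> prob_meas_cpt"
begin

sublocale prob_space \<tau>
  using tau by (simp add: prob_meas_cpt_def)

abbreviation "\<Gamma> \<equiv> supp_meas \<tau>"

lemma space_tau [simp]: "space \<tau> = Rat"
  using tau by (simp add: prob_meas_cpt_def)

lemma sets_tau: "openin Rat_topology U \<Longrightarrow> U \<in> sets \<tau>"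
  using tau by (auto simp: prob_meas_cpt_def)

lemma Gamma_Rat: "g \<in> \<Gamma> \<Longrightarrow> g \<in> Rat"
  by (simp add: supp_meas_def)

text \<open>Compactness of the support lets one constant serve all of \<Gamma>. It is behind the
  continuity and Hoelder bounds for \<open>M\<close> and the choice of neighbourhoods in the maximum
  principle.\<close>

definition Lc :: real where
  "Lc = (SOME L. L > 0 \<and> (\<forall>g\<in>\<Gamma>. lip L g))"

lemma Lc: "Lc > 0" "g \<in> \<Gamma> \<Longrightarrow> lip Lc g"
proof -
  have "compactin Rat_topology \<Gamma>" using tau by (simp add: prob_meas_cpt_def)
  then have "\<exists>L. L > 0 \<and> (\<forall>g\<in>\<Gamma>. lip L g)" using compactin_Rat_lip by metis
  from someI_ex[OF this] show "Lc > 0" "g \<in> \<Gamma> \<Longrightarrow> lip Lc g" unfolding Lc_def by auto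
qed

lemma measurable_kappa_continuous:
  fixes h :: "(rsphere \<Rightarrow> rsphere) \<Rightarrow> 'b::topological_space"
  assumes "\<And>g U. g \<in> Rat \<Longrightarrow> open U \<Longrightarrow> h g \<in> U \<Longrightarrow> \<exists>d>0. \<forall>g'\<in>Rat. kappa g g' < d \<longrightarrow> h g' \<in> U"
  shows "h \<in> borel_measurable \<tau>"
proof (rule borel_measurableI)
  fix U :: "'b set" assume U: "open U"
  have "openin Rat_topology (h -` U \<inter> Rat)"
    unfolding Rat_topology_def RM.openin_mtopology
  proof (intro conjI allI impI)
    fix g assume "g \<in> h -` U \<inter> Rat"
    then obtain d where "d > 0" "\<forall>g'\<in>Rat. kappa g g' < d \<longrightarrow> h g' \<in> U" using assms U by blast
    then show "\<exists>r>0. RM.mball g r \<subseteq> h -` U \<inter> Rat" by (intro exI[of _ d]) auto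
  qed auto
  then show "h -` U \<inter> space \<tau> \<in> sets \<tau>" using sets_tau by simp
qed

lemma measurable_eval:
  fixes u :: "rsphere \<times> rsphere \<Rightarrow> 'b::topological_space"
  assumes "continuous_on UNIV u"
  shows "(\<lambda>g. u (g x, g y)) \<in> borel_measurable \<tau>"
proof (rule measurable_kappa_continuous)
  fix g :: "rsphere \<Rightarrow> rsphere" and U assume U: "open U" "u (g x, g y) \<in> U"
  have "open (u -` U)" by (rule open_vimage[OF U(1) assms])
  then obtain A B where AB: "open A" "open B" "(g x, g y) \<in> A \<times> B" "A \<times> B \<subseteq> u -` U"
    using U(2) by (metis open_prod_elim vimageI)
  obtain a where a: "a > 0" "ball (g x) a \<subseteq> A" using AB openE by blast
  obtain b where b: "b > 0" "ball (g y) b \<subseteq> B" using AB openE by blast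
  show "\<exists>d>0. \<forall>g'\<in>Rat. kappa g g' < d \<longrightarrow> u (g' x, g' y) \<in> U"
  proof (intro exI[of _ "min a b"] conjI ballI impI)
    fix g' assume "kappa g g' < min a b"
    then have "g' x \<in> ball (g x) a" "g' y \<in> ball (g y) b"
      using dist_le_kappa[of g x g'] dist_le_kappa[of g y g'] by auto
    then show "u (g' x, g' y) \<in> U" using a b AB by blast
  qed (use a b in auto)
qed

lemma kball_sets: "g \<in> Rat \<Longrightarrow> {h \<in> Rat. kappa g h < e} \<in> sets \<tau>"
proof -
  assume g: "g \<in> Rat"
  then have "RM.mball g e = {h \<in> Rat. kappa g h < e}" by auto
  then show ?thesis using sets_tau RM.openin_mball unfolding Rat_topology_def by metis
qed

text \<open>This rests on separability: a small set meeting the complement of the support lies in a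
  ball of measure zero, and countably many small sets cover \<open>Rat\<close>.\<close>

lemma AE_Gamma: "AE g in \<tau>. g \<in> \<Gamma>"
proof -
  have "\<exists>\<C>. countable \<C> \<and> Rat = \<Union>\<C> \<and> (\<forall>C\<in>\<C>. \<forall>f\<in>C. \<forall>g\<in>C. kappa f g \<le> 4 * (1 / (real n + 1)))" for n :: nat
    by (rule Rat_separable) simp
  then obtain \<C> where C: "\<And>n. countable (\<C> n)" "\<And>n. Rat = \<Union>(\<C> n)"
    "\<And>n C f g. C \<in> \<C> n \<Longrightarrow> f \<in> C \<Longrightarrow> g \<in> C \<Longrightarrow> kappa f g \<le> 4 * (1 / (real (n::nat) + 1))"
    by metis
  \<comment> \<open>The covering sets are not known to be measurable, so those contained in some
    null set are collected and one such null set is chosen for each.\<close>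
  define I where "I = {C \<in> (\<Union>n. \<C> n). \<exists>Z\<in>null_sets \<tau>. C \<subseteq> Z}"
  define Z where "Z C = (SOME Z. Z\<in>null_sets \<tau> \<and> C \<subseteq> Z)" for C
  have Z: "Z C \<in> null_sets \<tau>" "C \<subseteq> Z C" if "C \<in> I" for C
  proof -
    have "\<exists>Z. Z\<in>null_sets \<tau> \<and> C \<subseteq> Z" using that by (auto simp: I_def)
    from someI_ex[OF this] show "Z C \<in> null_sets \<tau>" "C \<subseteq> Z C" by (auto simp: Z_def)
  qed
  have "countable (\<Union>n. \<C> n)" using C(1) by auto
  then have "countable I" unfolding I_def by (rule countable_subset[rotated]) auto
  then have "(\<Union>C\<in>I. Z C) \<in> null_sets \<tau>" by (rule null_sets_UN') (rule Z)
  moreover have "{g \<in> space \<tau>. g \<notin> \<Gamma>} \<subseteq> (\<Union>C\<in>I. Z C)"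
  proof safe
    fix g assume g: "g \<in> space \<tau>" "g \<notin> \<Gamma>"
    then have gR: "g \<in> Rat" by simp
    then obtain e where e: "e > 0" "\<not> emeasure \<tau> {h \<in> Rat. kappa g h < e} > 0"
      using g by (auto simp: supp_meas_def)
    obtain n where n: "4 / e < real n" using reals_Archimedean2 by blast
    have "4 / e < real n + 1" using n by linarith
    then have n: "4 * (1 / (real n + 1)) < e" using e(1) by (simp add: field_simps)
    obtain C' where C': "C' \<in> \<C> n" "g \<in> C'" using C(2)[of n] gR by blast
    have "C' \<subseteq> {h \<in> Rat. kappa g h < e}" using C(2)[of n] C(3)[OF C'] C'(1) n by fastforce
    moreover have "{h \<in> Rat. kappa g h < e} \<in> null_sets \<tau>"
      using e(2) kball_sets[OF gR] by (auto intro: null_setsI)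
    ultimately have "C' \<in> I" using C'(1) by (auto simp: I_def)
    then show "g \<in> (\<Union>C\<in>I. Z C)" using Z(2) C'(2) by blast
  qed
  ultimately show ?thesis by (rule AE_I')
qed

end

section \<open>The transition operator\<close>

lemma Ccont_bdd: "\<phi> \<in> Ccont \<Longrightarrow> bdd_above (range (\<lambda>z. cmod (\<phi> z)))"
  unfolding Ccont_def
  by (auto intro!: bounded_imp_bdd_above compact_imp_bounded compact_continuous_image compact_UNIV_rsphere
      continuous_intros)

lemma sup_norm_upper: "\<phi> \<in> Ccont \<Longrightarrow> cmod (\<phi> z) \<le> sup_norm \<phi>"
  unfolding sup_norm_def by (rule cSUP_upper[OF _ Ccont_bdd]) auto

lemma sup_norm_least: "(\<And>z. cmod (\<phi> z) \<le> B) \<Longrightarrow> sup_norm \<phi> \<le> B"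
  unfolding sup_norm_def by (rule cSUP_least) auto

lemma sup_norm_nonneg: "\<phi> \<in> Ccont \<Longrightarrow> 0 \<le> sup_norm \<phi>"
  using sup_norm_upper norm_ge_zero order_trans by blast

lemma Ccont_lincomb: "\<phi> \<in> Ccont \<Longrightarrow> \<psi> \<in> Ccont \<Longrightarrow> (\<lambda>z. c * \<phi> z + d * \<psi> z) \<in> Ccont"
  unfolding Ccont_def by (auto intro!: continuous_intros)

lemma Ccont_diff: "\<phi> \<in> Ccont \<Longrightarrow> \<psi> \<in> Ccont \<Longrightarrow> (\<lambda>z. \<phi> z - \<psi> z) \<in> Ccont"
  unfolding Ccont_def by (auto intro!: continuous_intros)

lemma Ccont_add: "\<phi> \<in> Ccont \<Longrightarrow> \<psi> \<in> Ccont \<Longrightarrow> (\<lambda>z. \<phi> z + \<psi> z) \<in> Ccont"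
  unfolding Ccont_def by (auto intro!: continuous_intros)

lemma Ccont_scale: "\<phi> \<in> Ccont \<Longrightarrow> (\<lambda>z. c * \<phi> z) \<in> Ccont"
  unfolding Ccont_def by (auto intro!: continuous_intros)

lemma Ccont_0: "(\<lambda>_. 0) \<in> Ccont"
  unfolding Ccont_def by (auto intro!: continuous_intros)

lemma Ccont_uniform:
  assumes "\<phi> \<in> Ccont" "e > 0"
  obtains d where "d > 0" "\<And>x y. dist x y < d \<Longrightarrow> cmod (\<phi> x - \<phi> y) < e"
proof -
  have "uniformly_continuous_on UNIV \<phi>"
    using assms(1) compact_uniformly_continuous compact_UNIV_rsphere by (auto simp: Ccont_def)
  then show ?thesis using that assms(2) unfolding uniformly_continuous_on_def
    by (metis UNIV_I dist_norm)
qed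

section \<open>The Hoelder space\<close>

lemma CalphaI:
  assumes "\<And>z. cmod (\<phi> z) \<le> B" "\<And>x y. cmod (\<phi> x - \<phi> y) \<le> H * dist x y powr \<alpha>"
  shows "\<phi> \<in> Calpha \<alpha>" "holder_const \<alpha> \<phi> \<le> H" "sup_norm \<phi> \<le> B" "holder_norm \<alpha> \<phi> \<le> B + H"
proof -
  have q: "cmod (\<phi> x - \<phi> y) / dist x y powr \<alpha> \<le> H" if "x \<noteq> y" for x y
    using assms(2)[of x y] that by (simp add: divide_le_eq)
  show "\<phi> \<in> Calpha \<alpha>"
    unfolding Calpha_def mem_Collect_eq
  proof
    show "bdd_above (range (\<lambda>z. cmod (\<phi> z)))" using assms(1) by (intro bdd_aboveI[of _ B]) auto
    show "bdd_above ((\<lambda>(x, y). cmod (\<phi> x - \<phi> y) / dist x y powr \<alpha>) ` {(x, y). x \<noteq> y})"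
      using q by (intro bdd_aboveI[of _ H]) auto
  qed
  show h: "holder_const \<alpha> \<phi> \<le> H"
    unfolding holder_const_def
  proof (rule cSUP_least)
    have "(infty, emb 0) \<in> {(x, y). x \<noteq> y}" by simp
    then show "{(x, y). x \<noteq> (y :: rsphere)} \<noteq> {}" by blast
  qed (use q in auto)
  show s: "sup_norm \<phi> \<le> B" by (rule sup_norm_least[OF assms(1)])
  show "holder_norm \<alpha> \<phi> \<le> B + H" using h s by (simp add: holder_norm_def)
qed

lemma holder_const_upper:
  assumes "\<phi> \<in> Calpha \<alpha>"
  shows "cmod (\<phi> x - \<phi> y) \<le> holder_const \<alpha> \<phi> * dist x y powr \<alpha>"
proof (cases "x = y")
  case False
  have "(\<lambda>(x, y). cmod (\<phi> x - \<phi> y) / dist x y powr \<alpha>) (x, y) \<le> holder_const \<alpha> \<phi>"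
    unfolding holder_const_def using assms False by (intro cSUP_upper) (auto simp: Calpha_def)
  then show ?thesis using False by (simp add: divide_le_eq)
qed simp

lemma holder_const_nonneg: "\<phi> \<in> Calpha \<alpha> \<Longrightarrow> 0 \<le> holder_const \<alpha> \<phi>"
proof -
  assume "\<phi> \<in> Calpha \<alpha>"
  from holder_const_upper[OF this, of infty "emb 0"]
  have "0 \<le> holder_const \<alpha> \<phi> * dist infty (emb 0) powr \<alpha>" using norm_ge_zero order_trans by blast
  moreover have "dist infty (emb 0) powr \<alpha> > 0" by simp
  ultimately show ?thesis by (simp add: zero_le_mult_iff)
qed

lemma Calpha_Ccont: assumes "\<phi> \<in> Calpha \<alpha>" "\<alpha> > 0" shows "\<phi> \<in> Ccont"
proof -
  have "continuous (at x) \<phi>" for x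
  proof -
    have "((\<lambda>y. dist y x) \<longlongrightarrow> dist x x) (at x)" by (intro tendsto_intros)
    then have "((\<lambda>y. dist y x) \<longlongrightarrow> 0) (at x)" by simp
    then have "((\<lambda>y. holder_const \<alpha> \<phi> * dist y x powr \<alpha>) \<longlongrightarrow> holder_const \<alpha> \<phi> * 0) (at x)"
      using assms(2) by (intro tendsto_mult tendsto_const tendsto_zero_powrI[of _ _ _ \<alpha>]) auto
    then have "((\<lambda>y. \<phi> y - \<phi> x) \<longlongrightarrow> 0) (at x)"
      by (intro Lim_null_comparison[of "\<lambda>y. \<phi> y - \<phi> x" "\<lambda>y. holder_const \<alpha> \<phi> * dist y x powr \<alpha>"])
         (auto intro!: always_eventually holder_const_upper[OF assms(1)])
    then show ?thesis by (simp add: continuous_at LIM_zero_iff)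
  qed
  then show ?thesis by (simp add: Ccont_def continuous_on_eq_continuous_at)
qed

lemma Calpha_upper:
  assumes "\<phi> \<in> Calpha \<alpha>"
  shows "cmod (\<phi> z) \<le> sup_norm \<phi>" "cmod (\<phi> z) \<le> holder_norm \<alpha> \<phi>"
    "cmod (\<phi> x - \<phi> y) \<le> holder_norm \<alpha> \<phi> * dist x y powr \<alpha>" "0 \<le> holder_norm \<alpha> \<phi>"
proof -
  show s: "cmod (\<phi> z) \<le> sup_norm \<phi>" for z
    unfolding sup_norm_def using assms by (intro cSUP_upper) (auto simp: Calpha_def)
  have s0: "0 \<le> sup_norm \<phi>" using s[of infty] norm_ge_zero order_trans by blast
  have h0: "0 \<le> holder_const \<alpha> \<phi>" by (rule holder_const_nonneg[OF assms])
  show "0 \<le> holder_norm \<alpha> \<phi>" using s0 h0 by (simp add: holder_norm_def)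
  show "cmod (\<phi> z) \<le> holder_norm \<alpha> \<phi>" using s[of z] h0 by (simp add: holder_norm_def)
  have "holder_const \<alpha> \<phi> * dist x y powr \<alpha> \<le> holder_norm \<alpha> \<phi> * dist x y powr \<alpha>"
    using s0 by (intro mult_right_mono) (auto simp: holder_norm_def)
  then show "cmod (\<phi> x - \<phi> y) \<le> holder_norm \<alpha> \<phi> * dist x y powr \<alpha>"
    using holder_const_upper[OF assms, of x y] by linarith
qed

lemma Calpha_add:
  assumes "\<phi> \<in> Calpha \<alpha>" "\<psi> \<in> Calpha \<alpha>"
  shows "(\<lambda>z. \<phi> z + \<psi> z) \<in> Calpha \<alpha>" "holder_norm \<alpha> (\<lambda>z. \<phi> z + \<psi> z) \<le> holder_norm \<alpha> \<phi> + holder_norm \<alpha> \<psi>"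
proof -
  have 1: "cmod (\<phi> z + \<psi> z) \<le> sup_norm \<phi> + sup_norm \<psi>" for z
    using norm_triangle_ineq[of "\<phi> z" "\<psi> z"] Calpha_upper(1)[OF assms(1), of z] Calpha_upper(1)[OF assms(2), of z] by linarith
  have 2: "cmod ((\<phi> x + \<psi> x) - (\<phi> y + \<psi> y)) \<le> (holder_const \<alpha> \<phi> + holder_const \<alpha> \<psi>) * dist x y powr \<alpha>" for x y
    using norm_triangle_ineq[of "\<phi> x - \<phi> y" "\<psi> x - \<psi> y"] holder_const_upper[OF assms(1), of x y]
      holder_const_upper[OF assms(2), of x y]
    by (simp add: algebra_simps)
  show "(\<lambda>z. \<phi> z + \<psi> z) \<in> Calpha \<alpha>" by (rule CalphaI(1)[OF 1 2])
  show "holder_norm \<alpha> (\<lambda>z. \<phi> z + \<psi> z) \<le> holder_norm \<alpha> \<phi> + holder_norm \<alpha> \<psi>"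
    using CalphaI(4)[OF 1 2] by (simp add: holder_norm_def)
qed

lemma Calpha_scale:
  assumes "\<phi> \<in> Calpha \<alpha>"
  shows "(\<lambda>z. c * \<phi> z) \<in> Calpha \<alpha>" "holder_norm \<alpha> (\<lambda>z. c * \<phi> z) \<le> cmod c * holder_norm \<alpha> \<phi>"
proof -
  have 1: "cmod (c * \<phi> z) \<le> cmod c * sup_norm \<phi>" for z
    using Calpha_upper(1)[OF assms, of z] by (simp add: norm_mult mult_left_mono)
  have 2: "cmod (c * \<phi> x - c * \<phi> y) \<le> (cmod c * holder_const \<alpha> \<phi>) * dist x y powr \<alpha>" for x y
  proof -
    have "cmod (c * \<phi> x - c * \<phi> y) = cmod c * cmod (\<phi> x - \<phi> y)" by (simp flip: norm_mult right_diff_distrib)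
    then show ?thesis using holder_const_upper[OF assms, of x y] by (simp add: mult_left_mono mult.assoc)
  qed
  show "(\<lambda>z. c * \<phi> z) \<in> Calpha \<alpha>" by (rule CalphaI(1)[OF 1 2])
  show "holder_norm \<alpha> (\<lambda>z. c * \<phi> z) \<le> cmod c * holder_norm \<alpha> \<phi>"
    using CalphaI(4)[OF 1 2] by (simp add: holder_norm_def distrib_left)
qed

lemma Calpha_diff:
  assumes "\<phi> \<in> Calpha \<alpha>" "\<psi> \<in> Calpha \<alpha>"
  shows "(\<lambda>z. \<phi> z - \<psi> z) \<in> Calpha \<alpha>" "holder_norm \<alpha> (\<lambda>z. \<phi> z - \<psi> z) \<le> holder_norm \<alpha> \<phi> + holder_norm \<alpha> \<psi>"
  using Calpha_add[OF assms(1) Calpha_scale(1)[OF assms(2), of "-1"]] Calpha_scale(2)[OF assms(2), of "-1"] by auto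

context random_rational
begin

abbreviation "M \<equiv> Mop \<tau>"

lemma measurable_Ccont: "\<phi> \<in> Ccont \<Longrightarrow> (\<lambda>g. \<phi> (g z)) \<in> borel_measurable \<tau>"
  using measurable_eval[of "\<lambda>p. \<phi> (fst p)" z z] continuous_on_compose2[of UNIV \<phi> UNIV fst]
  by (simp add: Ccont_def continuous_on_fst)

lemma integrable_Ccont: "\<phi> \<in> Ccont \<Longrightarrow> integrable \<tau> (\<lambda>g. \<phi> (g z))"
  by (rule integrable_const_bound[of _ "sup_norm \<phi>"]) (auto simp: sup_norm_upper measurable_Ccont)

lemma prob_Rat [simp]: "prob Rat = 1"
  using prob_space by simp

lemma norm_integral_le:
  fixes f :: "_ \<Rightarrow> complex"
  assumes "f \<in> borel_measurable \<tau>" "AE g in \<tau>. cmod (f g) \<le> c"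
  shows "cmod (\<integral>g. f g \<partial>\<tau>) \<le> c"
proof -
  have i: "integrable \<tau> f" by (rule integrable_const_bound[OF assms(2,1)])
  have "cmod (\<integral>g. f g \<partial>\<tau>) \<le> (\<integral>g. cmod (f g) \<partial>\<tau>)" by (rule integral_norm_bound)
  also have "\<dots> \<le> (\<integral>g. c \<partial>\<tau>)" by (rule integral_mono_AE) (use i assms(2) in auto)
  finally show ?thesis by (simp add: prob_space)
qed

lemma M_bound: "\<phi> \<in> Ccont \<Longrightarrow> (\<And>z. cmod (\<phi> z) \<le> B) \<Longrightarrow> cmod (M \<phi> z) \<le> B"
  unfolding Mop_def by (rule norm_integral_le) (auto simp: measurable_Ccont)

lemma M_diff_integral: "\<phi> \<in> Ccont \<Longrightarrow> M \<phi> x - M \<phi> y = (\<integral>g. \<phi> (g x) - \<phi> (g y) \<partial>\<tau>)"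
  unfolding Mop_def by (simp add: integrable_Ccont)

lemma M_Ccont: assumes "\<phi> \<in> Ccont" shows "M \<phi> \<in> Ccont"
proof -
  have "\<exists>d>0. \<forall>x'. dist x' x < d \<longrightarrow> dist (M \<phi> x') (M \<phi> x) < e" if e: "e > 0" for x e
  proof -
    obtain d where d: "d > 0" "\<And>x y. dist x y < d \<Longrightarrow> cmod (\<phi> x - \<phi> y) < e / 2"
      using Ccont_uniform[OF assms, of "e / 2"] e by auto
    have "dist (M \<phi> x') (M \<phi> x) < e" if "dist x' x < d / Lc" for x'
    proof -
      have "Lc * dist x' x < d" using that Lc(1) by (simp add: field_simps)
      then have "cmod (\<phi> (g x') - \<phi> (g x)) \<le> e / 2" if "g \<in> \<Gamma>" for g
        using d(2)[of "g x'" "g x"] lipD[OF Lc(2)[OF that], of x' x] by simp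
      then have "cmod (\<integral>g. \<phi> (g x') - \<phi> (g x) \<partial>\<tau>) \<le> e / 2"
        using AE_Gamma by (intro norm_integral_le borel_measurable_diff measurable_Ccont assms) auto
      then show ?thesis using e by (simp add: dist_norm M_diff_integral[OF assms])
    qed
    then show ?thesis using d(1) Lc(1) by (intro exI[of _ "d / Lc"]) auto
  qed
  then show ?thesis by (simp add: Ccont_def continuous_on_iff)
qed

lemma Mn_Ccont: "\<phi> \<in> Ccont \<Longrightarrow> (M ^^ n) \<phi> \<in> Ccont"
  by (induction n) (auto intro: M_Ccont)

lemma M_lincomb:
  "\<phi> \<in> Ccont \<Longrightarrow> \<psi> \<in> Ccont \<Longrightarrow> M (\<lambda>z. c * \<phi> z + d * \<psi> z) = (\<lambda>z. c * M \<phi> z + d * M \<psi> z)"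
  unfolding Mop_def by (simp add: integrable_Ccont)

lemma M_scale: "\<phi> \<in> Ccont \<Longrightarrow> M (\<lambda>z. c * \<phi> z) = (\<lambda>z. c * M \<phi> z)"
  using M_lincomb[of \<phi> \<phi> c 0] by simp

lemma M_diff: "\<phi> \<in> Ccont \<Longrightarrow> \<psi> \<in> Ccont \<Longrightarrow> M (\<lambda>z. \<phi> z - \<psi> z) = (\<lambda>z. M \<phi> z - M \<psi> z)"
  using M_lincomb[of \<phi> \<psi> 1 "-1"] by simp

lemma M_add: "\<phi> \<in> Ccont \<Longrightarrow> \<psi> \<in> Ccont \<Longrightarrow> M (\<lambda>z. \<phi> z + \<psi> z) = (\<lambda>z. M \<phi> z + M \<psi> z)"
  using M_lincomb[of \<phi> \<psi> 1 1] by simp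

lemma Mn_lincomb: "\<phi> \<in> Ccont \<Longrightarrow> \<psi> \<in> Ccont \<Longrightarrow>
    (M ^^ n) (\<lambda>z. c * \<phi> z + d * \<psi> z) = (\<lambda>z. c * (M ^^ n) \<phi> z + d * (M ^^ n) \<psi> z)"
  by (induction n) (auto simp: M_lincomb Mn_Ccont)

lemma Mn_diff: "\<phi> \<in> Ccont \<Longrightarrow> \<psi> \<in> Ccont \<Longrightarrow> (M ^^ n) (\<lambda>z. \<phi> z - \<psi> z) = (\<lambda>z. (M ^^ n) \<phi> z - (M ^^ n) \<psi> z)"
  using Mn_lincomb[of \<phi> \<psi> n 1 "-1"] by simp

lemma M_0: "M (\<lambda>_. 0) = (\<lambda>_. 0)"
  by (simp add: fun_eq_iff Mop_def)

lemma Mn_0: "(M ^^ n) (\<lambda>_. 0) = (\<lambda>_. 0)"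
  by (induction n) (auto simp: M_0)

lemma Mn_bound: "\<phi> \<in> Ccont \<Longrightarrow> (\<And>z. cmod (\<phi> z) \<le> B) \<Longrightarrow> cmod ((M ^^ n) \<phi> z) \<le> B"
proof (induction n arbitrary: z)
  case (Suc n)
  then show ?case using M_bound[OF Mn_Ccont[OF Suc.prems(1)]] by simp
qed simp

lemma Mn_eigen: "\<phi> \<in> Ccont \<Longrightarrow> M \<phi> = (\<lambda>z. a * \<phi> z) \<Longrightarrow> (M ^^ n) \<phi> = (\<lambda>z. a ^ n * \<phi> z)"
  by (induction n) (auto simp: M_scale mult.assoc)

text \<open>Composition with an \<open>Lc\<close>-Lipschitz map multiplies the Hoelder constant by
  at most Lc powr \<alpha>, and averaging does not increase the sup norm.\<close>

lemma M_Calpha: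
  assumes "\<alpha> > 0"
  obtains K where "K \<ge> 1" "\<And>\<phi>. \<phi> \<in> Calpha \<alpha> \<Longrightarrow> M \<phi> \<in> Calpha \<alpha> \<and> holder_norm \<alpha> (M \<phi>) \<le> K * holder_norm \<alpha> \<phi>"
proof
  define K where "K = max 1 (Lc powr \<alpha>)"
  show "K \<ge> 1" by (simp add: K_def)
  show "M \<phi> \<in> Calpha \<alpha> \<and> holder_norm \<alpha> (M \<phi>) \<le> K * holder_norm \<alpha> \<phi>" if \<phi>: "\<phi> \<in> Calpha \<alpha>" for \<phi>
  proof -
    have c: "\<phi> \<in> Ccont" by (rule Calpha_Ccont[OF \<phi> assms])
    have h0: "0 \<le> holder_const \<alpha> \<phi>" "0 \<le> sup_norm \<phi>" using holder_const_nonneg[OF \<phi>] sup_norm_nonneg[OF c] by auto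
    have 1: "cmod (M \<phi> z) \<le> sup_norm \<phi>" for z by (rule M_bound[OF c]) (rule sup_norm_upper[OF c])
    have 2: "cmod (M \<phi> x - M \<phi> y) \<le> (K * holder_const \<alpha> \<phi>) * dist x y powr \<alpha>" for x y
      unfolding M_diff_integral[OF c]
    proof (rule norm_integral_le)
      have "cmod (\<phi> (g x) - \<phi> (g y)) \<le> K * holder_const \<alpha> \<phi> * dist x y powr \<alpha>" if "g \<in> \<Gamma>" for g
      proof -
        have "dist (g x) (g y) powr \<alpha> \<le> (Lc * dist x y) powr \<alpha>"
          using lipD[OF Lc(2)[OF that]] assms by (intro powr_mono2) auto
        also have "\<dots> = Lc powr \<alpha> * dist x y powr \<alpha>" using Lc(1) by (simp add: powr_mult)
        also have "\<dots> \<le> K * dist x y powr \<alpha>" by (intro mult_right_mono) (auto simp: K_def)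
        finally have "holder_const \<alpha> \<phi> * dist (g x) (g y) powr \<alpha> \<le> holder_const \<alpha> \<phi> * (K * dist x y powr \<alpha>)"
          using h0 by (intro mult_left_mono)
        then show ?thesis using holder_const_upper[OF \<phi>, of "g x" "g y"] by (simp add: mult_ac)
      qed
      then show "AE g in \<tau>. cmod (\<phi> (g x) - \<phi> (g y)) \<le> K * holder_const \<alpha> \<phi> * dist x y powr \<alpha>"
        using AE_Gamma by auto
    qed (intro borel_measurable_diff measurable_Ccont c)
    have "sup_norm \<phi> \<le> K * sup_norm \<phi>" using h0 by (simp add: K_def mult_le_cancel_right1)
    then have "sup_norm \<phi> + K * holder_const \<alpha> \<phi> \<le> K * holder_norm \<alpha> \<phi>"
      by (simp add: holder_norm_def distrib_left)
    then show ?thesis using CalphaI(1,4)[OF 1 2] by auto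
  qed
qed

lemma Mn_Calpha: "\<alpha> > 0 \<Longrightarrow> \<phi> \<in> Calpha \<alpha> \<Longrightarrow> (M ^^ n) \<phi> \<in> Calpha \<alpha>"
  by (induction n) (auto intro: M_Calpha)

end

section \<open>The maximum principle and equicontinuity\<close>

text \<open>Membership for some \<open>k\<close> says that the limsup of \<open>u j\<close> at
  points tending to q is at most c, locally uniformly. The interior makes these sublevel sets open,
  so that compactness arguments apply to an upper semicontinuous limsup.\<close>

definition ev_le :: "(nat \<Rightarrow> 'a::topological_space \<Rightarrow> real) \<Rightarrow> real \<Rightarrow> nat \<Rightarrow> 'a set" where
  "ev_le u c k = interior {q. \<forall>j\<ge>k. u j q \<le> c}"

lemma open_ev_le: "open (ev_le u c k)"
  by (simp add: ev_le_def)

lemma ev_le_mono: "c \<le> c' \<Longrightarrow> k \<le> k' \<Longrightarrow> ev_le u c k \<subseteq> ev_le u c' k'"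
  unfolding ev_le_def
proof (rule interior_mono, rule subsetI)
  fix q assume c: "c \<le> c'" and k: "k \<le> k'" and q: "q \<in> {q. \<forall>j\<ge>k. u j q \<le> c}"
  have "u j q \<le> c'" if "k' \<le> j" for j
  proof -
    have "k \<le> j" using k that by simp
    then have "u j q \<le> c" using q by simp
    then show ?thesis using c by simp
  qed
  then show "q \<in> {q. \<forall>j\<ge>k'. u j q \<le> c'}" by simp
qed

lemma ev_leD: "q \<in> ev_le u c k \<Longrightarrow> k \<le> j \<Longrightarrow> u j q \<le> c"
  using subsetD[OF interior_subset, of q "{q. \<forall>j\<ge>k. u j q \<le> c}"] unfolding ev_le_def by simp

lemma dist_map_prod_lip:
  assumes "lip L g" "L \<ge> 0"
  shows "dist (map_prod g g p) (map_prod g g q) \<le> L * dist p q"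
proof -
  obtain a b c d where pq: "p = (a, b)" "q = (c, d)" by fastforce
  have "sqrt ((dist (g a) (g c))\<^sup>2 + (dist (g b) (g d))\<^sup>2) \<le> sqrt ((L * dist a c)\<^sup>2 + (L * dist b d)\<^sup>2)"
    using lipD[OF assms(1)] by (intro real_sqrt_le_mono add_mono power_mono) auto
  also have "\<dots> = sqrt (L\<^sup>2 * ((dist a c)\<^sup>2 + (dist b d)\<^sup>2))"
    by (simp add: power_mult_distrib distrib_left)
  also have "\<dots> = L * sqrt ((dist a c)\<^sup>2 + (dist b d)\<^sup>2)" using assms(2) by (simp add: real_sqrt_mult)
  finally show ?thesis by (simp add: pq dist_Pair_Pair)
qed

lemma dist_map_prod_kappa: "dist (map_prod g g p) (map_prod h h p) \<le> 2 * kappa g h"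
proof -
  obtain a b where p: "p = (a, b)" by fastforce
  have "dist (map_prod g g p) (map_prod h h p) \<le> dist (g a) (h a) + dist (g b) (h b)"
    unfolding p map_prod_simp dist_Pair_Pair by (rule sqrt_sum_squares_le_sum) auto
  then show ?thesis using dist_le_kappa[of g a h] dist_le_kappa[of g b h] by linarith
qed

context random_rational
begin

definition inv_pairs :: "(rsphere \<times> rsphere) set \<Rightarrow> bool" where
  "inv_pairs K = (\<forall>g\<in>\<Gamma>. map_prod g g ` K \<subseteq> K)"

lemma inv_pairsD: "inv_pairs K \<Longrightarrow> g \<in> \<Gamma> \<Longrightarrow> p \<in> K \<Longrightarrow> map_prod g g p \<in> K"
  unfolding inv_pairs_def by blast

text \<open>The superlevel set of the upper semicontinuous limsup of \<open>u\<close> at its maximum over \<open>K\<close> is invariant,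
  because averages of values at most \<open>m\<close> reach \<open>m\<close> only if all of them do.\<close>

lemma maximum_principle:
  fixes u :: "nat \<Rightarrow> rsphere \<times> rsphere \<Rightarrow> real"
  assumes cont: "\<And>k. continuous_on UNIV (u k)" and nonneg: "\<And>k p. 0 \<le> u k p" and bd: "\<And>k p. u k p \<le> B"
    and step: "\<And>k p. u (Suc k) p \<le> (\<integral>g. u k (map_prod g g p) \<partial>\<tau>)"
    and K: "compact K" "inv_pairs K"
    and test: "\<And>K'. K' \<subseteq> K \<Longrightarrow> K' \<noteq> {} \<Longrightarrow> compact K' \<Longrightarrow> inv_pairs K' \<Longrightarrow> \<exists>p\<in>K'. \<forall>c>0. \<exists>k. p \<in> ev_le u c k"
    and p0: "p0 \<in> K" and c0: "c0 > 0"
  shows "\<exists>k. p0 \<in> ev_le u c0 k"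
proof (rule ccontr)
  assume neg: "\<not> (\<exists>k. p0 \<in> ev_le u c0 k)"
  \<comment> \<open>The constants that eventually bound \<open>u\<close> near every point of
    \<open>K\<close>. By \<open>neg\<close> they are bounded below by \<open>c0\<close>; their
    infimum \<open>m\<close> is the maximum over \<open>K\<close> of the locally uniform
    limsup.\<close>
  define S where "S = {c. \<forall>p\<in>K. \<exists>k. p \<in> ev_le u c k}"
  have "{q. \<forall>j\<ge>0. u j q \<le> B} = UNIV" using bd by auto
  then have "ev_le u B 0 = UNIV" by (simp add: ev_le_def)
  then have BS: "B \<in> S" by (auto simp: S_def)
  have lower: "c0 \<le> c" if cS: "c \<in> S" for c
  proof (rule ccontr)
    assume "\<not> c0 \<le> c"
    moreover obtain k where "p0 \<in> ev_le u c k" using cS p0 by (auto simp: S_def)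
    ultimately show False using neg ev_le_mono[of c c0 k k u] by auto
  qed
  define m where "m = Inf S"
  have bb: "bdd_below S" using lower by (intro bdd_belowI)
  have m: "c0 \<le> m" unfolding m_def using BS lower by (intro cInf_greatest) auto
  have m_le: "m \<le> c" if "c \<in> S" for c unfolding m_def by (rule cInf_lower[OF that bb])
  \<comment> \<open>The points where this limsup reaches \<open>m\<close>. If there were none,
    finitely many levels below \<open>m\<close> would cover \<open>K\<close>, and the largest would
    be a member of \<open>S\<close> below \<open>m\<close>.\<close>
  define K' where "K' = K - (\<Union>c\<in>{..<m}. \<Union>k. ev_le u c k)"
  have K'D: "p \<in> K" "c < m \<Longrightarrow> p \<notin> ev_le u c k" if "p \<in> K'" for p c k
    using that unfolding K'_def by blast+
  have K'I: "\<exists>c k. c < m \<and> p \<in> ev_le u c k" if "p \<in> K" "p \<notin> K'" for p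
    using that unfolding K'_def by blast
  have cK': "compact K'" unfolding K'_def by (intro compact_diff K(1) open_UN ballI open_ev_le)
  have ne: "K' \<noteq> {}"
  proof
    assume "K' = {}"
    then have cov: "K \<subseteq> (\<Union>c\<in>{..<m}. \<Union>k. ev_le u c k)" by (auto simp: K'_def)
    have "open (\<Union>k. ev_le u c k)" for c by (intro open_UN ballI open_ev_le)
    then obtain C where C: "C \<subseteq> {..<m}" "finite C" "K \<subseteq> (\<Union>c\<in>C. \<Union>k. ev_le u c k)"
      using compactE_image[OF K(1) _ cov] by metis
    have Cne: "C \<noteq> {}" using C(3) p0 by auto
    have "Max C < m" using C Cne by (simp add: subset_iff)
    moreover have "Max C \<in> S"
      unfolding S_def
    proof (intro CollectI ballI)
      fix p assume "p \<in> K"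
      then obtain c k where "c \<in> C" "p \<in> ev_le u c k" using C(3) by blast
      then show "\<exists>k. p \<in> ev_le u (Max C) k" using ev_le_mono[of c "Max C" k k u] C(2) by auto
    qed
    ultimately show False using m_le by fastforce
  qed
  have "inv_pairs K'"
    unfolding inv_pairs_def
  proof (intro ballI subsetI)
    fix g0 p' assume g0: "g0 \<in> \<Gamma>" and "p' \<in> map_prod g0 g0 ` K'"
    then obtain p where p: "p \<in> K'" "p' = map_prod g0 g0 p" by (elim imageE)
    have p'K: "p' \<in> K" unfolding p(2) by (rule inv_pairsD[OF K(2) g0 K'D(1)[OF p(1)]])
    show "p' \<in> K'"
    proof (rule ccontr)
      assume "p' \<notin> K'"
      then obtain c k0 where c: "c < m" "p' \<in> ev_le u c k0" using K'I p'K by metis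
      obtain r0 where r0: "r0 > 0" "ball p' r0 \<subseteq> ev_le u c k0" using c open_ev_le openE by blast
      \<comment> \<open>On pairs these maps differ from \<open>g0\<close> by at most 2 * kappa < r0
        / 2; the other half of \<open>r0\<close> absorbs the move from p to a nearby q. The set has
        positive measure because \<open>g0\<close> is in the support.\<close>
      define N where "N = {g \<in> Rat. kappa g0 g < r0 / 4}"
      have N: "N \<in> sets \<tau>" unfolding N_def by (rule kball_sets[OF Gamma_Rat[OF g0]])
      define P where "P = prob N"
      have "\<forall>e>0. emeasure \<tau> {g \<in> Rat. kappa g0 g < e} > 0" using g0 unfolding supp_meas_def by blast
      moreover have "r0 / 4 > 0" using r0(1) by simp
      ultimately have "emeasure \<tau> N > 0" unfolding N_def by blast
      then have P0: "P > 0" by (simp add: P_def emeasure_eq_measure)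
      have P1: "P \<le> 1" by (simp add: P_def)
      \<comment> \<open>Chosen so that P * (m - c) = 2 * \<eta>: the average of c with weight P and
        of a value below m + \<eta> with weight 1 - P is then less than m.\<close>
      define \<eta> where "\<eta> = P * (m - c) / 2"
      have \<eta>: "\<eta> > 0" using P0 c(1) by (simp add: \<eta>_def)
      have "\<exists>c1\<in>S. c1 < m + \<eta>" using \<eta> BS cInf_lessD[of S "m + \<eta>"] by (auto simp: m_def)
      then obtain c1 where c1: "c1 \<in> S" "c1 < m + \<eta>" by blast
      have cov: "K \<subseteq> (\<Union>k\<in>UNIV. ev_le u c1 k)" using c1(1) by (auto simp: S_def)
      obtain F where F: "finite F" "K \<subseteq> (\<Union>k\<in>F. ev_le u c1 k)"
        using compactE_image[OF K(1) open_ev_le cov] by metis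
      have Fne: "F \<noteq> {}" using F(2) p0 by auto
      define k1 where "k1 = Max F"
      have "ev_le u c1 k \<subseteq> ev_le u c1 k1" if "k \<in> F" for k
        by (rule ev_le_mono) (use that F(1) in \<open>auto simp: k1_def\<close>)
      then have K1: "K \<subseteq> ev_le u c1 k1" using F(2) by blast
      obtain \<rho> where \<rho>: "\<rho> > 0" "\<And>w. w \<in> K \<Longrightarrow> ball w \<rho> \<subseteq> ev_le u c1 k1"
      proof -
        have K1': "K \<subseteq> \<Union>{ev_le u c1 k1}" using K1 by simp
        obtain \<rho> where "\<rho> > 0" "\<And>w. w \<in> K \<Longrightarrow> \<exists>G\<in>{ev_le u c1 k1}. ball w \<rho> \<subseteq> G"
          by (rule Heine_Borel_lemma[OF K(1) K1']) (simp_all add: open_ev_le)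
        then show thesis using that by simp
      qed
      define r where "r = min \<rho> (r0 / 2) / Lc"
      have r: "r > 0" using \<rho>(1) r0(1) Lc(1) by (simp add: r_def)
      define c' where "c' = P * c + (1 - P) * c1"
      have "(1 - P) * c1 \<le> (1 - P) * (m + \<eta>)" using P1 c1(2) by (intro mult_left_mono) auto
      then have "c' \<le> m - P * (m - c) + \<eta> - P * \<eta>" by (simp add: c'_def algebra_simps)
      also have "\<dots> < m" using \<eta> P0 c(1) by (simp add: \<eta>_def) (smt (verit) mult_pos_pos)
      finally have c': "c' < m" .
      \<comment> \<open>\<open>step\<close> lowers the index by one, hence the successor. The
        integrand is at most c on \<open>N\<close> and at most \<open>c1\<close> elsewhere, which
        averages to c' < m and contradicts p being in \<open>K'\<close>.\<close>
      have "u j q \<le> c'" if q: "q \<in> ball p r" and j: "Suc (max k0 k1) \<le> j" for j q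
      proof -
        obtain k where k: "j = Suc k" "k0 \<le> k" "k1 \<le> k" using j by (cases j) auto
        have meas: "(\<lambda>g. u k (map_prod g g q)) \<in> borel_measurable \<tau>"
          using measurable_eval[OF cont[of k], of "fst q" "snd q"] by (simp add: map_prod_def case_prod_unfold)
        have "u j q \<le> (\<integral>g. u k (map_prod g g q) \<partial>\<tau>)" unfolding k(1) by (rule step)
        also have "\<dots> \<le> (\<integral>g. c1 + (c - c1) * indicator N g \<partial>\<tau>)"
        proof (rule integral_mono_AE)
          show "integrable \<tau> (\<lambda>g. u k (map_prod g g q))"
            by (rule integrable_const_bound[of _ B, OF _ meas]) (use nonneg bd in auto)
          show "integrable \<tau> (\<lambda>g. c1 + (c - c1) * indicator N g)" using N by (simp add: emeasure_eq_measure)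
          have "u k (map_prod g g q) \<le> c1 + (c - c1) * indicator N g" if g: "g \<in> \<Gamma>" for g
          proof -
            have "dist (map_prod g g p) (map_prod g g q) \<le> Lc * dist p q"
              by (rule dist_map_prod_lip) (use Lc g in auto)
            also have "\<dots> < Lc * r" using q Lc(1) by simp
            finally have d: "dist (map_prod g g p) (map_prod g g q) < min \<rho> (r0/2)" using Lc(1) by (simp add: r_def)
            have pK: "map_prod g g p \<in> K" by (rule inv_pairsD[OF K(2) g K'D(1)[OF p(1)]])
            show ?thesis
            proof (cases "g \<in> N")
              case True
              then have "kappa g0 g < r0 / 4" by (simp add: N_def)
              then have "dist p' (map_prod g g p) < r0 / 2"
                using dist_map_prod_kappa[of g0 p g] p(2) by simp
              then have "map_prod g g q \<in> ball p' r0"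
                using d dist_triangle[of p' "map_prod g g q" "map_prod g g p"] by simp
              then have "u k (map_prod g g q) \<le> c" using r0(2) ev_leD[OF _ k(2)] by (metis subsetD)
              then show ?thesis using True by simp
            next
              case False
              have "map_prod g g q \<in> ball (map_prod g g p) \<rho>" using d by simp
              then have "u k (map_prod g g q) \<le> c1" using \<rho>(2)[OF pK] ev_leD[OF _ k(3)] by (metis subsetD)
              then show ?thesis using False by simp
            qed
          qed
          then show "AE g in \<tau>. u k (map_prod g g q) \<le> c1 + (c - c1) * indicator N g" using AE_Gamma by auto
        qed
        also have "\<dots> = c1 + (c - c1) * P"
        proof -
          have "N \<inter> Rat = N" by (auto simp: N_def)
          then show ?thesis using N by (simp add: P_def emeasure_eq_measure)
        qed
        also have "\<dots> = c'" by (simp add: c'_def algebra_simps)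
        finally show ?thesis .
      qed
      then have "ball p r \<subseteq> {q. \<forall>j\<ge>Suc (max k0 k1). u j q \<le> c'}" by blast
      then have "p \<in> ev_le u c' (Suc (max k0 k1))"
        unfolding ev_le_def using r by (meson centre_in_ball interiorI open_ball)
      then show False using K'D(2)[OF p(1) c'] by metis
    qed
  qed
  then obtain p where p: "p \<in> K'" "\<forall>c>0. \<exists>k. p \<in> ev_le u c k"
    using test[OF _ ne cK'] K'D(1) by (metis subsetI)
  \<comment> \<open>The limsup is 0 at the test point p but m > 0 everywhere on \<open>K'\<close>; m
    / 2 is a positive level strictly between.\<close>
  have "m / 2 > 0" "m / 2 < m" using m c0 by auto
  then show False using K'D(2)[OF p(1)] p(2) by metis
qed

end

section \<open>The semigroup and the oscillation of iterates\<close>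

context random_rational
begin

abbreviation "G \<equiv> G_of \<tau>"

lemma Gamma_G: "g \<in> \<Gamma> \<Longrightarrow> g \<in> G"
  by (simp add: G_of_def gen_semigroup.base)

lemma G_comp: "f \<in> G \<Longrightarrow> g \<in> G \<Longrightarrow> f \<circ> g \<in> G"
  by (simp add: G_of_def gen_semigroup.comp)

lemma G_Hol: "g \<in> G \<Longrightarrow> Hol g"
  unfolding G_of_def
proof (induction rule: gen_semigroup.induct)
  case (base g)
  then show ?case by (intro Rat_Hol Gamma_Rat)
qed (rule Hol_comp)

lemma inv_pairs_G:
  assumes "inv_pairs K" "g \<in> G" "(x, y) \<in> K" shows "(g x, g y) \<in> K"
  using assms(2,3) unfolding G_of_def
proof (induction arbitrary: x y)
  case (base g)
  then show ?case using assms(1) by (force simp: inv_pairs_def)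
qed auto

text \<open>The oscillation of an iterate across a pair. It is at most the average of its
  predecessor under the diagonal action, which is the \<open>step\<close> premise of
  \<open>maximum_principle\<close>.\<close>

definition u_diff :: "(rsphere \<Rightarrow> complex) \<Rightarrow> nat \<Rightarrow> rsphere \<times> rsphere \<Rightarrow> real" where
  "u_diff \<phi> k p = cmod ((M ^^ k) \<phi> (fst p) - (M ^^ k) \<phi> (snd p))"

lemma u_diff:
  assumes "\<phi> \<in> Ccont"
  shows "continuous_on UNIV (u_diff \<phi> k)" "0 \<le> u_diff \<phi> k p" "u_diff \<phi> k p \<le> 2 * sup_norm \<phi>"
    "u_diff \<phi> (Suc k) p \<le> (\<integral>g. u_diff \<phi> k (map_prod g g p) \<partial>\<tau>)"
proof -
  have c: "continuous_on A ((M ^^ k) \<phi>)" for k A using Mn_Ccont[OF assms] Ccont_def continuous_on_subset by blast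
  show "continuous_on UNIV (u_diff \<phi> k)"
    unfolding u_diff_def
    by (intro continuous_intros continuous_on_compose2[OF c[of UNIV k]]) auto
  show "0 \<le> u_diff \<phi> k p" by (simp add: u_diff_def)
  show "u_diff \<phi> k p \<le> 2 * sup_norm \<phi>"
    using norm_triangle_ineq4[of "(M ^^ k) \<phi> (fst p)" "(M ^^ k) \<phi> (snd p)"]
      Mn_bound[OF assms sup_norm_upper[OF assms], of k "fst p"] Mn_bound[OF assms sup_norm_upper[OF assms], of k "snd p"]
    by (simp add: u_diff_def)
  have "(M ^^ Suc k) \<phi> (fst p) - (M ^^ Suc k) \<phi> (snd p) = (\<integral>g. (M ^^ k) \<phi> (g (fst p)) - (M ^^ k) \<phi> (g (snd p)) \<partial>\<tau>)"
    using M_diff_integral[OF Mn_Ccont[OF assms]] by simp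
  then have "u_diff \<phi> (Suc k) p = cmod (\<integral>g. (M ^^ k) \<phi> (g (fst p)) - (M ^^ k) \<phi> (g (snd p)) \<partial>\<tau>)"
    unfolding u_diff_def by (simp only:)
  also have "\<dots> \<le> (\<integral>g. cmod ((M ^^ k) \<phi> (g (fst p)) - (M ^^ k) \<phi> (g (snd p))) \<partial>\<tau>)"
    by (rule integral_norm_bound)
  finally show "u_diff \<phi> (Suc k) p \<le> (\<integral>g. u_diff \<phi> k (map_prod g g p) \<partial>\<tau>)"
    by (simp add: u_diff_def map_prod_def case_prod_unfold)
qed

text \<open>The iterate at x averages \<phi>(h x) over words h in the support. At least one letter
  is required, since the generated semigroup need not contain the identity; hence
  \<open>Suc k\<close>.\<close>

lemma Mn_diff_G:
  assumes "\<phi> \<in> Ccont"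
  shows "(\<And>h. h \<in> G \<Longrightarrow> cmod (\<phi> (h x) - \<phi> (h y)) \<le> c) \<Longrightarrow> cmod ((M ^^ Suc k) \<phi> x - (M ^^ Suc k) \<phi> y) \<le> c"
proof (induction k arbitrary: x y)
  case 0
  have "cmod (\<integral>g. \<phi> (g x) - \<phi> (g y) \<partial>\<tau>) \<le> c"
    by (rule norm_integral_le) (use 0 Gamma_G AE_Gamma in \<open>auto intro!: borel_measurable_diff measurable_Ccont assms\<close>)
  then show ?case by (simp add: M_diff_integral[OF assms])
next
  case (Suc k)
  have "cmod ((M ^^ Suc k) \<phi> (g x) - (M ^^ Suc k) \<phi> (g y)) \<le> c" if g: "g \<in> \<Gamma>" for g
  proof (rule Suc.IH)
    fix h assume "h \<in> G"
    then have "h \<circ> g \<in> G" by (rule G_comp[OF _ Gamma_G[OF g]])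
    from Suc.prems[OF this] show "cmod (\<phi> (h (g x)) - \<phi> (h (g y))) \<le> c" by (simp only: o_apply)
  qed
  then have "cmod (\<integral>g. (M ^^ Suc k) \<phi> (g x) - (M ^^ Suc k) \<phi> (g y) \<partial>\<tau>) \<le> c"
    using AE_Gamma by (intro norm_integral_le borel_measurable_diff measurable_Ccont Mn_Ccont assms) auto
  then show ?case using M_diff_integral[OF Mn_Ccont[OF assms, of "Suc k"]] by simp
qed

lemma Fatou_equi:
  assumes "w \<in> Fatou G" "e > 0"
  obtains d where "d > 0" "\<And>x y h. dist x w < d \<Longrightarrow> dist y w < d \<Longrightarrow> h \<in> G \<Longrightarrow> dist (h x) (h y) < e"
proof -
  obtain U where U: "open U" "w \<in> U" "equicont_on G U" using assms by (auto simp: Fatou_def)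
  obtain d1 where d1: "d1 > 0" "\<And>y h. y \<in> U \<Longrightarrow> h \<in> G \<Longrightarrow> dist w y < d1 \<Longrightarrow> dist (h w) (h y) < e / 2"
    using U(2,3) assms(2) unfolding equicont_on_def by (meson half_gt_zero)
  obtain d2 where d2: "d2 > 0" "ball w d2 \<subseteq> U" using U openE by blast
  show ?thesis
  proof (rule that[of "min d1 d2"])
    fix x y h assume xy: "dist x w < min d1 d2" "dist y w < min d1 d2" and h: "h \<in> G"
    have "x \<in> U" "y \<in> U" using xy d2 by (auto simp: dist_commute subset_iff)
    then have "dist (h w) (h x) < e / 2" "dist (h w) (h y) < e / 2"
      using d1(2)[of x h] d1(2)[of y h] xy h by (auto simp: dist_commute)
    then show "dist (h x) (h y) < e" by (metis dist_commute dist_triangle_half_l)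
  qed (use d1 d2 in auto)
qed

text \<open>Equicontinuity of the semigroup near w keeps the images of nearby points close, so all
  iterates but the zeroth oscillate little on a product of balls.\<close>

lemma Fatou_ev_le:
  assumes "\<phi> \<in> Ccont" "w \<in> Fatou G" "c > 0"
  shows "\<exists>k. (w, w) \<in> ev_le (u_diff \<phi>) c k"
proof -
  obtain \<delta> where \<delta>: "\<delta> > 0" "\<And>x y. dist x y < \<delta> \<Longrightarrow> cmod (\<phi> x - \<phi> y) < c"
    using Ccont_uniform[OF assms(1,3)] by blast
  obtain d where d: "d > 0" "\<And>x y h. dist x w < d \<Longrightarrow> dist y w < d \<Longrightarrow> h \<in> G \<Longrightarrow> dist (h x) (h y) < \<delta>"
    using Fatou_equi[OF assms(2) \<delta>(1)] by blast
  have "u_diff \<phi> j q \<le> c" if q: "q \<in> ball w d \<times> ball w d" and j: "1 \<le> j" for q j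
  proof -
    obtain k where k: "j = Suc k" using j by (cases j) auto
    have "cmod ((M ^^ Suc k) \<phi> (fst q) - (M ^^ Suc k) \<phi> (snd q)) \<le> c"
    proof (rule Mn_diff_G[OF assms(1)])
      fix h assume h: "h \<in> G"
      have "dist (fst q) w < d" "dist (snd q) w < d" using q by (auto simp: dist_commute)
      then show "cmod (\<phi> (h (fst q)) - \<phi> (h (snd q))) \<le> c" using \<delta>(2)[OF d(2)] h by (simp add: less_imp_le)
    qed
    then show ?thesis by (simp only: u_diff_def k)
  qed
  then have "(w, w) \<in> ev_le (u_diff \<phi>) c 1"
    unfolding ev_le_def using d(1) by (intro interiorI[of "ball w d \<times> ball w d"]) (auto intro!: open_Times)
  then show ?thesis by blast
qed

end

locale random_rational_ker = random_rational +
  assumes ker: "Julia_ker G = {}"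
begin

text \<open>The maximum principle on the diagonal: every nonempty invariant subset contains a pair
  (g x, g x) with g x in the Fatou set, because the kernel Julia set is empty.\<close>

lemma diagonal_ev_le:
  assumes \<phi>: "\<phi> \<in> Ccont" and c: "c > 0"
  shows "\<exists>k. (z, z) \<in> ev_le (u_diff \<phi>) c k"
proof (rule maximum_principle[where K = "range (\<lambda>x. (x, x))" and B = "2 * sup_norm \<phi>"])
  show "compact (range (\<lambda>x :: rsphere. (x, x)))"
    by (intro compact_continuous_image compact_UNIV_rsphere continuous_intros)
  show "inv_pairs (range (\<lambda>x. (x, x)))" by (auto simp: inv_pairs_def)
  fix K' :: "(rsphere \<times> rsphere) set" assume K': "K' \<subseteq> range (\<lambda>x. (x, x))" "K' \<noteq> {}" "inv_pairs K'"
  then obtain x where x: "(x, x) \<in> K'" by blast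
  obtain g where g: "g \<in> G" "g x \<in> Fatou G" using ker by (auto simp: Julia_ker_def Julia_def)
  have "(g x, g x) \<in> K'" by (rule inv_pairs_G[OF K'(3) g(1) x])
  then show "\<exists>p\<in>K'. \<forall>c>0. \<exists>k. p \<in> ev_le (u_diff \<phi>) c k" using Fatou_ev_le[OF \<phi> g(2)] by blast
qed (use u_diff[OF \<phi>] c in auto)

text \<open>The late iterates are controlled by \<open>diagonal_ev_le\<close>, the finitely many
  early ones by their own uniform continuity.\<close>

lemma Mn_equicontinuous_at:
  assumes \<phi>: "\<phi> \<in> Ccont" and e: "e > 0"
  shows "\<exists>d>0. \<forall>k y. dist y x < d \<longrightarrow> cmod ((M ^^ k) \<phi> y - (M ^^ k) \<phi> x) < e"
proof -
  obtain k0 where k0: "(x, x) \<in> ev_le (u_diff \<phi>) (e/2) k0" using diagonal_ev_le[OF \<phi>, of "e/2"] e by auto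
  then obtain d0 where d0: "d0 > 0" "ball (x, x) d0 \<subseteq> ev_le (u_diff \<phi>) (e/2) k0" using open_ev_le openE by blast
  have fin: "\<exists>d>0. \<forall>k<n. \<forall>y. dist y x < d \<longrightarrow> cmod ((M ^^ k) \<phi> y - (M ^^ k) \<phi> x) < e" for n
  proof (induction n)
    case 0
    show ?case by (auto intro: exI[of _ 1])
  next
    case (Suc n)
    then obtain d1 where d1: "d1 > 0" "\<forall>k<n. \<forall>y. dist y x < d1 \<longrightarrow> cmod ((M ^^ k) \<phi> y - (M ^^ k) \<phi> x) < e" by blast
    obtain d2 where d2: "d2 > 0" "\<And>x y. dist x y < d2 \<Longrightarrow> cmod ((M ^^ n) \<phi> x - (M ^^ n) \<phi> y) < e"
      using Ccont_uniform[OF Mn_Ccont[OF \<phi>] e] by blast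
    show ?case using d1 d2 by (intro exI[of _ "min d1 d2"]) (auto simp: less_Suc_eq)
  qed
  obtain d1 where d1: "d1 > 0" "\<forall>k<k0. \<forall>y. dist y x < d1 \<longrightarrow> cmod ((M ^^ k) \<phi> y - (M ^^ k) \<phi> x) < e" using fin by blast
  have "cmod ((M ^^ k) \<phi> y - (M ^^ k) \<phi> x) < e" if y: "dist y x < min d0 d1" for k y
  proof (cases "k < k0")
    case False
    have "(y, x) \<in> ball (x, x) d0" using y by (simp add: dist_Pair_Pair dist_commute)
    then have "u_diff \<phi> k (y, x) \<le> e/2" using d0(2) False ev_leD[of "(y, x)" "u_diff \<phi>" "e/2" k0 k] by auto
    then show ?thesis using e by (simp add: u_diff_def)
  qed (use y d1 in auto)
  then show ?thesis using d0(1) d1(1) by (intro exI[of _ "min d0 d1"]) auto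
qed

end

section \<open>Pointwise limits and idempotents\<close>

text \<open>Zorn's lemma on complements. Compactness makes the intersection of a chain nonempty, so
  \<open>Int\<close> may assume this. It yields both minimal subsemigroups and minimal invariant
  sets.\<close>

lemma minimal_closed:
  fixes \<A> :: "'a::topological_space set set"
  assumes U: "compact (UNIV :: 'a set)" and ne: "\<A> \<noteq> {}"
    and cl: "\<And>T. T \<in> \<A> \<Longrightarrow> closed T \<and> T \<noteq> {}"
    and Int: "\<And>\<C>. \<C> \<noteq> {} \<Longrightarrow> \<C> \<subseteq> \<A> \<Longrightarrow> \<Inter>\<C> \<noteq> {} \<Longrightarrow> \<Inter>\<C> \<in> \<A>"
  shows "\<exists>T\<in>\<A>. \<forall>T'\<in>\<A>. T' \<subseteq> T \<longrightarrow> T' = T"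
proof -
  have "\<exists>M\<in>uminus ` \<A>. \<forall>X\<in>uminus ` \<A>. M \<subseteq> X \<longrightarrow> X = M"
  proof (rule subset_Zorn_nonempty)
    show "uminus ` \<A> \<noteq> {}" using ne by simp
    fix \<C> assume C: "\<C> \<noteq> {}" "subset.chain (uminus ` \<A>) \<C>"
    define \<D> where "\<D> = uminus ` \<C>"
    have DA: "\<D> \<subseteq> \<A>" using C(2) by (auto simp: \<D>_def subset.chain_def)
    have D: "\<D> \<noteq> {}" using C(1) by (simp add: \<D>_def)
    have chain: "A \<subseteq> B \<or> B \<subseteq> A" if "A \<in> \<D>" "B \<in> \<D>" for A B
      using that C(2) unfolding \<D>_def subset_chain_def by blast
    have "UNIV \<inter> \<Inter>\<D> \<noteq> {}"
    proof (rule compact_imp_fip[OF U])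
      show "closed T" if "T \<in> \<D>" for T using that DA cl by blast
      show "UNIV \<inter> \<Inter>F \<noteq> {}" if F: "finite F" "F \<subseteq> \<D>" for F
      proof (cases "F = {}")
        case False
        have "subset.chain \<D> F" using F(2) chain unfolding subset_chain_def by blast
        then have "\<Inter>F \<in> F" by (rule Inter_in_chain[OF F(1) False])
        then show ?thesis using F(2) DA cl by blast
      qed simp
    qed
    then have "\<Inter>\<D> \<in> \<A>" using Int[OF D DA] by simp
    moreover have "\<Union>\<C> = - \<Inter>\<D>" by (auto simp: \<D>_def)
    ultimately show "\<Union>\<C> \<in> uminus ` \<A>" by blast
  qed
  then obtain X where X: "X \<in> uminus ` \<A>" "\<forall>Y\<in>uminus ` \<A>. X \<subseteq> Y \<longrightarrow> Y = X" by (elim bexE)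
  obtain T where T: "T \<in> \<A>" "X = - T" using X(1) by (elim imageE)
  show ?thesis
  proof (rule bexI[OF _ T(1)], intro ballI impI)
    fix T' assume "T' \<in> \<A>" "T' \<subseteq> T"
    then have "- T' \<in> uminus ` \<A>" "X \<subseteq> - T'" using T(2) by auto
    then have "- T' = X" using X(2) by (simp only:)
    then have "- T' = - T" using T(2) by (simp only:)
    then show "T' = T" by simp
  qed
qed

lemma compact_UNIV_fun:
  assumes "compact (UNIV :: 'b::topological_space set)"
  shows "compact (UNIV :: ('a \<Rightarrow> 'b) set)"
proof -
  have "compact_space (euclidean :: 'b topology)" using assms by (simp add: compact_space_def)
  then have "compact_space (product_topology (\<lambda>_ :: 'a. euclidean :: 'b topology) UNIV)"
    by (simp add: compact_space_product_topology)
  then show ?thesis by (simp add: euclidean_product_topology compact_space_def)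
qed

lemma compact_fun_imp_closed:
  fixes K :: "('a \<Rightarrow> 'b::metric_space) set"
  assumes "compact K" shows "closed K"
proof -
  have "Hausdorff_space (product_topology (\<lambda>_ :: 'a. euclidean :: 'b topology) UNIV)"
    by (simp add: Hausdorff_space_product_topology)
  then have "Hausdorff_space (euclidean :: ('a \<Rightarrow> 'b) topology)" by (simp only: euclidean_product_topology)
  then have "closedin (euclidean :: ('a \<Rightarrow> 'b) topology) K"
    by (rule compactin_imp_closedin) (use assms in simp)
  then show ?thesis by simp
qed

lemma continuous_on_comp_right: "continuous_on A (\<lambda>p. p \<circ> f)"
  by (rule continuous_on_coordinatewise_then_product)
     (auto intro: continuous_on_subset[OF continuous_on_product_coordinates])

lemma continuous_on_comp_left:
  fixes q :: "'b::topological_space \<Rightarrow> 'c::topological_space"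
  assumes "continuous_on UNIV q" shows "continuous_on A (\<lambda>p. q \<circ> p)"
  by (rule continuous_on_coordinatewise_then_product)
     (auto intro!: continuous_on_compose2[OF assms] continuous_on_subset[OF continuous_on_product_coordinates])

lemma continuous_image_closure:
  assumes "continuous_on UNIV f" "x \<in> closure A" shows "f x \<in> closure (f ` A)"
proof -
  have "closed (f -` closure (f ` A))" by (rule closed_vimage[OF closed_closure assms(1)])
  moreover have "A \<subseteq> f -` closure (f ` A)" using closure_subset by fastforce
  ultimately have "closure A \<subseteq> f -` closure (f ` A)" by (rule closure_minimal[rotated])
  then show ?thesis using assms(2) by blast
qed

lemma closure_fun_closed:
  assumes "p \<in> closure A" "closed K" "\<And>h. h \<in> A \<Longrightarrow> h x \<in> K" shows "p x \<in> K"
proof -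
  have "p x \<in> closure ((\<lambda>h. h x) ` A)"
    by (rule continuous_image_closure[OF continuous_on_product_coordinates assms(1)])
  moreover have "closure ((\<lambda>h. h x) ` A) \<subseteq> K" using assms by (intro closure_minimal) auto
  ultimately show ?thesis by blast
qed

lemma closure_fun_approx:
  fixes p :: "'a \<Rightarrow> 'b::metric_space"
  assumes p: "p \<in> closure A" and X: "finite X" and e: "e > 0"
  obtains h where "h \<in> A" "\<And>x. x \<in> X \<Longrightarrow> dist (h x) (p x) < e"
proof -
  let ?U = "\<Inter>x\<in>X. (\<lambda>h. h x) -` ball (p x) e"
  have "open ?U" using X by (intro open_INT ballI open_vimage continuous_on_product_coordinates open_ball)
  moreover have "p \<in> ?U" using e by simp
  ultimately obtain h where h: "h \<in> A" "h \<in> ?U" using p unfolding closure_iff_nhds_not_empty by blast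
  have "dist (h x) (p x) < e" if "x \<in> X" for x using h(2) that by (auto simp: dist_commute)
  then show ?thesis by (rule that[OF h(1)])
qed

text \<open>Ellis--Numakura: composition of functions is continuous in the left factor only.\<close>

lemma idempotent_exists:
  fixes S :: "('a::metric_space \<Rightarrow> 'a) set"
  assumes U: "compact (UNIV :: 'a set)" and S: "closed S" "S \<noteq> {}" "\<And>p q. p \<in> S \<Longrightarrow> q \<in> S \<Longrightarrow> p \<circ> q \<in> S"
  obtains e where "e \<in> S" "e \<circ> e = e"
proof -
  define \<A> where "\<A> = {T. T \<subseteq> S \<and> closed T \<and> T \<noteq> {} \<and> (\<forall>p\<in>T. \<forall>q\<in>T. p \<circ> q \<in> T)}"
  have UF: "compact (UNIV :: ('a \<Rightarrow> 'a) set)" by (rule compact_UNIV_fun[OF U])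
  have "\<exists>T\<in>\<A>. \<forall>T'\<in>\<A>. T' \<subseteq> T \<longrightarrow> T' = T"
  proof (rule minimal_closed[OF UF])
    have "S \<in> \<A>" using S by (simp add: \<A>_def)
    then show "\<A> \<noteq> {}" by blast
    show "closed T \<and> T \<noteq> {}" if "T \<in> \<A>" for T using that by (simp add: \<A>_def)
    show "\<Inter>\<C> \<in> \<A>" if C: "\<C> \<noteq> {}" "\<C> \<subseteq> \<A>" "\<Inter>\<C> \<noteq> {}" for \<C>
    proof -
      have "\<Inter>\<C> \<subseteq> S" using C(1,2) unfolding \<A>_def by blast
      moreover have "closed (\<Inter>\<C>)" using C(2) by (intro closed_Inter) (auto simp: \<A>_def)
      moreover have "p \<circ> q \<in> \<Inter>\<C>" if "p \<in> \<Inter>\<C>" "q \<in> \<Inter>\<C>" for p q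
      proof
        fix X assume X: "X \<in> \<C>"
        then have "p \<in> X" "q \<in> X" "X \<in> \<A>" using that C(2) by blast+
        then show "p \<circ> q \<in> X" by (simp add: \<A>_def)
      qed
      ultimately show ?thesis using C(3) unfolding \<A>_def by blast
    qed
  qed
  then obtain T where T: "T \<in> \<A>" and min: "\<And>T'. T' \<in> \<A> \<Longrightarrow> T' \<subseteq> T \<Longrightarrow> T' = T" by blast
  have TS: "T \<subseteq> S" "closed T" "T \<noteq> {}" and Tc: "\<And>p q. p \<in> T \<Longrightarrow> q \<in> T \<Longrightarrow> p \<circ> q \<in> T"
    using T by (auto simp: \<A>_def)
  obtain e where e: "e \<in> T" using TS by blast
  have "compact T" using compact_Int_closed[OF UF TS(2)] by simp
  then have "compact ((\<lambda>p. p \<circ> e) ` T)" by (rule compact_continuous_image[OF continuous_on_comp_right])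
  then have cl: "closed ((\<lambda>p. p \<circ> e) ` T)" by (rule compact_fun_imp_closed)
  have sub: "(\<lambda>p. p \<circ> e) ` T \<subseteq> T" using Tc e by blast
  \<comment> \<open>The left ideal T \<circ> e is closed, being the compact image under the
    continuous right composition. By minimality it is all of T, so e = p0 \<circ> e for some
    p0.\<close>
  have "(\<lambda>p. p \<circ> e) ` T \<in> \<A>"
    unfolding \<A>_def mem_Collect_eq
  proof (intro conjI ballI cl)
    show "(\<lambda>p. p \<circ> e) ` T \<subseteq> S" using sub TS by blast
    show "(\<lambda>p. p \<circ> e) ` T \<noteq> {}" using e by blast
    fix p q assume "p \<in> (\<lambda>p. p \<circ> e) ` T" "q \<in> (\<lambda>p. p \<circ> e) ` T"
    then obtain p' q' where "p' \<in> T" "q' \<in> T" "p = p' \<circ> e" "q = q' \<circ> e" by blast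
    then show "p \<circ> q \<in> (\<lambda>p. p \<circ> e) ` T"
      by (intro image_eqI[of _ _ "p' \<circ> (e \<circ> q')"]) (auto simp: o_assoc intro: Tc e)
  qed
  then have "(\<lambda>p. p \<circ> e) ` T = T" using sub by (rule min)
  then have "e \<in> (\<lambda>p. p \<circ> e) ` T" using e by (simp only:)
  then obtain p0 where p0: "p0 \<in> T" "p0 \<circ> e = e" by (elim imageE) (rule that, auto)
  \<comment> \<open>The elements p of T with p \<circ> e = e, written pointwise so that closedness
    is visible. This subsemigroup contains p0, so it is T, and e itself belongs to it.\<close>
  define N where "N = T \<inter> (\<Inter>z. (\<lambda>p. p (e z)) -` {e z})"
  have "N \<in> \<A>"
    unfolding \<A>_def mem_Collect_eq
  proof (intro conjI ballI)
    show "N \<subseteq> S" using TS by (auto simp: N_def)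
    show "closed N" unfolding N_def
      by (intro closed_Int TS(2) closed_INT ballI closed_vimage closed_singleton continuous_on_product_coordinates)
    show "N \<noteq> {}" using p0 by (auto simp: N_def fun_eq_iff)
    show "p \<circ> q \<in> N" if "p \<in> N" "q \<in> N" for p q
      using that Tc by (auto simp: N_def)
  qed
  then have "N = T" by (rule min) (auto simp: N_def)
  then have "e \<circ> e = e" using e by (auto simp: N_def fun_eq_iff)
  then show ?thesis using that e TS by blast
qed

text \<open>Approximation is available only at finitely many points at a time. For each w, a
  sequence approximating E at w and on ever more of a countable dense set has, by Montel, a
  holomorphic limit \<open>H w\<close> that equals E at w and on the dense set. By continuity all
  these limits are one function, which is therefore E.\<close>

lemma pointwise_closure_holomorphic:
  assumes \<rho>: "\<rho> > 0" and hol: "\<And>F. F \<in> \<H> \<Longrightarrow> F holomorphic_on ball z0 \<rho>"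
    and bd: "\<And>F w. F \<in> \<H> \<Longrightarrow> w \<in> ball z0 \<rho> \<Longrightarrow> cmod (F w) \<le> B"
    and approx: "\<And>X e. finite X \<Longrightarrow> X \<subseteq> ball z0 \<rho> \<Longrightarrow> e > 0 \<Longrightarrow> \<exists>F\<in>\<H>. \<forall>w\<in>X. cmod (F w - E w) < e"
  shows "E holomorphic_on ball z0 \<rho>"
proof -
  obtain D :: "complex set" where D: "countable D" "\<And>X. open X \<Longrightarrow> X \<noteq> {} \<Longrightarrow> \<exists>d\<in>D. d \<in> X"
    by (rule countable_dense_setE) blast
  define D' where "D' = D \<inter> ball z0 \<rho>"
  have D'ne: "D' \<noteq> {}" using D(2)[of "ball z0 \<rho>"] \<rho> by (auto simp: D'_def)
  have D'c: "countable D'" using D(1) by (auto simp: D'_def)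
  define d where "d = from_nat_into D'"
  have rd: "range d = D'" unfolding d_def by (rule range_from_nat_into[OF D'ne D'c])
  have "\<exists>H. H holomorphic_on ball z0 \<rho> \<and> H w = E w \<and> (\<forall>u\<in>D'. H u = E u)" if w: "w \<in> ball z0 \<rho>" for w
  proof -
    have "\<exists>F\<in>\<H>. \<forall>u\<in>insert w (d ` {..n}). cmod (F u - E u) < 1 / (real n + 1)" for n
      by (rule approx) (use w rd D'_def in auto)
    then obtain F where F: "\<And>n. F n \<in> \<H>" "\<And>n u. u \<in> insert w (d ` {..n}) \<Longrightarrow> cmod (F n u - E u) < 1 / (real n + 1)"
      by metis
    obtain H r where H: "H holomorphic_on ball z0 \<rho>" "strict_mono (r :: nat \<Rightarrow> nat)"
      "\<And>x. x \<in> ball z0 \<rho> \<Longrightarrow> (\<lambda>n. F (r n) x) \<longlonglongrightarrow> H x"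
    proof (rule Montel[of "ball z0 \<rho>" \<H> F])
      show "\<exists>B. \<forall>h\<in>\<H>. \<forall>z\<in>K. cmod (h z) \<le> B" if "compact K" "K \<subseteq> ball z0 \<rho>" for K
        using bd that by (intro exI[of _ B]) blast
      show "range F \<subseteq> \<H>" using F(1) by blast
    qed (use hol in auto)
    have lim0: "(\<lambda>n. 1 / (real (r n) + 1)) \<longlonglongrightarrow> 0"
      using LIMSEQ_subseq_LIMSEQ[OF LIMSEQ_inverse_real_of_nat H(2)] by (simp add: o_def inverse_eq_divide add.commute)
    have *: "H u = E u" if u: "u \<in> ball z0 \<rho>" and N: "\<And>n. N \<le> n \<Longrightarrow> u \<in> insert w (d ` {..n})" for u N
    proof (rule LIMSEQ_unique[OF H(3)[OF u]])
      have "eventually (\<lambda>n. norm (F (r n) u - E u) \<le> 1 / (real (r n) + 1)) sequentially"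
      proof (rule eventually_sequentiallyI[of N])
        fix n assume "N \<le> n"
        then have "N \<le> r n" using seq_suble[OF H(2)] order_trans by blast
        then show "norm (F (r n) u - E u) \<le> 1 / (real (r n) + 1)" using F(2)[OF N] less_imp_le by blast
      qed
      then have "(\<lambda>n. F (r n) u - E u) \<longlonglongrightarrow> 0" by (rule Lim_null_comparison[OF _ lim0])
      then show "(\<lambda>n. F (r n) u) \<longlonglongrightarrow> E u" by (simp add: LIM_zero_iff)
    qed
    have "H w = E w" by (rule *[OF w, of 0]) simp
    moreover have "H u = E u" if "u \<in> D'" for u
    proof -
      obtain N where N: "u = d N" using rd \<open>u \<in> D'\<close> by blast
      show ?thesis using \<open>u \<in> D'\<close> by (intro *[of u N]) (auto simp: N D'_def)
    qed
    ultimately show ?thesis using H(1) by blast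
  qed
  then obtain H where H: "\<And>w. w \<in> ball z0 \<rho> \<Longrightarrow> H w holomorphic_on ball z0 \<rho>"
    "\<And>w. w \<in> ball z0 \<rho> \<Longrightarrow> H w w = E w" "\<And>w u. w \<in> ball z0 \<rho> \<Longrightarrow> u \<in> D' \<Longrightarrow> H w u = E u" by metis
  have z0: "z0 \<in> ball z0 \<rho>" using \<rho> by simp
  have "H z0 w = E w" if w: "w \<in> ball z0 \<rho>" for w
  proof (rule ccontr)
    assume neq: "H z0 w \<noteq> E w"
    let ?f = "\<lambda>u. H z0 u - H w u"
    have "continuous_on (ball z0 \<rho>) ?f"
      by (intro continuous_on_diff holomorphic_on_imp_continuous_on H z0 w)
    then have "open (ball z0 \<rho> \<inter> ?f -` (- {0}))"
      by (intro continuous_open_preimage) auto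
    moreover have "w \<in> ball z0 \<rho> \<inter> ?f -` (- {0})" using w neq H(2)[OF w] by simp
    ultimately obtain u where "u \<in> D" "u \<in> ball z0 \<rho> \<inter> ?f -` (- {0})" using D(2) by blast
    then show False using H(3)[OF z0, of u] H(3)[OF w, of u] by (simp add: D'_def)
  qed
  then show ?thesis using H(1)[OF z0] by (rule holomorphic_transform[rotated])
qed

section \<open>Holomorphic limits\<close>

definition equi_at :: "(rsphere \<Rightarrow> rsphere) set \<Rightarrow> rsphere \<Rightarrow> bool" where
  "equi_at F x = (\<forall>\<epsilon>>0. \<exists>d>0. \<forall>f\<in>F. \<forall>y. dist y x < d \<longrightarrow> dist (f y) (f x) < \<epsilon>)"

text \<open>The family is a parameter because the notion is applied to the semigroup, to its right
  translates by a fixed g, and to their conjugates under \<open>flip\<close>. Equicontinuity is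
  asked at the one point x only.\<close>

definition Hol_limit :: "(rsphere \<Rightarrow> rsphere) set \<Rightarrow> rsphere \<Rightarrow> (rsphere \<Rightarrow> rsphere) \<Rightarrow> bool" where
  "Hol_limit F x e = ((\<forall>f\<in>F. Hol f) \<and> equi_at F x \<and> e \<in> closure F)"

lemma equi_atE:
  assumes "equi_at F x" "\<epsilon> > 0"
  obtains d where "d > 0" "\<And>f y. f \<in> F \<Longrightarrow> dist y x < d \<Longrightarrow> dist (f y) (f x) < \<epsilon>"
  using assms unfolding equi_at_def by blast

lemma equi_at_closure:
  assumes "equi_at F x" "\<epsilon> > 0"
  shows "\<exists>d>0. \<forall>e\<in>closure F. \<forall>y. dist y x < d \<longrightarrow> dist (e y) (e x) < \<epsilon>"
proof -
  have e4: "\<epsilon> / 4 > 0" using assms(2) by simp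
  obtain d where d: "d > 0" "\<And>f y. f \<in> F \<Longrightarrow> dist y x < d \<Longrightarrow> dist (f y) (f x) < \<epsilon> / 4"
    by (rule equi_atE[OF assms(1) e4]) blast
  have "dist (e y) (e x) < \<epsilon>" if e: "e \<in> closure F" and y: "dist y x < d" for e y
  proof -
    obtain f where f: "f \<in> F" "\<And>z. z \<in> {x, y} \<Longrightarrow> dist (f z) (e z) < \<epsilon> / 4"
      using closure_fun_approx[OF e _ e4, of "{x, y}"] by blast
    have "dist (e y) (e x) \<le> dist (f y) (e y) + dist (f y) (f x) + dist (f x) (e x)"
      by (smt (verit) dist_triangle dist_commute)
    then show ?thesis using f(2)[of x] f(2)[of y] d(2)[OF f(1) y] e4 by simp
  qed
  then show ?thesis using d(1) by blast
qed

definition conj_flip :: "(rsphere \<Rightarrow> rsphere) \<Rightarrow> rsphere \<Rightarrow> rsphere" where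
  "conj_flip f = flip \<circ> f \<circ> flip"

lemma conj_flip_apply: "conj_flip f x = flip (f (flip x))"
  by (simp add: conj_flip_def)

lemma Hol_limit_flip:
  assumes "Hol_limit F x e" shows "Hol_limit (conj_flip ` F) (flip x) (conj_flip e)"
proof -
  have "continuous_on UNIV conj_flip"
  proof -
    have "conj_flip = (\<lambda>p. flip \<circ> p) \<circ> (\<lambda>p. p \<circ> flip)" by (simp add: fun_eq_iff conj_flip_def)
    then show ?thesis
      by (metis continuous_on_compose continuous_on_comp_left continuous_on_comp_right continuous_on_flip)
  qed
  then have "conj_flip e \<in> closure (conj_flip ` F)"
    by (rule continuous_image_closure) (use assms in \<open>simp add: Hol_limit_def\<close>)
  moreover have "\<forall>f\<in>conj_flip ` F. Hol f" using assms Hol_flip by (simp add: Hol_limit_def conj_flip_def)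
  moreover have "equi_at (conj_flip ` F) (flip x)"
    unfolding equi_at_def
  proof (intro allI impI)
    fix \<epsilon> :: real assume \<epsilon>: "\<epsilon> > 0"
    have "equi_at F x" using assms by (simp add: Hol_limit_def)
    then obtain d where d: "d > 0" "\<And>f y. f \<in> F \<Longrightarrow> dist y x < d \<Longrightarrow> dist (f y) (f x) < \<epsilon>"
      using \<epsilon> by (rule equi_atE) blast
    have "dist (conj_flip f y) (conj_flip f (flip x)) < \<epsilon>" if "f \<in> F" "dist y (flip x) < d" for f y
      using d(2)[of f "flip y"] that dist_flip[of "flip y" x] by (simp add: conj_flip_apply)
    then show "\<exists>d>0. \<forall>f\<in>conj_flip ` F. \<forall>y. dist y (flip x) < d \<longrightarrow> dist (f y) (f (flip x)) < \<epsilon>"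
      using d(1) by (intro exI[of _ d]) auto
  qed
  ultimately show ?thesis by (simp add: Hol_limit_def)
qed

text \<open>Near the fixed point, equicontinuity keeps suitable approximants away from
  \<open>infty\<close>, hence bounded in the chart, and \<open>pointwise_closure_holomorphic\<close>
  applies.\<close>

lemma Hol_limit_holomorphic:
  assumes L: "Hol_limit F (emb z0) e" and fix0: "e (emb z0) = emb z0" and far: "dist (emb z0) infty \<ge> sqrt 2"
  obtains \<rho> where "\<rho> > 0" "(\<lambda>w. co (e (emb w))) holomorphic_on ball z0 \<rho>"
    "\<And>w. w \<in> ball z0 \<rho> \<Longrightarrow> e (emb w) = emb (co (e (emb w)))"
proof -
  have s2: "sqrt 2 \<ge> 1" by simp
  have "equi_at F (emb z0)" using L by (simp add: Hol_limit_def)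
  then obtain d where d: "d > 0" "\<And>f y. f \<in> F \<Longrightarrow> dist y (emb z0) < d \<Longrightarrow> dist (f y) (f (emb z0)) < 1/4"
    by (rule equi_atE[where \<epsilon> = "1/4"]) (simp, blast)
  have near: "dist (emb w) (emb z0) < d" if "w \<in> ball z0 (d / 2)" for w
    using that dist_emb_le[of w z0] by (simp add: dist_commute)
  \<comment> \<open>Only approximants that nearly fix \<open>emb z0\<close>: near it their values
    are at distance at least sqrt 2 - 1/4 - 1/4 from \<open>infty\<close>. As e fixes
    \<open>emb z0\<close>, adding this point to the test points shows that they still approximate
    e.\<close>
  define F' where "F' = {f \<in> F. dist (f (emb z0)) (emb z0) < 1/4}"
  have F': "dist (f (emb w)) infty \<ge> 1/2" if f: "f \<in> F'" and w: "w \<in> ball z0 (d / 2)" for f w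
  proof -
    have "dist (f (emb w)) (f (emb z0)) < 1/4" using d(2)[OF _ near[OF w]] f by (simp add: F'_def)
    moreover have "dist (f (emb z0)) (emb z0) < 1/4" using f by (simp add: F'_def)
    moreover have "dist (emb z0) infty \<le> dist (f (emb z0)) (emb z0) + dist (f (emb w)) (f (emb z0)) + dist (f (emb w)) infty"
      by (smt (verit) dist_triangle dist_commute)
    ultimately show ?thesis using far s2 by linarith
  qed
  have eF: "e \<in> closure F" using L by (simp add: Hol_limit_def)
  have approx: "\<exists>f\<in>F'. \<forall>x\<in>X. dist (f x) (e x) < \<epsilon>" if X: "finite X" and \<epsilon>: "\<epsilon> > 0" for X \<epsilon>
  proof -
    have "min \<epsilon> (1/4) > 0" using \<epsilon> by simp
    then obtain f where f: "f \<in> F" "\<And>x. x \<in> insert (emb z0) X \<Longrightarrow> dist (f x) (e x) < min \<epsilon> (1/4)"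
      using closure_fun_approx[OF eF, of "insert (emb z0) X"] X by blast
    have "f \<in> F'" using f(1) f(2)[of "emb z0"] fix0 by (simp add: F'_def)
    moreover have "dist (f x) (e x) < \<epsilon>" if "x \<in> X" for x using f(2)[of x] that by simp
    ultimately show ?thesis by blast
  qed
  have e_far: "dist (e (emb w)) infty \<ge> 1/2" if w: "w \<in> ball z0 (d / 2)" for w
  proof (rule ccontr)
    assume "\<not> dist (e (emb w)) infty \<ge> 1/2"
    then have "1/2 - dist (e (emb w)) infty > 0" by simp
    then obtain f where "f \<in> F'" "dist (f (emb w)) (e (emb w)) < 1/2 - dist (e (emb w)) infty"
      using approx[of "{emb w}"] by blast
    then show False using F'[OF _ w, of f] dist_triangle[of "f (emb w)" infty "e (emb w)"] by linarith
  qed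
  have half: "(0::real) < 1/2" by simp
  have E: "e (emb w) = emb (co (e (emb w)))" "cmod (co (e (emb w))) \<le> 4" if "w \<in> ball z0 (d / 2)" for w
    using cmod_co_le[OF e_far[OF that] half] by simp_all
  have Ff: "f (emb w) = emb (co (f (emb w)))" "cmod (co (f (emb w))) \<le> 4" if "f \<in> F'" "w \<in> ball z0 (d / 2)" for f w
    using cmod_co_le[OF F'[OF that] half] by simp_all
  have "(\<lambda>w. co (e (emb w))) holomorphic_on ball z0 (d / 2)"
  proof (rule pointwise_closure_holomorphic[where \<H> = "(\<lambda>f w. co (f (emb w))) ` F'" and B = 4])
    show "d / 2 > 0" using d(1) by simp
    show "h holomorphic_on ball z0 (d / 2)" if h: "h \<in> (\<lambda>f w. co (f (emb w))) ` F'" for h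
    proof -
      obtain f where f: "f \<in> F'" "h = (\<lambda>w. co (f (emb w)))" using h by blast
      have "Hol f" using f(1) L by (simp add: F'_def Hol_limit_def)
      then show ?thesis unfolding f(2)
      proof (rule Hol_holomorphic)
        show "f (emb w) \<noteq> infty" if "w \<in> ball z0 (d / 2)" for w using F'[OF f(1) that] by auto
      qed
    qed
    show "cmod (h w) \<le> 4" if "h \<in> (\<lambda>f w. co (f (emb w))) ` F'" "w \<in> ball z0 (d / 2)" for h w
      using that Ff(2) by auto
    show "\<exists>h\<in>(\<lambda>f w. co (f (emb w))) ` F'. \<forall>w\<in>X. cmod (h w - co (e (emb w))) < \<epsilon>"
      if X: "finite X" "X \<subseteq> ball z0 (d / 2)" "\<epsilon> > 0" for X \<epsilon>
    proof -
      \<comment> \<open>On the disc of radius 4 the inverse chart has Lipschitz constant (1 + 16) /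
        2 = 17 / 2 < 9.\<close>
      have "\<epsilon> / 9 > 0" using X by simp
      then obtain f where f: "f \<in> F'" "\<forall>x\<in>emb ` X. dist (f x) (e x) < \<epsilon> / 9"
        using approx[of "emb ` X"] X by blast
      have "cmod (co (f (emb w)) - co (e (emb w))) < \<epsilon>" if w: "w \<in> X" for w
      proof -
        have wb: "w \<in> ball z0 (d / 2)" using w X by blast
        have "dist (co (f (emb w))) (co (e (emb w))) \<le> (1 + 4\<^sup>2) / 2 * dist (emb (co (f (emb w)))) (emb (co (e (emb w))))"
          by (rule dist_emb_ge) (use Ff(2)[OF f(1) wb] E(2)[OF wb] in auto)
        also have "\<dots> = 17 / 2 * dist (f (emb w)) (e (emb w))"
          by (simp flip: Ff(1)[OF f(1) wb] E(1)[OF wb])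
        also have "\<dots> \<le> 17 / 2 * (\<epsilon> / 9)" using f(2) w by (intro mult_left_mono) auto
        also have "\<dots> < \<epsilon>" using X(3) by simp
        finally show ?thesis by (simp add: dist_norm)
      qed
      then have "\<forall>w\<in>X. cmod ((\<lambda>w. co (f (emb w))) w - co (e (emb w))) < \<epsilon>" by simp
      moreover have "(\<lambda>w. co (f (emb w))) \<in> (\<lambda>f w. co (f (emb w))) ` F'" using f(1) by (rule imageI)
      ultimately show ?thesis by (rule bexI)
    qed
  qed
  then show ?thesis using that[of "d / 2"] d(1) E(1) by simp
qed

lemma flip_transfer_nhds:
  assumes "r > 0" "\<And>y. dist y (flip x) < r \<Longrightarrow> P (flip y)" shows "\<exists>r>0. \<forall>y. dist y x < r \<longrightarrow> P y"
proof (intro exI[of _ r] conjI allI impI)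
  fix y assume "dist y x < r"
  then show "P y" using assms(2)[of "flip y"] by simp
qed (use assms in auto)

lemma emb_ball_dist:
  assumes "\<rho> > 0"
  obtains r where "r > 0" "\<And>y. dist y (emb z0) < r \<Longrightarrow> \<exists>w\<in>ball z0 \<rho>. y = emb w"
proof -
  obtain r where r: "r > 0" "ball (emb z0) r \<subseteq> emb ` ball z0 \<rho>" using emb_ball_nhds[OF assms] .
  show ?thesis
  proof (rule that[OF r(1)])
    fix y assume "dist y (emb z0) < r"
    then have "y \<in> emb ` ball z0 \<rho>" using r(2) by (auto simp: dist_commute)
    then show "\<exists>w\<in>ball z0 \<rho>. y = emb w" by blast
  qed
qed

text \<open>The image of a nonconstant holomorphic idempotent contains an open set, on which it is the identity.\<close>

lemma idempotent_dichotomy: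
  assumes "Hol_limit F x e" "e \<circ> e = e" "e x = x"
  shows "(\<exists>r>0. \<forall>y. dist y x < r \<longrightarrow> e y = x) \<or> (\<exists>r>0. \<forall>y. dist y x < r \<longrightarrow> e y = y)"
proof -
  have *: "(\<exists>r>0. \<forall>y. dist y (emb z0) < r \<longrightarrow> e y = emb z0) \<or> (\<exists>r>0. \<forall>y. dist y (emb z0) < r \<longrightarrow> e y = y)"
    if L: "Hol_limit F (emb z0) e" "e \<circ> e = e" "e (emb z0) = emb z0" "dist (emb z0) infty \<ge> sqrt 2" for F z0 e
  proof -
    let ?E = "\<lambda>w. co (e (emb w))"
    obtain \<rho> where \<rho>: "\<rho> > 0" "?E holomorphic_on ball z0 \<rho>"
      "\<And>w. w \<in> ball z0 \<rho> \<Longrightarrow> e (emb w) = emb (?E w)"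
      using Hol_limit_holomorphic[OF L(1,3,4)] by blast
    have E0: "?E z0 = z0" using L(3) by simp
    have z0: "z0 \<in> ball z0 \<rho>" using \<rho>(1) by simp
    show ?thesis
    proof (cases "?E constant_on ball z0 \<rho>")
      case True
      then have c: "?E w = z0" if "w \<in> ball z0 \<rho>" for w
        using that z0 E0 unfolding constant_on_def by metis
      obtain r where r: "r > 0" "\<And>y. dist y (emb z0) < r \<Longrightarrow> \<exists>w\<in>ball z0 \<rho>. y = emb w"
        using emb_ball_dist[OF \<rho>(1)] by blast
      have "e y = emb z0" if y: "dist y (emb z0) < r" for y
      proof -
        obtain w where w: "w \<in> ball z0 \<rho>" "y = emb w" using r(2)[OF y] by blast
        then show ?thesis using \<rho>(3)[OF w(1)] c[OF w(1)] by simp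
      qed
      then show ?thesis using r(1) by blast
    next
      case False
      have cont: "continuous_on (ball z0 \<rho>) ?E" using \<rho>(2) by (rule holomorphic_on_imp_continuous_on)
      let ?U = "ball z0 \<rho> \<inter> ?E -` ball z0 \<rho>"
      have U: "open ?U" by (rule continuous_open_preimage[OF cont]) auto
      have O: "open (?E ` ?U)"
        by (rule open_mapping_thm[OF \<rho>(2) open_ball _ U _ False]) (auto simp: convex_connected)
      have "z0 \<in> ?U" using z0 E0 by simp
      then have z0O: "z0 \<in> ?E ` ?U" using E0 by force
      have id: "e (emb v) = emb v" if v: "v \<in> ?E ` ?U" for v
      proof -
        obtain w where w: "w \<in> ?U" "v = ?E w" using v by blast
        then have "emb v = e (emb w)" using \<rho>(3) by simp
        then show ?thesis using L(2) by (metis comp_apply)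
      qed
      obtain s where s: "s > 0" "ball z0 s \<subseteq> ?E ` ?U" using O z0O openE by blast
      obtain r where r: "r > 0" "\<And>y. dist y (emb z0) < r \<Longrightarrow> \<exists>w\<in>ball z0 s. y = emb w"
        using emb_ball_dist[OF s(1)] by blast
      have "e y = y" if y: "dist y (emb z0) < r" for y
      proof -
        obtain w where w: "w \<in> ball z0 s" "y = emb w" using r(2)[OF y] by blast
        then show ?thesis using id s(2) by blast
      qed
      then show ?thesis using r(1) by blast
    qed
  qed
  show ?thesis
  proof (rule hemisphere[of x])
    assume far: "sqrt 2 \<le> dist x infty"
    have s2: "0 < sqrt (2::real)" by simp
    have "x = emb (co x)" by (rule cmod_co_le(1)[OF far s2])
    then obtain z0 where z0: "x = emb z0" by blast
    show ?thesis using *[of F z0 e] assms far unfolding z0 by blast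
  next
    assume far: "sqrt 2 \<le> dist (flip x) infty"
    have s2: "0 < sqrt (2::real)" by simp
    have "flip x = emb (co (flip x))" by (rule cmod_co_le(1)[OF far s2])
    then obtain z0 where z0: "flip x = emb z0" by blast
    have 2: "conj_flip e \<circ> conj_flip e = conj_flip e"
    proof
      fix y
      have "e (e (flip y)) = e (flip y)" using assms(2) by (metis comp_apply)
      then show "(conj_flip e \<circ> conj_flip e) y = conj_flip e y" by (simp add: conj_flip_apply)
    qed
    have 3: "conj_flip e (emb z0) = emb z0" using assms(3) z0 by (metis conj_flip_apply flip_flip)
    from *[OF Hol_limit_flip[OF assms(1), unfolded z0] 2 3 far[unfolded z0]]
    show ?thesis
    proof
      assume "\<exists>r>0. \<forall>y. dist y (emb z0) < r \<longrightarrow> conj_flip e y = emb z0"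
      then obtain r where r: "r > 0" "\<And>y. dist y (flip x) < r \<Longrightarrow> conj_flip e y = flip x" using z0 by metis
      have "\<exists>r>0. \<forall>y. dist y x < r \<longrightarrow> e y = x"
        by (rule flip_transfer_nhds[OF r(1)]) (metis r(2) conj_flip_apply flip_flip)
      then show ?thesis by blast
    next
      assume "\<exists>r>0. \<forall>y. dist y (emb z0) < r \<longrightarrow> conj_flip e y = y"
      then obtain r where r: "r > 0" "\<And>y. dist y (flip x) < r \<Longrightarrow> conj_flip e y = y" using z0 by metis
      have "\<exists>r>0. \<forall>y. dist y x < r \<longrightarrow> e y = y"
        by (rule flip_transfer_nhds[OF r(1)]) (metis r(2) conj_flip_apply flip_flip)
      then show ?thesis by blast
    qed
  qed
qed

text \<open>Equicontinuity at x passes to the limit e, so accumulation of fixed points at x forces e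
  x = x. Then e is holomorphic near x, and the identity theorem spreads the identity from a nearby
  open set.\<close>

lemma identity_propagates:
  assumes "Hol_limit F x e" "x \<in> closure (interior {y. e y = y})"
  shows "x \<in> interior {y. e y = y}"
proof -
  have ex: "e x = x" if L: "Hol_limit F x e" and x: "x \<in> closure (interior {y. e y = y})" for F x e
  proof (rule ccontr)
    assume "e x \<noteq> x"
    then have p: "dist (e x) x / 2 > 0" by simp
    have eq: "equi_at F x" "e \<in> closure F" using L by (simp_all add: Hol_limit_def)
    obtain d where d: "d > 0" "\<And>y. dist y x < d \<Longrightarrow> dist (e y) (e x) < dist (e x) x / 2"
      using equi_at_closure[OF eq(1) p] eq(2) by blast
    have "min d (dist (e x) x / 2) > 0" using d(1) p by simp
    then obtain y where y: "y \<in> interior {y. e y = y}" "dist y x < min d (dist (e x) x / 2)"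
      using x unfolding closure_approachable by blast
    have "e y = y" using y(1) interior_subset by blast
    then show False using d(2)[of y] y(2) dist_triangle[of "e x" x y] by (simp add: dist_commute)
  qed
  have *: "\<exists>r>0. \<forall>y. dist y (emb z0) < r \<longrightarrow> e y = y"
    if L: "Hol_limit F (emb z0) e" "emb z0 \<in> closure (interior {y. e y = y})" "dist (emb z0) infty \<ge> sqrt 2" for F z0 e
  proof -
    let ?E = "\<lambda>w. co (e (emb w))"
    obtain \<rho> where \<rho>: "\<rho> > 0" "?E holomorphic_on ball z0 \<rho>"
      "\<And>w. w \<in> ball z0 \<rho> \<Longrightarrow> e (emb w) = emb (?E w)"
      using Hol_limit_holomorphic[OF L(1) ex[OF L(1,2)] L(3)] by blast
    let ?U = "ball z0 \<rho> \<inter> emb -` interior {y. e y = y}"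
    have oemb: "open (emb -` interior {y. e y = y})" by (intro open_vimage open_interior continuous_intros)
    then have U: "open ?U" by auto
    have "emb z0 \<in> emb ` ball z0 \<rho>" using \<rho>(1) by simp
    then have "interior {y. e y = y} \<inter> emb ` ball z0 \<rho> \<noteq> {}"
      using L(2) open_emb_image[OF open_ball] by (metis IntI closure_iff_nhds_not_empty empty_iff inf_commute subset_refl)
    then have Une: "?U \<noteq> {}" by blast
    have EU: "?E w = w" if "w \<in> ?U" for w
    proof -
      have "e (emb w) = emb w" using that interior_subset[of "{y. e y = y}"] by blast
      then show ?thesis by simp
    qed
    have E: "?E w = w" if "w \<in> ball z0 \<rho>" for w
      by (rule analytic_continuation_open[OF U open_ball Une _ _ \<rho>(2) _ EU that])
         (auto simp: convex_connected)
    obtain r where r: "r > 0" "\<And>y. dist y (emb z0) < r \<Longrightarrow> \<exists>w\<in>ball z0 \<rho>. y = emb w"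
      using emb_ball_dist[OF \<rho>(1)] by blast
    have "e y = y" if y: "dist y (emb z0) < r" for y
    proof -
      obtain w where w: "w \<in> ball z0 \<rho>" "y = emb w" using r(2)[OF y] by blast
      then show ?thesis using \<rho>(3)[OF w(1)] E[OF w(1)] by simp
    qed
    then show ?thesis using r(1) by blast
  qed
  have "\<exists>r>0. \<forall>y. dist y x < r \<longrightarrow> e y = y"
  proof (rule hemisphere[of x])
    assume far: "sqrt 2 \<le> dist x infty"
    have s2: "0 < sqrt (2::real)" by simp
    have "x = emb (co x)" by (rule cmod_co_le(1)[OF far s2])
    then obtain z0 where z0: "x = emb z0" by blast
    show ?thesis using *[of F z0 e] assms far unfolding z0 by blast
  next
    assume far: "sqrt 2 \<le> dist (flip x) infty"
    have s2: "0 < sqrt (2::real)" by simp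
    have "flip x = emb (co (flip x))" by (rule cmod_co_le(1)[OF far s2])
    then obtain z0 where z0: "flip x = emb z0" by blast
    have "flip ` interior {y. e y = y} \<subseteq> interior {y. conj_flip e y = y}"
    proof (rule interior_maximal)
      show "flip ` interior {y. e y = y} \<subseteq> {y. conj_flip e y = y}"
        using interior_subset by (fastforce simp: conj_flip_apply)
    qed (intro open_flip_image open_interior)
    then have "closure (flip ` interior {y. e y = y}) \<subseteq> closure (interior {y. conj_flip e y = y})"
      by (rule closure_mono)
    moreover have "flip x \<in> closure (flip ` interior {y. e y = y})"
      by (rule continuous_image_closure[OF continuous_on_flip assms(2)])
    ultimately have "emb z0 \<in> closure (interior {y. conj_flip e y = y})" using z0 by auto
    from *[OF Hol_limit_flip[OF assms(1), unfolded z0] this far[unfolded z0]]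
    obtain r where r: "r > 0" "\<And>y. dist y (flip x) < r \<Longrightarrow> conj_flip e y = y" using z0 by metis
    show ?thesis
      by (rule flip_transfer_nhds[OF r(1)]) (metis r(2) conj_flip_apply flip_flip)
  qed
  then obtain r where r: "r > 0" "\<And>y. dist y x < r \<Longrightarrow> e y = y" by blast
  show ?thesis
    by (rule interiorI[of "ball x r"]) (use r in \<open>auto simp: dist_commute\<close>)
qed

section \<open>Contraction at minimal sets\<close>

text \<open>Two passages to the limit, one factor at a time: first in the right factor with the left
  one in A and so continuous, then in the left factor, where composition is always
  continuous.\<close>

lemma closure_comp_closed:
  fixes A :: "('a::topological_space \<Rightarrow> 'a) set"
  assumes cont: "\<And>a. a \<in> A \<Longrightarrow> continuous_on UNIV a" and comp: "\<And>a b. a \<in> A \<Longrightarrow> b \<in> A \<Longrightarrow> a \<circ> b \<in> A"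
    and p: "p \<in> closure A" and q: "q \<in> closure A"
  shows "p \<circ> q \<in> closure A"
proof -
  have "a \<circ> q \<in> closure A" if a: "a \<in> A" for a
  proof -
    have "a \<circ> q \<in> closure ((\<lambda>b. a \<circ> b) ` A)"
      by (rule continuous_image_closure[OF continuous_on_comp_left[OF cont[OF a]] q])
    moreover have "(\<lambda>b. a \<circ> b) ` A \<subseteq> A" by (intro image_subsetI comp a)
    ultimately show ?thesis by (rule subsetD[OF closure_mono, rotated])
  qed
  then have "closure ((\<lambda>a. a \<circ> q) ` A) \<subseteq> closure A" by (intro closure_minimal image_subsetI closed_closure)
  moreover have "p \<circ> q \<in> closure ((\<lambda>a. a \<circ> q) ` A)"
    by (rule continuous_image_closure[OF continuous_on_comp_right p])
  ultimately show ?thesis by blast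
qed

lemma compact_closure_fun: "compact (closure (A :: ('a \<Rightarrow> rsphere) set))"
  using compact_Int_closed[OF compact_UNIV_fun[OF compact_UNIV_rsphere] closed_closure] by simp

lemma open_Fatou: "open (Fatou H)"
proof (subst open_subopen, intro ballI)
  fix z assume "z \<in> Fatou H"
  then obtain U where "open U" "z \<in> U" "equicont_on H U" by (auto simp: Fatou_def)
  then show "\<exists>T. open T \<and> z \<in> T \<and> T \<subseteq> Fatou H" by (intro exI[of _ U]) (auto simp: Fatou_def)
qed

lemma compact_rsphere: "closed K \<Longrightarrow> compact (K :: rsphere set)"
  using compact_Int_closed[OF compact_UNIV_rsphere] by simp

section \<open>Orbit closures, minimal sets and idempotent limits\<close>

context random_rational
begin

lemma G_cont: "g \<in> G \<Longrightarrow> continuous_on A g"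
  using G_Hol Hol_continuous by blast

lemma Gamma_nonempty: "\<exists>g. g \<in> \<Gamma>"
proof (rule ccontr)
  assume "\<not> (\<exists>g. g \<in> \<Gamma>)"
  then have "AE g in \<tau>. False" using AE_Gamma by simp
  then show False using AE_False by blast
qed

lemma G_nonempty: "\<exists>g. g \<in> G"
  using Gamma_nonempty Gamma_G by blast

lemma clG_comp: "p \<in> closure G \<Longrightarrow> q \<in> closure G \<Longrightarrow> p \<circ> q \<in> closure G"
  by (rule closure_comp_closed) (auto intro: G_cont G_comp)

lemma G_clG: "g \<in> G \<Longrightarrow> g \<in> closure G"
  using closure_subset by blast

lemma clG_invariant:
  assumes "fwd_inv G K" "p \<in> closure G" "x \<in> K" shows "p x \<in> K"
proof (rule closure_fun_closed[OF assms(2)])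
  show "closed K" using assms(1) by (simp add: fwd_inv_def compact_imp_closed)
  show "h x \<in> K" if "h \<in> G" for h using assms that by (auto simp: fwd_inv_def)
qed

text \<open>Without an identity in the semigroup, x need not belong to it; for x in a minimal set it
  is nevertheless the whole minimal set.\<close>

definition orbit_closure :: "rsphere \<Rightarrow> rsphere set" where
  "orbit_closure x = closure ((\<lambda>h. h x) ` G)"

lemma orbit_closure_fwd_inv: "fwd_inv G (orbit_closure x)"
  unfolding fwd_inv_def
proof (intro conjI ballI)
  show "orbit_closure x \<noteq> {}" using G_nonempty by (auto simp: orbit_closure_def)
  show "compact (orbit_closure x)" unfolding orbit_closure_def by (rule compact_rsphere) simp
  show "g ` orbit_closure x \<subseteq> orbit_closure x" if g: "g \<in> G" for g
  proof -
    have "g ` closure ((\<lambda>h. h x) ` G) \<subseteq> closure (g ` (\<lambda>h. h x) ` G)"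
      using continuous_image_closure[OF G_cont[OF g]] by blast
    moreover have "g ` (\<lambda>h. h x) ` G \<subseteq> (\<lambda>h. h x) ` G"
    proof (clarsimp)
      fix h assume "h \<in> G"
      then show "g (h x) \<in> (\<lambda>h. h x) ` G" by (intro image_eqI[of _ _ "g \<circ> h"] G_comp g) auto
    qed
    ultimately show ?thesis unfolding orbit_closure_def using closure_mono by blast
  qed
qed

lemma orbit_closure_subset:
  assumes "fwd_inv G K" "x \<in> K" shows "orbit_closure x \<subseteq> K"
  unfolding orbit_closure_def
proof (rule closure_minimal)
  show "closed K" using assms(1) by (simp add: fwd_inv_def compact_imp_closed)
  show "(\<lambda>h. h x) ` G \<subseteq> K" using assms by (auto simp: fwd_inv_def)
qed

lemma fwd_inv_contains_minimal:
  assumes "fwd_inv G K" obtains L where "L \<in> Min_sets G" "L \<subseteq> K"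
proof -
  let ?A = "{L. fwd_inv G L \<and> L \<subseteq> K}"
  have "\<exists>T\<in>?A. \<forall>T'\<in>?A. T' \<subseteq> T \<longrightarrow> T' = T"
  proof (rule minimal_closed[OF compact_UNIV_rsphere])
    show "?A \<noteq> {}" using assms by blast
    show "closed T \<and> T \<noteq> {}" if "T \<in> ?A" for T using that by (auto simp: fwd_inv_def compact_imp_closed)
    show "\<Inter>\<C> \<in> ?A" if C: "\<C> \<noteq> {}" "\<C> \<subseteq> ?A" "\<Inter>\<C> \<noteq> {}" for \<C>
    proof -
      have "closed (\<Inter>\<C>)" using C(2) by (intro closed_Inter) (auto simp: fwd_inv_def compact_imp_closed)
      then have "compact (\<Inter>\<C>)" by (rule compact_rsphere)
      moreover have "g ` \<Inter>\<C> \<subseteq> \<Inter>\<C>" if "g \<in> G" for g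
        using that C(2) unfolding fwd_inv_def by blast
      ultimately show ?thesis using C unfolding fwd_inv_def by blast
    qed
  qed
  then obtain T where T: "fwd_inv G T" "T \<subseteq> K" "\<And>T'. fwd_inv G T' \<Longrightarrow> T' \<subseteq> K \<Longrightarrow> T' \<subseteq> T \<Longrightarrow> T' = T" by blast
  have "T \<in> Min_sets G" unfolding Min_sets_def using T by blast
  then show ?thesis using that T(2) by blast
qed

lemma Min_setsD:
  assumes "L \<in> Min_sets G"
  shows "fwd_inv G L" "\<And>K. fwd_inv G K \<Longrightarrow> K \<subseteq> L \<Longrightarrow> K = L"
  using assms unfolding Min_sets_def by blast+

lemma fwd_inv_nonempty: "fwd_inv G L \<Longrightarrow> \<exists>z. z \<in> L"
  by (auto simp: fwd_inv_def)

lemma orbit_closure_minimal: "L \<in> Min_sets G \<Longrightarrow> x \<in> L \<Longrightarrow> orbit_closure x = L"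
  using Min_setsD orbit_closure_fwd_inv orbit_closure_subset by blast

text \<open>Only the image g x has to be in the Fatou set. So right translates can be used at a
  point x that may itself be in the Julia set.\<close>

lemma equi_at_Fatou:
  assumes g: "continuous_on UNIV g" and F: "g x \<in> Fatou G"
  shows "equi_at ((\<lambda>h. h \<circ> g) ` G) x"
  unfolding equi_at_def
proof (intro allI impI)
  fix \<epsilon> :: real assume "\<epsilon> > 0"
  then obtain d where d: "d > 0" "\<And>u v h. dist u (g x) < d \<Longrightarrow> dist v (g x) < d \<Longrightarrow> h \<in> G \<Longrightarrow> dist (h u) (h v) < \<epsilon>"
    using Fatou_equi[OF F] by blast
  obtain d' where d': "d' > 0" "\<And>y. dist y x < d' \<Longrightarrow> dist (g y) (g x) < d"
    using g d(1) unfolding continuous_on_iff by blast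
  have "dist (h (g y)) (h (g x)) < \<epsilon>" if "h \<in> G" "dist y x < d'" for h y
    using d(2)[of "g y" "g x" h] d'(2)[OF that(2)] d(1) that(1) by simp
  then show "\<exists>d>0. \<forall>f\<in>(\<lambda>h. h \<circ> g) ` G. \<forall>y. dist y x < d \<longrightarrow> dist (f y) (f x) < \<epsilon>"
    using d'(1) by (intro exI[of _ d']) auto
qed

lemma equi_at_G: "x \<in> Fatou G \<Longrightarrow> equi_at G x"
  using equi_at_Fatou[of "\<lambda>x. x" x] by (simp add: o_def)

lemma Fatou_intro:
  assumes "open U" "x \<in> U" "\<And>y. y \<in> U \<Longrightarrow> equi_at G y" shows "x \<in> Fatou G"
proof -
  have "equicont_on G U"
    unfolding equicont_on_def
  proof (intro ballI allI impI)
    fix y and \<epsilon> :: real assume y: "y \<in> U" and \<epsilon>: "\<epsilon> > 0"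
    obtain d where d: "d > 0" "\<And>f w. f \<in> G \<Longrightarrow> dist w y < d \<Longrightarrow> dist (f w) (f y) < \<epsilon>"
      by (rule equi_atE[OF assms(3)[OF y] \<epsilon>]) blast
    have "dist (g y) (g w) < \<epsilon>" if "g \<in> G" "dist y w < d" for g w
      using d(2)[of g w] that by (simp add: dist_commute)
    then show "\<exists>d>0. \<forall>w\<in>U. \<forall>g\<in>G. dist y w < d \<longrightarrow> dist (g y) (g w) < \<epsilon>" using d(1) by blast
  qed
  then show ?thesis using assms by (auto simp: Fatou_def)
qed

lemma right_translate_comp:
  assumes "g \<in> G" "a \<in> (\<lambda>h. h \<circ> g) ` G" "b \<in> (\<lambda>h. h \<circ> g) ` G"
  shows "a \<circ> b \<in> (\<lambda>h. h \<circ> g) ` G"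
proof -
  obtain h h' where h: "h \<in> G" "a = h \<circ> g" "h' \<in> G" "b = h' \<circ> g" using assms(2,3) by (elim imageE) (rule that)
  have "a \<circ> b = (h \<circ> (g \<circ> h')) \<circ> g" by (simp add: h fun_eq_iff)
  moreover have "h \<circ> (g \<circ> h') \<in> G" by (intro G_comp h assms(1))
  ultimately show ?thesis by (metis (no_types) image_eqI)
qed

text \<open>The limits of maps h \<circ> g that fix z form a closed semigroup. It is nonempty
  because by minimality z lies in the orbit closure of g z, and compactness turns this into a limit
  sending z to z. Right translates are used so that e factors as p \<circ> g.\<close>

lemma idempotent_at:
  assumes L: "L \<in> Min_sets G" and z: "z \<in> L" and g: "g \<in> G"
  obtains e where "e \<in> closure ((\<lambda>h. h \<circ> g) ` G)" "e \<circ> e = e" "e z = z"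
proof -
  let ?A = "(\<lambda>h. h \<circ> g) ` G"
  let ?S = "closure ?A \<inter> (\<lambda>p. p z) -` {z}"
  have cont: "continuous_on UNIV a" if a: "a \<in> ?A" for a
  proof -
    obtain h where "h \<in> G" "a = h \<circ> g" using a by (elim imageE)
    then show ?thesis using G_cont[OF G_comp[OF _ g]] by (simp only:)
  qed
  have "closed ?S" by (intro closed_Int closed_closure closed_vimage closed_singleton continuous_on_product_coordinates)
  moreover have "?S \<noteq> {}"
  proof -
    have "compact ((\<lambda>p. p z) ` closure ?A)"
      by (intro compact_continuous_image compact_closure_fun continuous_on_subset[OF continuous_on_product_coordinates]) auto
    then have "closed ((\<lambda>p. p z) ` closure ?A)" by (rule compact_imp_closed)
    moreover have "(\<lambda>h. h (g z)) ` G \<subseteq> (\<lambda>p. p z) ` closure ?A"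
    proof
      fix y assume "y \<in> (\<lambda>h. h (g z)) ` G"
      then obtain h where h: "h \<in> G" "y = h (g z)" by blast
      have "h \<circ> g \<in> closure ?A" by (rule subsetD[OF closure_subset imageI[OF h(1)]])
      then show "y \<in> (\<lambda>p. p z) ` closure ?A" using h by (intro image_eqI[of _ _ "h \<circ> g"]) auto
    qed
    ultimately have "orbit_closure (g z) \<subseteq> (\<lambda>p. p z) ` closure ?A" unfolding orbit_closure_def by (intro closure_minimal)
    moreover have "g z \<in> L" using Min_setsD(1)[OF L] g z by (auto simp: fwd_inv_def)
    ultimately have "z \<in> (\<lambda>p. p z) ` closure ?A" using orbit_closure_minimal[OF L] z by blast
    then show ?thesis by force
  qed
  moreover have "p \<circ> q \<in> ?S" if p: "p \<in> ?S" and q: "q \<in> ?S" for p q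
  proof -
    have "p \<circ> q \<in> closure ?A"
      by (rule closure_comp_closed[OF cont right_translate_comp[OF g]]) (use p q in auto)
    then show ?thesis using p q by auto
  qed
  ultimately obtain e where "e \<in> ?S" "e \<circ> e = e" by (rule idempotent_exists[OF compact_UNIV_rsphere]) blast
  then show ?thesis using that by blast
qed

lemma closure_right_translate:
  assumes "e \<in> closure ((\<lambda>h. h \<circ> g) ` G)" obtains p where "p \<in> closure G" "e = p \<circ> g"
proof -
  have "compact ((\<lambda>p. p \<circ> g) ` closure G)"
    by (rule compact_continuous_image[OF continuous_on_comp_right compact_closure_fun])
  then have "closed ((\<lambda>p. p \<circ> g) ` closure G)" by (rule compact_fun_imp_closed)
  moreover have "(\<lambda>h. h \<circ> g) ` G \<subseteq> (\<lambda>p. p \<circ> g) ` closure G" by (rule image_mono[OF closure_subset])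
  ultimately have "closure ((\<lambda>h. h \<circ> g) ` G) \<subseteq> (\<lambda>p. p \<circ> g) ` closure G" by (intro closure_minimal)
  then have "e \<in> (\<lambda>p. p \<circ> g) ` closure G" using assms by (rule subsetD)
  then show ?thesis using that by (elim imageE)
qed

end

locale mean_stable = random_rational_ker +
  assumes J_ne: "Julia G \<noteq> {}" and S_Fatou: "S_of \<tau> \<subseteq> Fatou G"
begin

text \<open>If no limit of the semigroup contracted a neighbourhood of \<open>z\<close>, every \<open>g\<close> would have a left
  quasi-inverse \<open>p\<close> with \<open>p \<circ> g\<close> the identity near \<open>z\<close>, hence on the Fatou component of \<open>z\<close>.
  Then \<open>g\<close> could not map a boundary point of this component into the Fatou set, and that
  point would lie in the kernel Julia set.\<close>

lemma contraction_at_minimal: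
  assumes L: "L \<in> Min_sets G" and z: "z \<in> L"
  shows "\<exists>p\<in>closure G. \<exists>r>0. \<forall>y. dist y z < r \<longrightarrow> p y = z"
proof (rule ccontr)
  assume no: "\<not> ?thesis"
  have LF: "L \<subseteq> Fatou G" using L S_Fatou by (auto simp: S_of_def)
  have Fz: "z \<in> Fatou G" using z LF by blast
  have limG: "e \<in> closure G" if e: "e \<in> closure ((\<lambda>h. h \<circ> g) ` G)" and g: "g \<in> G" for e g
  proof -
    have "(\<lambda>h. h \<circ> g) ` G \<subseteq> G" by (intro image_subsetI G_comp g)
    then show ?thesis using e by (rule subsetD[OF closure_mono])
  qed
  have HolA: "\<forall>f\<in>(\<lambda>h. h \<circ> g) ` G. Hol f" if g: "g \<in> G" for g
  proof
    fix f assume "f \<in> (\<lambda>h. h \<circ> g) ` G"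
    then obtain h where "h \<in> G" "f = h \<circ> g" by (elim imageE)
    then show "Hol f" using G_Hol[OF G_comp[OF _ g]] by (simp only:)
  qed
  \<comment> \<open>By \<open>no\<close>, the constant alternative of the dichotomy is excluded for
    each g.\<close>
  have near_id: "\<exists>e\<in>closure ((\<lambda>h. h \<circ> g) ` G). z \<in> interior {y. e y = y}" if g: "g \<in> G" for g
  proof -
    obtain e where e: "e \<in> closure ((\<lambda>h. h \<circ> g) ` G)" "e \<circ> e = e" "e z = z"
      using idempotent_at[OF L z g] .
    have "g z \<in> Fatou G" using Min_setsD(1)[OF L] g z LF by (auto simp: fwd_inv_def)
    then have "Hol_limit ((\<lambda>h. h \<circ> g) ` G) z e"
      unfolding Hol_limit_def using e(1) HolA[OF g] equi_at_Fatou[OF G_cont[OF g]] by blast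
    from idempotent_dichotomy[OF this e(2,3)] no limG[OF e(1) g]
    obtain r where r: "r > 0" "\<And>y. dist y z < r \<Longrightarrow> e y = y" by blast
    have "z \<in> interior {y. e y = y}"
      by (rule interiorI[of "ball z r"]) (use r in \<open>auto simp: dist_commute\<close>)
    then show ?thesis using e(1) by blast
  qed
  define U where "U = connected_component_set (Fatou G) z"
  have UF: "U \<subseteq> Fatou G" unfolding U_def by (rule connected_component_subset)
  have Uc: "connected U" unfolding U_def by (rule connected_connected_component)
  have zU: "z \<in> U" unfolding U_def using Fz by (simp add: connected_component_refl)
  have absorb: "D \<subseteq> U" if D: "connected D" "D \<subseteq> Fatou G" "D \<inter> U \<noteq> {}" for D
  proof -
    have "connected (D \<union> U)" by (rule connected_Un[OF D(1) Uc D(3)])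
    then have "D \<union> U \<subseteq> U" unfolding U_def
      by (rule connected_component_maximal[rotated]) (use zU UF D(2) U_def in auto)
    then show ?thesis by blast
  qed
  have Uo: "open U"
  proof (subst open_subopen, intro ballI)
    fix y assume y: "y \<in> U"
    obtain D where D: "open D" "connected D" "y \<in> D" "D \<subseteq> Fatou G"
      using rsphere_locally_connected[OF open_Fatou, of y G] y UF by blast
    then have "D \<subseteq> U" using absorb[of D] y by blast
    then show "\<exists>T. open T \<and> y \<in> T \<and> T \<subseteq> U" using D by blast
  qed
  \<comment> \<open>Otherwise the connected sphere would be split by U and its complement, which
    contains the nonempty Julia set.\<close>
  have "closure U \<noteq> U"
  proof
    assume "closure U = U"
    then have "open (- U)" by (metis closed_closure open_Compl)
    moreover have "- U \<noteq> {}" using UF J_ne by (auto simp: Julia_def)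
    ultimately show False using connectedD[OF connected_UNIV_rsphere Uo, of "- U"] zU by blast
  qed
  then obtain x where x: "x \<in> closure U" "x \<notin> U" using closure_subset by blast
  have xJ: "x \<notin> Fatou G"
  proof
    assume "x \<in> Fatou G"
    then obtain D where D: "open D" "connected D" "x \<in> D" "D \<subseteq> Fatou G"
      using rsphere_locally_connected[OF open_Fatou] by blast
    have "D \<inter> U \<noteq> {}" using x(1) D(1,3) by (meson closure_iff_nhds_not_empty disjoint_iff open_contains_ball subset_refl)
    then show False using absorb[OF D(2,4)] D(3) x(2) by blast
  qed
  have "g x \<notin> Fatou G" if g: "g \<in> G" for g
  proof
    assume gx: "g x \<in> Fatou G"
    obtain e where e: "e \<in> closure ((\<lambda>h. h \<circ> g) ` G)" "z \<in> interior {y. e y = y}" using near_id[OF g] by blast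
    let ?I = "interior {y. e y = y}"
    \<comment> \<open>The set where e is locally the identity is open and, by
      \<open>identity_propagates\<close>, relatively closed in the connected set U, so it fills
      U.\<close>
    have "U \<inter> - closure ?I = {}"
    proof (rule ccontr)
      assume ne: "U \<inter> - closure ?I \<noteq> {}"
      have "U \<subseteq> ?I \<union> - closure ?I"
      proof
        fix y assume y: "y \<in> U"
        have "Hol_limit G y e"
          unfolding Hol_limit_def using G_Hol limG[OF e(1) g] equi_at_G y UF by blast
        then show "y \<in> ?I \<union> - closure ?I" using identity_propagates by blast
      qed
      moreover have "?I \<inter> - closure ?I \<inter> U = {}" using closure_subset by blast
      moreover have "?I \<inter> U \<noteq> {}" using e(2) zU by blast
      ultimately show False
        using connectedD[OF Uc open_interior open_Compl[OF closed_closure], of "{y. e y = y}" ?I] ne by blast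
    qed
    then have "U \<subseteq> closure ?I" by blast
    then have "x \<in> closure ?I" using x(1) closure_minimal[OF _ closed_closure] by blast
    \<comment> \<open>The assumption that g x is in the Fatou set gives equicontinuity of the right
      translates at the boundary point x, so the identity extends across the boundary of U.\<close>
    moreover have "Hol_limit ((\<lambda>h. h \<circ> g) ` G) x e"
      unfolding Hol_limit_def using e(1) HolA[OF g] equi_at_Fatou[OF G_cont[OF g] gx] by blast
    ultimately have xI: "x \<in> ?I" using identity_propagates by blast
    obtain p where p: "p \<in> closure G" "e = p \<circ> g" using closure_right_translate[OF e(1)] .
    have "open (?I \<inter> g -` Fatou G)" by (intro open_Int open_interior open_vimage open_Fatou G_cont g)
    \<comment> \<open>Near x each q equals (q \<circ> p) \<circ> g, and q \<circ> p is a limit of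
      the semigroup, which is equicontinuous at g y. So equicontinuity is pulled back to y, and x
      would be in the Fatou set.\<close>
    moreover have "equi_at G y" if y: "y \<in> ?I \<inter> g -` Fatou G" for y
      unfolding equi_at_def
    proof (intro allI impI)
      fix \<epsilon> :: real assume \<epsilon>: "\<epsilon> > 0"
      have "equi_at G (g y)" using y equi_at_G by blast
      from equi_at_closure[OF this \<epsilon>]
      obtain d where d: "d > 0" "\<And>s w. s \<in> closure G \<Longrightarrow> dist w (g y) < d \<Longrightarrow> dist (s w) (s (g y)) < \<epsilon>" by blast
      obtain d1 where d1: "d1 > 0" "\<And>w. dist w y < d1 \<Longrightarrow> dist (g w) (g y) < d"
        using G_cont[OF g, of UNIV] d(1) unfolding continuous_on_iff by blast
      obtain d2 where d2: "d2 > 0" "ball y d2 \<subseteq> ?I" using y open_interior openE by blast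
      have "dist (q w) (q y) < \<epsilon>" if q: "q \<in> G" and w: "dist w y < min d1 d2" for q w
      proof -
        have I: "p (g v) = v" if "v \<in> ?I" for v using that interior_subset[of "{y. e y = y}"] p(2) by auto
        have "w \<in> ?I" "y \<in> ?I" using w d2 y by (auto simp: dist_commute)
        then have "q w = (q \<circ> p) (g w)" "q y = (q \<circ> p) (g y)" by (simp_all add: I)
        moreover have "q \<circ> p \<in> closure G" by (rule clG_comp[OF G_clG[OF q] p(1)])
        ultimately show ?thesis using d(2)[of "q \<circ> p" "g w"] d1(2)[of w] w by simp
      qed
      then show "\<exists>d>0. \<forall>q\<in>G. \<forall>w. dist w y < d \<longrightarrow> dist (q w) (q y) < \<epsilon>"
        using d1(1) d2(1) by (intro exI[of _ "min d1 d2"]) auto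
    qed
    ultimately have "x \<in> Fatou G" using xI gx by (intro Fatou_intro[of "?I \<inter> g -` Fatou G"]) auto
    then show False using xJ by blast
  qed
  then have "x \<in> Julia_ker G" by (auto simp: Julia_ker_def Julia_def)
  then show False using ker by blast
qed

end

section \<open>Asymptotically constant functions\<close>

context random_rational
begin

definition asymptotic_pair :: "(rsphere \<Rightarrow> complex) \<Rightarrow> rsphere \<Rightarrow> rsphere \<Rightarrow> bool" where
  "asymptotic_pair \<psi> x y = (\<forall>c>0. \<exists>k0. \<forall>k\<ge>k0. cmod ((M ^^ k) \<psi> x - (M ^^ k) \<psi> y) \<le> c)"

text \<open>Functions that take equal values wherever iteration merges values in the limit.
  Recurrent functions and eigenfunctions with unimodular eigenvalue are of this kind.\<close>

definition rigid :: "(rsphere \<Rightarrow> complex) \<Rightarrow> bool" where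
  "rigid \<psi> = (\<forall>x y. asymptotic_pair \<psi> x y \<longrightarrow> \<psi> x = \<psi> y)"

lemma S_fwd: "g \<in> G \<Longrightarrow> x \<in> S_of \<tau> \<Longrightarrow> g x \<in> S_of \<tau>"
proof -
  assume g: "g \<in> G" and "x \<in> S_of \<tau>"
  then obtain L where L: "L \<in> Min_sets G" "x \<in> L" unfolding S_of_def by (elim UnionE)
  then have "g x \<in> L" using Min_setsD(1)[OF L(1)] g by (auto simp: fwd_inv_def)
  then show "g x \<in> S_of \<tau>" using L(1) unfolding S_of_def by (rule UnionI[rotated])
qed

lemma Mn_zero_on_S:
  assumes "\<phi> \<in> Ccont" "\<And>x. x \<in> S_of \<tau> \<Longrightarrow> \<phi> x = 0"
  shows "x \<in> S_of \<tau> \<Longrightarrow> (M ^^ n) \<phi> x = 0"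
proof (induction n arbitrary: x)
  case (Suc n)
  have "cmod (\<integral>g. (M ^^ n) \<phi> (g x) \<partial>\<tau>) \<le> 0"
  proof (rule norm_integral_le)
    have "cmod ((M ^^ n) \<phi> (g x)) \<le> 0" if "g \<in> \<Gamma>" for g
      using Suc.IH[OF S_fwd[OF Gamma_G[OF that] Suc.prems]] by simp
    then show "AE g in \<tau>. cmod ((M ^^ n) \<phi> (g x)) \<le> 0" using AE_Gamma by auto
  qed (intro measurable_Ccont Mn_Ccont assms(1))
  moreover have "(M ^^ Suc n) \<phi> x = (\<integral>g. (M ^^ n) \<phi> (g x) \<partial>\<tau>)" by (simp only: funpow.simps o_apply Mop_def)
  ultimately show ?case by simp
qed (use assms in auto)

lemma clG_pairs:
  assumes "inv_pairs K" "closed K" "p \<in> closure G" "(x, y) \<in> K" shows "(p x, p y) \<in> K"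
proof -
  have "continuous_on UNIV (\<lambda>p :: rsphere \<Rightarrow> rsphere. (p x, p y))"
    by (intro continuous_on_Pair continuous_on_product_coordinates)
  then have "(p x, p y) \<in> closure ((\<lambda>p. (p x, p y)) ` G)" by (rule continuous_image_closure[OF _ assms(3)])
  moreover have "closure ((\<lambda>p. (p x, p y)) ` G) \<subseteq> K"
    using inv_pairs_G[OF assms(1) _ assms(4)] by (intro closure_minimal image_subsetI assms(2))
  ultimately show ?thesis by blast
qed

end

context random_rational_ker
begin

text \<open>The maximum principle for a function of the first coordinate: the first projection of an
  invariant set contains a minimal set, where all iterates vanish and near which they are small by
  equicontinuity.\<close>

lemma vanishing_on_S_decays:
  assumes \<phi>: "\<phi> \<in> Ccont" and zero: "\<And>x. x \<in> S_of \<tau> \<Longrightarrow> \<phi> x = 0" and c: "c > 0"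
  shows "\<exists>N. \<forall>n\<ge>N. \<forall>z. cmod ((M ^^ n) \<phi> z) \<le> c"
proof -
  let ?u = "\<lambda>k (p :: rsphere \<times> rsphere). cmod ((M ^^ k) \<phi> (fst p))"
  have cU: "compact (UNIV :: (rsphere \<times> rsphere) set)"
    using compact_Times[OF compact_UNIV_rsphere compact_UNIV_rsphere] by simp
  have ev: "\<exists>k. p \<in> ev_le ?u c k" for p
  proof (rule maximum_principle[where K = UNIV and B = "sup_norm \<phi>"])
    show "continuous_on UNIV (?u k)" for k
      using Mn_Ccont[OF \<phi>, of k] unfolding Ccont_def
      by (intro continuous_intros continuous_on_compose2[of UNIV "(M ^^ k) \<phi>" UNIV fst]) auto
    show "?u k p \<le> sup_norm \<phi>" for k p by (rule Mn_bound[OF \<phi> sup_norm_upper[OF \<phi>]])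
    show "?u (Suc k) p \<le> (\<integral>g. ?u k (map_prod g g p) \<partial>\<tau>)" for k p
    proof -
      have "cmod (\<integral>g. (M ^^ k) \<phi> (g (fst p)) \<partial>\<tau>) \<le> (\<integral>g. cmod ((M ^^ k) \<phi> (g (fst p))) \<partial>\<tau>)"
        by (rule integral_norm_bound)
      moreover have "(M ^^ Suc k) \<phi> (fst p) = (\<integral>g. (M ^^ k) \<phi> (g (fst p)) \<partial>\<tau>)" by (simp only: funpow.simps o_apply Mop_def)
      ultimately show ?thesis by simp
    qed
    show "inv_pairs UNIV" by (simp add: inv_pairs_def)
    fix K' :: "(rsphere \<times> rsphere) set" assume K': "K' \<noteq> {}" "compact K'" "inv_pairs K'"
    have "fwd_inv G (fst ` K')"
      unfolding fwd_inv_def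
    proof (intro conjI ballI image_subsetI)
      show "fst ` K' \<noteq> {}" using K' by simp
      show "compact (fst ` K')" by (intro compact_continuous_image K' continuous_intros)
      fix g x assume g: "g \<in> G" and x: "x \<in> fst ` K'"
      from x obtain y where "(x, y) \<in> K'" by auto
      then have "(g x, g y) \<in> K'" by (rule inv_pairs_G[OF K'(3) g])
      then show "g x \<in> fst ` K'" by force
    qed
    then obtain L where L: "L \<in> Min_sets G" "L \<subseteq> fst ` K'" by (rule fwd_inv_contains_minimal)
    obtain x where x: "x \<in> L" using fwd_inv_nonempty Min_setsD(1)[OF L(1)] by blast
    then obtain y where y: "(x, y) \<in> K'" using L(2) by auto
    have xS: "x \<in> S_of \<tau>" using x L(1) by (auto simp: S_of_def)
    have "(x, y) \<in> ev_le ?u c 0" if c: "c > 0" for c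
    proof -
      obtain d where d: "d > 0" "\<And>k w. dist w x < d \<Longrightarrow> cmod ((M ^^ k) \<phi> w - (M ^^ k) \<phi> x) < c"
        using Mn_equicontinuous_at[OF \<phi> c, of x] by blast
      have "ball x d \<times> UNIV \<subseteq> {q. \<forall>j\<ge>0. ?u j q \<le> c}"
      proof (intro subsetI CollectI allI impI)
        fix q j assume "q \<in> ball x d \<times> (UNIV :: rsphere set)"
        then have "dist (fst q) x < d" by (auto simp: dist_commute)
        from d(2)[OF this, of j] show "?u j q \<le> c" using Mn_zero_on_S[OF \<phi> zero, where x = x and n = j] xS by simp
      qed
      then show ?thesis unfolding ev_le_def
        using d(1) by (intro interiorI[of "ball x d \<times> UNIV"]) (auto intro!: open_Times)
    qed
    then show "\<exists>p\<in>K'. \<forall>c>0. \<exists>k. p \<in> ev_le ?u c k" using y by blast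
  qed (use cU c in auto)
  \<comment> \<open>Compactness turns the times \<open>k\<close>, so far depending on the point,
    into a single one.\<close>
  then have cov: "UNIV \<subseteq> (\<Union>k\<in>UNIV. ev_le ?u c k)" by auto
  obtain F where F: "finite F" "UNIV \<subseteq> (\<Union>k\<in>F. ev_le ?u c k)"
    using compactE_image[OF cU open_ev_le cov] by metis
  have "cmod ((M ^^ n) \<phi> z) \<le> c" if n: "Max F \<le> n" for n z
  proof -
    have "(z, z) \<in> (\<Union>k\<in>F. ev_le ?u c k)" using F(2) by blast
    then obtain k where k: "k \<in> F" "(z, z) \<in> ev_le ?u c k" by blast
    have "k \<le> n" using Max_ge[OF F(1) k(1)] n by simp
    from ev_leD[OF k(2) this] show ?thesis by simp
  qed
  then show ?thesis by blast
qed

end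

context mean_stable
begin

text \<open>Every orbit closure contains a minimal set, so some g brings x to a place where a limit
  p is constant; then p \<circ> g is constant near x.\<close>

lemma contracting_cover:
  obtains \<O> where "finite \<O>" "UNIV \<subseteq> \<Union>\<O>" "\<And>D. D \<in> \<O> \<Longrightarrow> open D \<and> (\<exists>p\<in>closure G. \<exists>c. \<forall>y\<in>D. p y = c)"
proof -
  let ?\<T> = "{D. open D \<and> (\<exists>p\<in>closure G. \<exists>c. \<forall>y\<in>D. p y = c)}"
  have "x \<in> \<Union>?\<T>" for x
  proof -
    obtain L where L: "L \<in> Min_sets G" "L \<subseteq> orbit_closure x"
      using fwd_inv_contains_minimal[OF orbit_closure_fwd_inv] .
    obtain z where z: "z \<in> L" using fwd_inv_nonempty Min_setsD(1)[OF L(1)] by blast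
    obtain p r where p: "p \<in> closure G" and r: "r > 0" "\<And>y. dist y z < r \<Longrightarrow> p y = z"
      using contraction_at_minimal[OF L(1) z] by blast
    have "z \<in> closure ((\<lambda>h. h x) ` G)" using z L(2) by (auto simp: orbit_closure_def)
    then obtain g where g: "g \<in> G" "dist (g x) z < r" using r(1) unfolding closure_approachable by auto
    let ?D = "g -` ball z r"
    have "open ?D" by (intro open_vimage open_ball G_cont g)
    moreover have "p \<circ> g \<in> closure G" by (rule clG_comp[OF p G_clG[OF g(1)]])
    moreover have "\<forall>y\<in>?D. (p \<circ> g) y = z" using r(2) by (auto simp: dist_commute)
    moreover have "x \<in> ?D" using g(2) by (simp add: dist_commute)
    ultimately show ?thesis by blast
  qed
  then have cov: "UNIV \<subseteq> \<Union>?\<T>" by blast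
  obtain \<O> where "\<O> \<subseteq> ?\<T>" "finite \<O>" "UNIV \<subseteq> \<Union>\<O>"
    by (rule compactE[OF compact_UNIV_rsphere cov]) auto
  then show ?thesis using that[of \<O>] by blast
qed

text \<open>Two minimal sets meeting the same member of the cover both contain its constant limit
  value, hence coincide.\<close>

lemma finite_Min_sets: "finite (Min_sets G)"
proof -
  obtain \<O> where O: "finite \<O>" "UNIV \<subseteq> \<Union>\<O>" "\<And>D. D \<in> \<O> \<Longrightarrow> open D \<and> (\<exists>p\<in>closure G. \<exists>c. \<forall>y\<in>D. p y = c)"
    using contracting_cover by blast
  have "\<exists>D\<in>\<O>. D \<inter> L \<noteq> {}" if L: "L \<in> Min_sets G" for L
  proof -
    obtain z where z: "z \<in> L" using fwd_inv_nonempty Min_setsD(1)[OF L] by blast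
    have "z \<in> \<Union>\<O>" using O(2) by blast
    then show ?thesis using z by blast
  qed
  then obtain f where f: "\<And>L. L \<in> Min_sets G \<Longrightarrow> f L \<in> \<O>" "\<And>L. L \<in> Min_sets G \<Longrightarrow> f L \<inter> L \<noteq> {}" by metis
  have "inj_on f (Min_sets G)"
  proof (rule inj_onI)
    fix L L' assume LL: "L \<in> Min_sets G" "L' \<in> Min_sets G" "f L = f L'"
    obtain x where x: "x \<in> f L" "x \<in> L" using f(2)[OF LL(1)] by blast
    obtain y where y: "y \<in> f L" "y \<in> L'" using f(2)[OF LL(2)] LL(3) by auto
    obtain p c where p: "p \<in> closure G" "\<forall>y\<in>f L. p y = c" using O(3)[OF f(1)[OF LL(1)]] by blast
    have cL: "c \<in> L" using clG_invariant[OF Min_setsD(1)[OF LL(1)] p(1) x(2)] p(2) x(1) by simp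
    have cL': "c \<in> L'" using clG_invariant[OF Min_setsD(1)[OF LL(2)] p(1) y(2)] p(2) y(1) by simp
    show "L = L'" using orbit_closure_minimal[OF LL(1) cL] orbit_closure_minimal[OF LL(2) cL'] by simp
  qed
  moreover have "f ` Min_sets G \<subseteq> \<O>" using f(1) by blast
  ultimately show ?thesis using O(1) by (rule inj_on_finite)
qed

lemma compact_S: "compact (S_of \<tau>)"
  unfolding S_of_def using finite_Min_sets
  by (intro compact_Union) (auto dest: Min_setsD(1) simp: fwd_inv_def)

text \<open>Two points near x stay within half a Lebesgue number of the contracting cover under the
  whole semigroup. Every pair in their orbit closure therefore lies in one member of the cover and
  is sent to the diagonal by a limit, where \<open>diagonal_ev_le\<close> provides the test point of
  the maximum principle.\<close>

lemma rigid_locally_constant: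
  assumes x: "x \<in> S_of \<tau>"
  shows "\<exists>\<delta>>0. \<forall>y. dist y x < \<delta> \<longrightarrow> (\<forall>\<psi>\<in>Ccont. asymptotic_pair \<psi> x y)"
proof -
  obtain \<O> where O: "finite \<O>" "UNIV \<subseteq> \<Union>\<O>" "\<And>D. D \<in> \<O> \<Longrightarrow> open D \<and> (\<exists>p\<in>closure G. \<exists>c. \<forall>y\<in>D. p y = c)"
    using contracting_cover by blast
  obtain \<eta> where \<eta>: "\<eta> > 0" "\<And>x. \<exists>D\<in>\<O>. ball x \<eta> \<subseteq> D"
    by (rule Heine_Borel_lemma[OF compact_UNIV_rsphere O(2)]) (use O(3) in auto)
  have "x \<in> Fatou G" using x S_Fatou by blast
  moreover have "\<eta> / 2 > 0" using \<eta>(1) by simp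
  ultimately obtain d where d: "d > 0" "\<And>u v h. dist u x < d \<Longrightarrow> dist v x < d \<Longrightarrow> h \<in> G \<Longrightarrow> dist (h u) (h v) < \<eta> / 2"
    using Fatou_equi by blast
  have "asymptotic_pair \<psi> x y" if y: "dist y x < min d (\<eta> / 2)" and \<psi>: "\<psi> \<in> Ccont" for y \<psi>
  proof -
    \<comment> \<open>The starting pair is added by hand, since the semigroup need not contain the
      identity.\<close>
    let ?Q = "insert (x, y) ((\<lambda>h. (h x, h y)) ` G)"
    let ?K = "closure ?Q"
    have "closed {q :: rsphere \<times> rsphere. dist (fst q) (snd q) \<le> \<eta> / 2}"
      by (intro closed_Collect_le continuous_intros)
    moreover have "?Q \<subseteq> {q. dist (fst q) (snd q) \<le> \<eta> / 2}"
      using d(2)[of x y] y d(1) by (auto simp: dist_commute less_imp_le)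
    ultimately have close: "?K \<subseteq> {q. dist (fst q) (snd q) \<le> \<eta> / 2}" by (intro closure_minimal)
    have inv: "inv_pairs ?K"
      unfolding inv_pairs_def
    proof
      fix g assume "g \<in> \<Gamma>"
      then have g: "g \<in> G" by (rule Gamma_G)
      have "continuous_on UNIV (map_prod g g)"
        unfolding map_prod_def case_prod_unfold
        by (intro continuous_on_Pair continuous_on_compose2[OF G_cont[OF g, of UNIV]] continuous_intros) auto
      then have A: "map_prod g g ` ?K \<subseteq> closure (map_prod g g ` ?Q)"
        by (intro image_subsetI continuous_image_closure)
      have B: "map_prod g g ` ?Q \<subseteq> ?Q"
      proof -
        have 1: "map_prod g g (x, y) \<in> ?Q" using g by simp
        have 2: "map_prod g g (h x, h y) \<in> ?Q" if h: "h \<in> G" for h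
        proof -
          have "((g \<circ> h) x, (g \<circ> h) y) \<in> (\<lambda>h. (h x, h y)) ` G" using G_comp[OF g h] by (rule imageI)
          then show ?thesis by simp
        qed
        show ?thesis
        proof (rule image_subsetI)
          fix q assume "q \<in> ?Q"
          then show "map_prod g g q \<in> ?Q"
          proof (elim insertE imageE)
            assume "q = (x, y)" then show ?thesis using 1 by (simp only:)
          next
            fix h assume "q = (h x, h y)" "h \<in> G" then show ?thesis using 2[of h] by (simp only:)
          qed
        qed
      qed
      show "map_prod g g ` ?K \<subseteq> ?K" by (rule order_trans[OF A closure_mono[OF B]])
    qed
    have cK: "compact ?K"
      using compact_Int_closed[OF compact_Times[OF compact_UNIV_rsphere compact_UNIV_rsphere] closed_closure, of ?Q] by simp
    have ev: "\<exists>k. (x, y) \<in> ev_le (u_diff \<psi>) c k" if c: "c > 0" for c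
    proof (rule maximum_principle[where K = ?K and u = "u_diff \<psi>" and B = "2 * sup_norm \<psi>", OF u_diff(1,2,3,4)[OF \<psi>] cK inv])
      show "c > 0" by (rule c)
      show "(x, y) \<in> ?K" using closure_subset[of ?Q] by blast
      fix K' assume K': "K' \<subseteq> ?K" "K' \<noteq> {}" "compact K'" "inv_pairs K'"
      obtain a b where ab: "(a, b) \<in> K'" using K'(2) by auto
      have "dist a b \<le> \<eta> / 2" using ab K'(1) close by auto
      then have "a \<in> ball a \<eta>" "b \<in> ball a \<eta>" using \<eta>(1) by auto
      moreover obtain D where D: "D \<in> \<O>" "ball a \<eta> \<subseteq> D" using \<eta>(2) by blast
      obtain p c' where p: "p \<in> closure G" "\<forall>y\<in>D. p y = c'" using O(3)[OF D(1)] by blast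
      ultimately have "p a = c'" "p b = c'" using D(2) by blast+
      then have "(c', c') \<in> K'" using clG_pairs[OF K'(4) compact_imp_closed[OF K'(3)] p(1) ab] by simp
      then show "\<exists>p\<in>K'. \<forall>c>0. \<exists>k. p \<in> ev_le (u_diff \<psi>) c k" using diagonal_ev_le[OF \<psi>] by blast
    qed
    show ?thesis
      unfolding asymptotic_pair_def
    proof (intro allI impI)
      fix c :: real assume "c > 0"
      then obtain k0 where k0: "(x, y) \<in> ev_le (u_diff \<psi>) c k0" using ev by blast
      have "cmod ((M ^^ k) \<psi> x - (M ^^ k) \<psi> y) \<le> c" if "k0 \<le> k" for k
        using ev_leD[OF k0 that] by (simp add: u_diff_def)
      then show "\<exists>k0. \<forall>k\<ge>k0. cmod ((M ^^ k) \<psi> x - (M ^^ k) \<psi> y) \<le> c" by blast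
    qed
  qed
  then show ?thesis using d(1) \<eta>(1) by (intro exI[of _ "min d (\<eta> / 2)"]) auto
qed

text \<open>Rigid functions are locally constant on the compact set \<open>S_of \<tau>\<close>, so
  finitely many values determine them there. All dimension counts below use this
  \<open>P\<close>.\<close>

lemma finite_test_set:
  obtains P where "finite P" "P \<subseteq> S_of \<tau>"
    "\<And>x. x \<in> S_of \<tau> \<Longrightarrow> \<exists>s\<in>P. \<forall>\<psi>\<in>Ccont. rigid \<psi> \<longrightarrow> \<psi> x = \<psi> s"
proof -
  obtain \<delta> where \<delta>: "\<And>x. x \<in> S_of \<tau> \<Longrightarrow> \<delta> x > 0"
    "\<And>x y \<psi>. x \<in> S_of \<tau> \<Longrightarrow> dist y x < \<delta> x \<Longrightarrow> \<psi> \<in> Ccont \<Longrightarrow> asymptotic_pair \<psi> x y"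
    using rigid_locally_constant by metis
  obtain P where P: "P \<subseteq> S_of \<tau>" "finite P" "S_of \<tau> \<subseteq> (\<Union>s\<in>P. ball s (\<delta> s))"
    by (rule compactE_image[OF compact_S, of "S_of \<tau>" "\<lambda>s. ball s (\<delta> s)"]) (use \<delta>(1) in auto)
  have "\<exists>s\<in>P. \<forall>\<psi>\<in>Ccont. rigid \<psi> \<longrightarrow> \<psi> x = \<psi> s" if x: "x \<in> S_of \<tau>" for x
  proof -
    have "x \<in> (\<Union>s\<in>P. ball s (\<delta> s))" using x P(3) by blast
    then obtain s where s: "s \<in> P" "dist x s < \<delta> s" by (auto simp: dist_commute)
    have "\<psi> x = \<psi> s" if "\<psi> \<in> Ccont" "rigid \<psi>" for \<psi>
      using \<delta>(2)[OF subsetD[OF P(1) s(1)] s(2) that(1)] that(2) unfolding rigid_def by simp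
    then show ?thesis using s(1) by blast
  qed
  then show ?thesis using that P by blast
qed

end

section \<open>Decaying and recurrent functions\<close>

text \<open>Linear combinations built term by term, to allow induction on the number of
  terms.\<close>

inductive_set lspan :: "(rsphere \<Rightarrow> complex) set \<Rightarrow> (rsphere \<Rightarrow> complex) set"
  for U where
  zero: "(\<lambda>_. 0) \<in> lspan U"
| add: "u \<in> U \<Longrightarrow> f \<in> lspan U \<Longrightarrow> (\<lambda>z. c * u z + f z) \<in> lspan U"

lemma LS_eq_lspan: "LS U = lspan U"
proof (intro set_eqI iffI)
  fix f assume "f \<in> LS U"
  then obtain A :: "nat set" and c u where A: "finite A" "\<forall>i\<in>A. u i \<in> U" and f: "f = (\<lambda>z. \<Sum>i\<in>A. c i * u i z)"
    unfolding LS_def by blast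
  show "f \<in> lspan U" unfolding f using A
    by (induction A rule: finite_induct) (auto intro: lspan.intros)
next
  fix f assume "f \<in> lspan U"
  then show "f \<in> LS U"
  proof induction
    case zero
    show ?case unfolding LS_def by (rule CollectI, rule exI[of _ "{}"]) auto
  next
    case (add v f d)
    from add.IH obtain A :: "nat set" and c u where A: "finite A" "\<forall>i\<in>A. u i \<in> U" and f: "f = (\<lambda>z. \<Sum>i\<in>A. c i * u i z)"
      unfolding LS_def by blast
    obtain k where k: "k \<notin> A" using ex_new_if_finite[OF infinite_UNIV_nat A(1)] by blast
    have "(\<lambda>z. d * v z + f z) = (\<lambda>z. \<Sum>i\<in>insert k A. (c(k := d)) i * (u(k := v)) i z)"
    proof
      fix z
      have "(\<Sum>i\<in>A. (c(k := d)) i * (u(k := v)) i z) = f z"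
        unfolding f using k by (intro sum.cong) auto
      then show "d * v z + f z = (\<Sum>i\<in>insert k A. (c(k := d)) i * (u(k := v)) i z)"
        using A(1) k by simp
    qed
    moreover have "\<forall>i\<in>insert k A. (u(k := v)) i \<in> U" using A(2) add.hyps by simp
    moreover have "finite (insert k A)" using A(1) by simp
    ultimately show ?case unfolding LS_def by blast
  qed
qed

lemma lspan_base: "u \<in> U \<Longrightarrow> u \<in> lspan U"
  using lspan.add[of u U "\<lambda>_. 0" 1] lspan.zero by simp

lemma lspan_lincomb: "f \<in> lspan U \<Longrightarrow> g \<in> lspan U \<Longrightarrow> (\<lambda>z. c * f z + g z) \<in> lspan U"
proof (induction rule: lspan.induct)
  case (add u f d)
  then have "(\<lambda>z. c * d * u z + (c * f z + g z)) \<in> lspan U" using lspan.add[OF add.hyps(1)] by simp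
  then show ?case by (simp add: algebra_simps)
qed simp

lemma lspan_add: "f \<in> lspan U \<Longrightarrow> g \<in> lspan U \<Longrightarrow> (\<lambda>z. f z + g z) \<in> lspan U"
  using lspan_lincomb[of f U g 1] by simp

lemma lspan_diff: "f \<in> lspan U \<Longrightarrow> g \<in> lspan U \<Longrightarrow> (\<lambda>z. f z - g z) \<in> lspan U"
  using lspan_lincomb[of g U f "-1"] by simp

lemma lspan_mono: "f \<in> lspan U \<Longrightarrow> U \<subseteq> V \<Longrightarrow> f \<in> lspan V"
  by (induction rule: lspan.induct) (auto intro: lspan.intros)

lemma lspan_Ccont: "f \<in> lspan U \<Longrightarrow> U \<subseteq> Ccont \<Longrightarrow> f \<in> Ccont"
proof (induction rule: lspan.induct)
  case (add u f c)
  then show ?case by (intro Ccont_add Ccont_scale) auto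
qed (rule Ccont_0)

text \<open>Gaussian elimination: coordinate \<open>k\<close> is cleared from the other vectors with
  a pivot \<open>j\<close>, which leaves one vector and one coordinate fewer.\<close>

lemma linear_dependence:
  fixes v :: "'i \<Rightarrow> 'k \<Rightarrow> 'f::field"
  assumes "finite K" "finite I" "card K < card I"
  shows "\<exists>c. (\<exists>i\<in>I. c i \<noteq> 0) \<and> (\<forall>k\<in>K. (\<Sum>i\<in>I. c i * v i k) = 0)"
  using assms
proof (induction K arbitrary: I v rule: finite_induct)
  case empty
  then have "I \<noteq> {}" by auto
  then show ?case by (intro exI[of _ "\<lambda>_. 1"]) auto
next
  case (insert k K)
  show ?case
  proof (cases "\<forall>i\<in>I. v i k = 0")
    case True
    have "card K < card I" using insert.prems insert.hyps by simp
    then obtain c where c: "\<exists>i\<in>I. c i \<noteq> 0" "\<forall>k\<in>K. (\<Sum>i\<in>I. c i * v i k) = 0"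
      using insert.IH[OF insert.prems(1), of v] by blast
    then show ?thesis using True by (intro exI[of _ c]) auto
  next
    case False
    then obtain j where j: "j \<in> I" "v j k \<noteq> 0" by blast
    let ?J = "I - {j}"
    define w where "w i l = v i l - v i k / v j k * v j l" for i l
    have "card K < card ?J" using insert.prems insert.hyps j(1) by simp
    then obtain c where c: "\<exists>i\<in>?J. c i \<noteq> 0" "\<forall>l\<in>K. (\<Sum>i\<in>?J. c i * w i l) = 0"
      using insert.IH[of ?J w] insert.prems(1) by blast
    \<comment> \<open>The coefficient of the pivot is chosen so that the combination of the
      \<open>v i\<close> equals that of the reduced vectors \<open>w i\<close> in every
      coordinate.\<close>
    define d where "d i = (if i = j then - (\<Sum>i\<in>?J. c i * (v i k / v j k)) else c i)" for i
    have sum: "(\<Sum>i\<in>I. d i * v i l) = (\<Sum>i\<in>?J. c i * w i l)" for l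
    proof -
      have "(\<Sum>i\<in>I. d i * v i l) = d j * v j l + (\<Sum>i\<in>?J. d i * v i l)"
        by (rule sum.remove[OF insert.prems(1) j(1)])
      also have "(\<Sum>i\<in>?J. d i * v i l) = (\<Sum>i\<in>?J. c i * v i l)" by (intro sum.cong) (auto simp: d_def)
      also have "d j * v j l = - (\<Sum>i\<in>?J. c i * (v i k / v j k) * v j l)" by (simp add: d_def sum_distrib_right)
      finally show ?thesis by (simp add: w_def sum_subtractf[symmetric] algebra_simps)
    qed
    have "(\<Sum>i\<in>I. d i * v i k) = 0" unfolding sum using j(2) by (simp add: w_def)
    moreover have "\<exists>i\<in>I. d i \<noteq> 0" using c(1) by (auto simp: d_def)
    ultimately show ?thesis using c(2) sum by (intro exI[of _ d]) auto
  qed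
qed

definition near :: "real \<Rightarrow> (rsphere \<Rightarrow> complex) \<Rightarrow> (rsphere \<Rightarrow> complex) \<Rightarrow> bool" where
  "near c f g = (\<forall>z. cmod (f z - g z) \<le> c)"

lemma near_sym: "near c f g \<Longrightarrow> near c g f"
  by (simp add: near_def norm_minus_commute)

lemma near_trans: "near c f g \<Longrightarrow> near d g h \<Longrightarrow> near (c + d) f h"
  unfolding near_def by (meson norm_diff_triangle_le)

section \<open>Decay, recurrence and rigidity\<close>

context random_rational
begin

lemma near_Mn: "f \<in> Ccont \<Longrightarrow> g \<in> Ccont \<Longrightarrow> near c f g \<Longrightarrow> near c ((M ^^ n) f) ((M ^^ n) g)"
  unfolding near_def
proof
  fix z assume fg: "f \<in> Ccont" "g \<in> Ccont" "\<forall>z. cmod (f z - g z) \<le> c"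
  have "cmod ((M ^^ n) (\<lambda>z. f z - g z) z) \<le> c" by (rule Mn_bound[OF Ccont_diff]) (use fg in auto)
  then show "cmod ((M ^^ n) f z - (M ^^ n) g z) \<le> c" by (simp add: Mn_diff fg)
qed

lemma Mn_Mn: "(M ^^ n) ((M ^^ k) f) = (M ^^ (n + k)) f"
  by (simp add: funpow_add)

definition decays :: "(rsphere \<Rightarrow> complex) \<Rightarrow> bool" where
  "decays \<phi> = (\<forall>c>0. \<exists>N. \<forall>n\<ge>N. \<forall>z. cmod ((M ^^ n) \<phi> z) \<le> c)"

lemma Zsp_iff: "\<phi> \<in> Zsp \<tau> \<longleftrightarrow> \<phi> \<in> Ccont \<and> decays \<phi>"
proof (cases "\<phi> \<in> Ccont")
  case True
  have n0: "0 \<le> sup_norm ((M ^^ n) \<phi>)" for n by (rule sup_norm_nonneg[OF Mn_Ccont[OF True]])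
  have "(\<lambda>n. sup_norm ((M ^^ n) \<phi>)) \<longlonglongrightarrow> 0 \<longleftrightarrow> decays \<phi>"
  proof
    assume lim: "(\<lambda>n. sup_norm ((M ^^ n) \<phi>)) \<longlonglongrightarrow> 0"
    show "decays \<phi>" unfolding decays_def
    proof (intro allI impI)
      fix c :: real assume "c > 0"
      then obtain N where N: "\<And>n. n \<ge> N \<Longrightarrow> norm (sup_norm ((M ^^ n) \<phi>) - 0) < c" using LIMSEQ_D[OF lim] by blast
      have "cmod ((M ^^ n) \<phi> z) \<le> c" if "n \<ge> N" for n z
        using sup_norm_upper[OF Mn_Ccont[OF True], of n z] N[OF that] n0[of n] by simp
      then show "\<exists>N. \<forall>n\<ge>N. \<forall>z. cmod ((M ^^ n) \<phi> z) \<le> c" by blast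
    qed
  next
    assume d: "decays \<phi>"
    show "(\<lambda>n. sup_norm ((M ^^ n) \<phi>)) \<longlonglongrightarrow> 0"
    proof (rule LIMSEQ_I)
      fix r :: real assume "r > 0"
      then have "r / 2 > 0" by simp
      then obtain N where N: "\<And>n z. n \<ge> N \<Longrightarrow> cmod ((M ^^ n) \<phi> z) \<le> r / 2" using d unfolding decays_def by blast
      have "sup_norm ((M ^^ n) \<phi>) \<le> r / 2" if "n \<ge> N" for n by (rule sup_norm_least[OF N[OF that]])
      then show "\<exists>no. \<forall>n\<ge>no. norm (sup_norm ((M ^^ n) \<phi>) - 0) < r" using n0 \<open>r > 0\<close>
        by (intro exI[of _ N]) force
    qed
  qed
  then show ?thesis using True by (simp add: Zsp_def)
qed (simp add: Zsp_def)

text \<open>One small iterate suffices, because \<open>M\<close> does not increase the sup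
  norm.\<close>

lemma decaysI:
  assumes "\<phi> \<in> Ccont" "\<And>c. c > 0 \<Longrightarrow> \<exists>N. \<forall>z. cmod ((M ^^ N) \<phi> z) \<le> c" shows "decays \<phi>"
  unfolding decays_def
proof (intro allI impI)
  fix c :: real assume "c > 0"
  then obtain N where N: "\<And>z. cmod ((M ^^ N) \<phi> z) \<le> c" using assms(2) by blast
  have "cmod ((M ^^ n) \<phi> z) \<le> c" if n: "N \<le> n" for n z
  proof -
    have "(M ^^ n) \<phi> = (M ^^ (n - N)) ((M ^^ N) \<phi>)" using n by (simp add: Mn_Mn)
    then show ?thesis using Mn_bound[OF Mn_Ccont[OF assms(1)] N] by simp
  qed
  then show "\<exists>N. \<forall>n\<ge>N. \<forall>z. cmod ((M ^^ n) \<phi> z) \<le> c" by blast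
qed

lemma decays_lincomb:
  assumes "\<phi> \<in> Ccont" "\<psi> \<in> Ccont" "decays \<phi>" "decays \<psi>" shows "decays (\<lambda>z. c * \<phi> z + d * \<psi> z)"
proof (rule decaysI[OF Ccont_lincomb[OF assms(1,2)]])
  fix e :: real assume e: "e > 0"
  define K where "K = cmod c + cmod d + 1"
  have K: "K > 0" by (simp add: K_def add_nonneg_pos)
  then have eK: "e / K > 0" using e by simp
  obtain N1 where N1: "\<And>n z. n \<ge> N1 \<Longrightarrow> cmod ((M ^^ n) \<phi> z) \<le> e / K" using assms(3) eK unfolding decays_def by blast
  obtain N2 where N2: "\<And>n z. n \<ge> N2 \<Longrightarrow> cmod ((M ^^ n) \<psi> z) \<le> e / K" using assms(4) eK unfolding decays_def by blast
  have "cmod ((M ^^ (max N1 N2)) (\<lambda>z. c * \<phi> z + d * \<psi> z) z) \<le> e" for z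
  proof -
    let ?n = "max N1 N2"
    have "cmod (c * (M ^^ ?n) \<phi> z + d * (M ^^ ?n) \<psi> z) \<le> cmod c * cmod ((M ^^ ?n) \<phi> z) + cmod d * cmod ((M ^^ ?n) \<psi> z)"
      by (metis norm_mult norm_triangle_ineq)
    also have "\<dots> \<le> cmod c * (e / K) + cmod d * (e / K)"
      using N1[of ?n z] N2[of ?n z] by (intro add_mono mult_left_mono) auto
    also have "\<dots> = (cmod c + cmod d) * (e / K)" by (rule distrib_right[symmetric])
    also have "\<dots> \<le> K * (e / K)" using eK by (intro mult_right_mono) (auto simp: K_def)
    also have "\<dots> = e" using K by simp
    finally show ?thesis by (simp add: Mn_lincomb assms(1,2))
  qed
  then show "\<exists>N. \<forall>z. cmod ((M ^^ N) (\<lambda>z. c * \<phi> z + d * \<psi> z) z) \<le> e" by blast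
qed

lemma decays_M: "decays \<phi> \<Longrightarrow> decays (M \<phi>)"
  unfolding decays_def
proof (intro allI impI)
  fix c :: real assume d: "\<forall>c>0. \<exists>N. \<forall>n\<ge>N. \<forall>z. cmod ((M ^^ n) \<phi> z) \<le> c" and c: "c > 0"
  obtain N where N: "\<And>n z. n \<ge> N \<Longrightarrow> cmod ((M ^^ n) \<phi> z) \<le> c" using d c by blast
  have "cmod ((M ^^ n) (M \<phi>) z) \<le> c" if "n \<ge> N" for n z
    using N[of "Suc n" z] that by (simp only: funpow_Suc_right o_apply)
  then show "\<exists>N. \<forall>n\<ge>N. \<forall>z. cmod ((M ^^ n) (M \<phi>) z) \<le> c" by blast
qed

lemma eigen_norm_le_1:
  assumes "\<theta> \<in> Ccont" "M \<theta> = (\<lambda>z. a * \<theta> z)" "\<theta> \<noteq> (\<lambda>_. 0)" shows "cmod a \<le> 1"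
proof (rule ccontr)
  assume "\<not> cmod a \<le> 1"
  then have a: "1 < cmod a" by simp
  obtain z where z: "\<theta> z \<noteq> 0" using assms(3) by auto
  obtain n where n: "sup_norm \<theta> / cmod (\<theta> z) < cmod a ^ n" using real_arch_pow[OF a] by blast
  have "cmod a ^ n * cmod (\<theta> z) = cmod ((M ^^ n) \<theta> z)"
    by (simp add: Mn_eigen[OF assms(1,2)] norm_mult norm_power)
  also have "\<dots> \<le> sup_norm \<theta>" by (rule Mn_bound[OF assms(1) sup_norm_upper[OF assms(1)]])
  finally show False using n z by (simp add: field_simps)
qed

lemma eigen_decays:
  assumes "\<theta> \<in> Ccont" "M \<theta> = (\<lambda>z. a * \<theta> z)" "cmod a < 1" shows "decays \<theta>"
proof (rule decaysI[OF assms(1)])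
  fix c :: real assume c: "c > 0"
  have "(\<lambda>n. cmod a ^ n * sup_norm \<theta>) \<longlonglongrightarrow> 0 * sup_norm \<theta>"
    using assms(3) by (intro tendsto_mult LIMSEQ_power_zero tendsto_const) simp
  then have "(\<lambda>n. cmod a ^ n * sup_norm \<theta>) \<longlonglongrightarrow> 0" by simp
  then obtain N where "\<And>n. n \<ge> N \<Longrightarrow> norm (cmod a ^ n * sup_norm \<theta> - 0) < c" using LIMSEQ_D c by blast
  then have N: "cmod a ^ N * sup_norm \<theta> < c" by (metis abs_less_iff diff_zero order_refl real_norm_def)
  have "cmod ((M ^^ N) \<theta> z) \<le> c" for z
  proof -
    have "cmod ((M ^^ N) \<theta> z) = cmod a ^ N * cmod (\<theta> z)" by (simp add: Mn_eigen[OF assms(1,2)] norm_mult norm_power)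
    also have "\<dots> \<le> cmod a ^ N * sup_norm \<theta>" by (intro mult_left_mono sup_norm_upper assms(1)) auto
    finally show ?thesis using N by simp
  qed
  then show "\<exists>N. \<forall>z. cmod ((M ^^ N) \<theta> z) \<le> c" by blast
qed

lemma eigen_decays_0:
  assumes "\<theta> \<in> Ccont" "M \<theta> = (\<lambda>z. a * \<theta> z)" "cmod a = 1" "decays \<theta>" shows "\<theta> z = 0"
proof (rule ccontr)
  assume "\<theta> z \<noteq> 0"
  then have "cmod (\<theta> z) / 2 > 0" by simp
  then obtain N where "\<And>n w. n \<ge> N \<Longrightarrow> cmod ((M ^^ n) \<theta> w) \<le> cmod (\<theta> z) / 2" using assms(4) unfolding decays_def by blast
  from this[of N z] show False using \<open>\<theta> z \<noteq> 0\<close>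
    by (simp add: Mn_eigen[OF assms(1,2)] norm_mult norm_power assms(3))
qed

lemma Uf_Ccont: "Uf \<tau> \<subseteq> Ccont"
  by (auto simp: Uf_def)

lemma eigen_rigid:
  assumes "\<theta> \<in> Ccont" "M \<theta> = (\<lambda>z. a * \<theta> z)" "cmod a = 1" shows "rigid \<theta>"
  unfolding rigid_def
proof (intro allI impI, rule ccontr)
  fix x y assume ap: "asymptotic_pair \<theta> x y" and ne: "\<theta> x \<noteq> \<theta> y"
  then have "cmod (\<theta> x - \<theta> y) / 2 > 0" by simp
  then obtain k where "cmod ((M ^^ k) \<theta> x - (M ^^ k) \<theta> y) \<le> cmod (\<theta> x - \<theta> y) / 2"
    using ap unfolding asymptotic_pair_def by blast
  moreover have "(M ^^ k) \<theta> x - (M ^^ k) \<theta> y = a ^ k * (\<theta> x - \<theta> y)"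
    by (simp add: Mn_eigen[OF assms(1,2)] right_diff_distrib)
  ultimately show False using ne assms(3) by (simp add: norm_mult norm_power)
qed

text \<open>Recurrence along one fixed sequence of times. Fixing \<nu> in advance makes this a
  linear space invariant under \<open>M\<close>.\<close>

definition Rec :: "(nat \<Rightarrow> nat) \<Rightarrow> (rsphere \<Rightarrow> complex) set" where
  "Rec \<nu> = {h \<in> Ccont. \<forall>c>0. \<exists>N. \<forall>i\<ge>N. near c ((M ^^ \<nu> i) h) h}"

lemma Rec_Ccont: "h \<in> Rec \<nu> \<Longrightarrow> h \<in> Ccont"
  by (simp add: Rec_def)

lemma Rec_0: "(\<lambda>_. 0) \<in> Rec \<nu>"
  by (auto simp: Rec_def Ccont_0 Mn_0 near_def)

lemma Rec_lincomb:
  assumes "f \<in> Rec \<nu>" "g \<in> Rec \<nu>" shows "(\<lambda>z. a * f z + b * g z) \<in> Rec \<nu>"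
proof -
  have C: "f \<in> Ccont" "g \<in> Ccont" using assms Rec_Ccont by auto
  have "\<exists>N. \<forall>i\<ge>N. near c ((M ^^ \<nu> i) (\<lambda>z. a * f z + b * g z)) (\<lambda>z. a * f z + b * g z)" if c: "c > 0" for c
  proof -
    define K where "K = cmod a + cmod b + 1"
    have K: "K > 0" by (simp add: K_def add_nonneg_pos)
    then have eK: "c / K > 0" using c by simp
    obtain N1 where N1: "\<And>i. i \<ge> N1 \<Longrightarrow> near (c / K) ((M ^^ \<nu> i) f) f" using assms(1) eK unfolding Rec_def by blast
    obtain N2 where N2: "\<And>i. i \<ge> N2 \<Longrightarrow> near (c / K) ((M ^^ \<nu> i) g) g" using assms(2) eK unfolding Rec_def by blast
    have "near c ((M ^^ \<nu> i) (\<lambda>z. a * f z + b * g z)) (\<lambda>z. a * f z + b * g z)" if i: "i \<ge> max N1 N2" for i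
      unfolding near_def
    proof
      fix z
      have 1: "cmod ((M ^^ \<nu> i) f z - f z) \<le> c / K" and 2: "cmod ((M ^^ \<nu> i) g z - g z) \<le> c / K"
        using N1[of i] N2[of i] i by (auto simp: near_def)
      have "cmod (a * ((M ^^ \<nu> i) f z - f z) + b * ((M ^^ \<nu> i) g z - g z)) \<le> cmod a * cmod ((M ^^ \<nu> i) f z - f z) + cmod b * cmod ((M ^^ \<nu> i) g z - g z)"
        by (metis norm_mult norm_triangle_ineq)
      also have "\<dots> \<le> cmod a * (c / K) + cmod b * (c / K)"
        using 1 2 by (intro add_mono mult_left_mono) auto
      also have "\<dots> = (cmod a + cmod b) * (c / K)" by (rule distrib_right[symmetric])
      also have "\<dots> \<le> K * (c / K)" using eK by (intro mult_right_mono) (auto simp: K_def)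
      also have "\<dots> = c" using K by simp
      finally show "cmod ((M ^^ \<nu> i) (\<lambda>z. a * f z + b * g z) z - (a * f z + b * g z)) \<le> c"
        by (simp add: Mn_lincomb C algebra_simps)
    qed
    then show ?thesis by blast
  qed
  then show ?thesis unfolding Rec_def using Ccont_lincomb[OF C] by blast
qed

lemma Rec_diff: "f \<in> Rec \<nu> \<Longrightarrow> g \<in> Rec \<nu> \<Longrightarrow> (\<lambda>z. f z - g z) \<in> Rec \<nu>"
  using Rec_lincomb[of f \<nu> g 1 "-1"] by simp

lemma Rec_M: assumes "f \<in> Rec \<nu>" shows "M f \<in> Rec \<nu>"
proof -
  have C: "f \<in> Ccont" using assms Rec_Ccont by auto
  have "\<exists>N. \<forall>i\<ge>N. near c ((M ^^ \<nu> i) (M f)) (M f)" if c: "c > 0" for c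
  proof -
    obtain N where N: "\<And>i. i \<ge> N \<Longrightarrow> near c ((M ^^ \<nu> i) f) f" using assms c unfolding Rec_def by blast
    have "near c ((M ^^ \<nu> i) (M f)) (M f)" if "i \<ge> N" for i
      using near_Mn[OF Mn_Ccont[OF C] C N[OF that], of 1] by (simp add: funpow_swap1)
    then show ?thesis by blast
  qed
  then show ?thesis unfolding Rec_def using M_Ccont[OF C] by blast
qed

lemma Rec_Mn: "f \<in> Rec \<nu> \<Longrightarrow> (M ^^ n) f \<in> Rec \<nu>"
  by (induction n) (auto intro: Rec_M)

lemma Rec_decays_0:
  assumes \<nu>: "\<And>i. i \<le> \<nu> i" and f: "f \<in> Rec \<nu>" "decays f" shows "f z = 0"
proof (rule ccontr)
  assume "f z \<noteq> 0"
  then have c: "cmod (f z) / 3 > 0" by simp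
  obtain N1 where N1: "\<And>i. i \<ge> N1 \<Longrightarrow> near (cmod (f z) / 3) ((M ^^ \<nu> i) f) f" using f(1) c unfolding Rec_def by blast
  obtain N2 where N2: "\<And>n w. n \<ge> N2 \<Longrightarrow> cmod ((M ^^ n) f w) \<le> cmod (f z) / 3" using f(2) c unfolding decays_def by blast
  let ?n = "\<nu> (max N1 N2)"
  have "cmod ((M ^^ ?n) f z - f z) \<le> cmod (f z) / 3" using N1[of "max N1 N2"] by (simp add: near_def)
  moreover have "cmod ((M ^^ ?n) f z) \<le> cmod (f z) / 3" using N2[of ?n z] \<nu>[of "max N1 N2"] by simp
  moreover have "cmod (f z) \<le> cmod ((M ^^ ?n) f z) + cmod ((M ^^ ?n) f z - f z)"
    by (metis norm_minus_commute norm_triangle_sub)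
  ultimately show False using c by linarith
qed

text \<open>At large return times f x and f y are close to the values of one iterate of f at x and
  y, and these approach each other.\<close>

lemma Rec_rigid:
  assumes \<nu>: "\<And>i. i \<le> \<nu> i" and f: "f \<in> Rec \<nu>" shows "rigid f"
  unfolding rigid_def
proof (intro allI impI, rule ccontr)
  fix x y assume ap: "asymptotic_pair f x y" and ne: "f x \<noteq> f y"
  define c where "c = cmod (f x - f y) / 4"
  have c: "c > 0" using ne by (simp add: c_def)
  obtain N1 where N1: "\<And>i. i \<ge> N1 \<Longrightarrow> near c ((M ^^ \<nu> i) f) f" using f(1) c unfolding Rec_def by blast
  obtain N2 where N2: "\<And>k. k \<ge> N2 \<Longrightarrow> cmod ((M ^^ k) f x - (M ^^ k) f y) \<le> c" using ap c unfolding asymptotic_pair_def by blast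
  let ?n = "\<nu> (max N1 N2)"
  have "cmod ((M ^^ ?n) f x - f x) \<le> c" "cmod ((M ^^ ?n) f y - f y) \<le> c" using N1[of "max N1 N2"] by (auto simp: near_def)
  moreover have "cmod ((M ^^ ?n) f x - (M ^^ ?n) f y) \<le> c" using N2[of ?n] \<nu>[of "max N1 N2"] by simp
  moreover have "cmod (f x - f y) \<le> cmod ((M ^^ ?n) f x - f x) + cmod ((M ^^ ?n) f x - (M ^^ ?n) f y) + cmod ((M ^^ ?n) f y - f y)"
    by (smt (verit, best) norm_diff_triangle_ineq norm_minus_commute norm_triangle_ineq4 norm_diff_triangle_le)
  moreover have "cmod (f x - f y) = 4 * c" by (simp add: c_def)
  ultimately show False using c by linarith
qed

end

section \<open>The decomposition\<close>

context random_rational_ker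
begin

lemma orbit_subsequence:
  assumes \<phi>: "\<phi> \<in> Ccont"
  obtains r :: "nat \<Rightarrow> nat" and \<psi> where "strict_mono r" "\<psi> \<in> Ccont"
    "\<And>c. c > 0 \<Longrightarrow> \<exists>N. \<forall>i\<ge>N. near c ((M ^^ m (r i)) \<phi>) \<psi>"
proof -
  let ?S = "sphere 0 1 :: (real \<times> real \<times> real) set"
  \<comment> \<open>\<open>Rep_rsphere\<close> is an isometry onto the Euclidean unit sphere, so
    equicontinuity carries over and Arzela-Ascoli can be applied there.\<close>
  let ?f = "\<lambda>n x. (M ^^ m n) \<phi> (Abs_rsphere x)"
  have Rep_Abs: "Rep_rsphere (Abs_rsphere x) = x" if "x \<in> ?S" for x
    using that by (intro Abs_rsphere_inverse) simp
  obtain g k where g: "continuous_on ?S g" "strict_mono (k :: nat \<Rightarrow> nat)"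
    "\<And>e. 0 < e \<Longrightarrow> \<exists>N. \<forall>n x. n \<ge> N \<and> x \<in> ?S \<longrightarrow> norm (?f (k n) x - g x) < e"
  proof (rule Arzela_Ascoli[of ?S ?f "sup_norm \<phi>"])
    show "cmod (?f n x) \<le> sup_norm \<phi>" for n x by (rule Mn_bound[OF \<phi> sup_norm_upper[OF \<phi>]])
    fix x :: "real \<times> real \<times> real" and e :: real assume x: "x \<in> ?S" and e: "0 < e"
    obtain d where d: "d > 0" "\<And>k y. dist y (Abs_rsphere x) < d \<Longrightarrow> cmod ((M ^^ k) \<phi> y - (M ^^ k) \<phi> (Abs_rsphere x)) < e"
      using Mn_equicontinuous_at[OF \<phi> e, of "Abs_rsphere x"] by blast
    have "cmod (?f n x - ?f n y) < e" if y: "y \<in> ?S" "norm (x - y) < d" for n y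
    proof -
      have "dist (Abs_rsphere y) (Abs_rsphere x) < d"
        using y by (simp add: dist_rsphere_def Rep_Abs[OF y(1)] Rep_Abs[OF x] dist_norm norm_minus_commute)
      from d(2)[OF this] show ?thesis by (simp add: norm_minus_commute)
    qed
    then show "\<exists>d>0. \<forall>n y. y \<in> ?S \<and> norm (x - y) < d \<longrightarrow> cmod (?f n x - ?f n y) < e" using d(1) by blast
  qed (auto intro: compact_sphere)
  have RepS: "Rep_rsphere z \<in> ?S" for z using Rep_rsphere[of z] by simp
  define \<psi> where "\<psi> z = g (Rep_rsphere z)" for z
  have "\<psi> \<in> Ccont"
    unfolding Ccont_def \<psi>_def using continuous_on_compose2[OF g(1) continuous_on_Rep] RepS by blast
  moreover have "\<exists>N. \<forall>i\<ge>N. near c ((M ^^ m (k i)) \<phi>) \<psi>" if c: "c > 0" for c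
  proof -
    obtain N where N: "\<And>n x. n \<ge> N \<Longrightarrow> x \<in> ?S \<Longrightarrow> norm (?f (k n) x - g x) < c" using g(3)[OF c] by blast
    have "near c ((M ^^ m (k i)) \<phi>) \<psi>" if "i \<ge> N" for i
      unfolding near_def using N[OF that RepS] by (simp add: \<psi>_def Rep_rsphere_inverse less_imp_le)
    then show ?thesis by blast
  qed
  ultimately show ?thesis using that g(2) by blast
qed

lemma near_limit_diff:
  assumes "\<phi> \<in> Ccont" "\<psi> \<in> Ccont" "\<And>c. c > 0 \<Longrightarrow> \<exists>N. near c ((M ^^ N) \<phi>) ((M ^^ N) \<psi>)"
  shows "decays (\<lambda>z. \<phi> z - \<psi> z)"
proof (rule decaysI[OF Ccont_diff[OF assms(1,2)]])
  fix c :: real assume "c > 0"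
  then obtain N where "near c ((M ^^ N) \<phi>) ((M ^^ N) \<psi>)" using assms(3) by blast
  then show "\<exists>N. \<forall>z. cmod ((M ^^ N) (\<lambda>z. \<phi> z - \<psi> z) z) \<le> c"
    by (intro exI[of _ N]) (simp add: Mn_diff[OF assms(1,2)] near_def)
qed

text \<open>If \<open>M ^ k i \<phi>\<close> converges to \<open>\<psi>0\<close>, then \<open>M ^ (k (2 i) - k i)\<close> tends to the identity on \<open>\<psi>0\<close>,
  and a limit \<open>\<psi>\<close> of \<open>M ^ (k (2 i) - k i) \<phi>\<close> is the recurrent part of \<open>\<phi>\<close>.\<close>

lemma recurrent_part:
  assumes \<phi>: "\<phi> \<in> Ccont"
  obtains \<nu> \<psi> where "\<And>i. i \<le> \<nu> i" "\<psi> \<in> Rec \<nu>" "decays (\<lambda>z. \<phi> z - \<psi> z)"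
proof -
  obtain k :: "nat \<Rightarrow> nat" and \<psi>0 where k: "strict_mono k" and \<psi>0: "\<psi>0 \<in> Ccont"
    and lim0: "\<And>c. c > 0 \<Longrightarrow> \<exists>N. \<forall>i\<ge>N. near c ((M ^^ k i) \<phi>) \<psi>0"
    using orbit_subsequence[OF \<phi>, of "\<lambda>i. i"] by blast
  define n where "n i = k (2 * i) - k i" for i
  have kadd: "k i + j \<le> k (i + j)" for i j
  proof (induction j)
    case (Suc j)
    have "k (i + j) < k (i + Suc j)" using k by (simp add: strict_mono_less)
    then show ?case using Suc by simp
  qed simp
  have k2: "k i + i \<le> k (2 * i)" for i using kadd[of i i] by (simp add: mult_2)
  have ni: "i \<le> n i" "n i + k i = k (2 * i)" for i using k2[of i] by (simp_all add: n_def)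
  obtain r :: "nat \<Rightarrow> nat" and \<psi> where r: "strict_mono r" and \<psi>: "\<psi> \<in> Ccont"
    and lim: "\<And>c. c > 0 \<Longrightarrow> \<exists>N. \<forall>i\<ge>N. near c ((M ^^ n (r i)) \<phi>) \<psi>"
    using orbit_subsequence[OF \<phi>, of n] by blast
  define \<nu> where "\<nu> i = n (r i)" for i
  have \<nu>i: "i \<le> \<nu> i" for i using ni(1)[of "r i"] seq_suble[OF r, of i] by (simp add: \<nu>_def)
  have rec0: "\<exists>N. \<forall>i\<ge>N. near c ((M ^^ n i) \<psi>0) \<psi>0" if c: "c > 0" for c
  proof -
    obtain N where N: "\<And>i. i \<ge> N \<Longrightarrow> near (c / 2) ((M ^^ k i) \<phi>) \<psi>0" using lim0[of "c / 2"] c by auto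
    have "near c ((M ^^ n i) \<psi>0) \<psi>0" if i: "i \<ge> N" for i
    proof -
      have "near (c / 2) ((M ^^ n i) \<psi>0) ((M ^^ n i) ((M ^^ k i) \<phi>))"
        by (rule near_Mn[OF \<psi>0 Mn_Ccont[OF \<phi>] near_sym[OF N[OF i]]])
      then have "near (c / 2) ((M ^^ n i) \<psi>0) ((M ^^ k (2 * i)) \<phi>)" by (simp only: Mn_Mn ni(2))
      moreover have "near (c / 2) ((M ^^ k (2 * i)) \<phi>) \<psi>0" by (rule N) (use i in simp)
      ultimately have "near (c / 2 + c / 2) ((M ^^ n i) \<psi>0) \<psi>0" by (rule near_trans)
      then show ?thesis by simp
    qed
    then show ?thesis by blast
  qed
  \<comment> \<open>The chain of approximations is M^(k i) \<phi>, \<psi>0, M^(k (2 i)) \<phi> =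
    M^(k i) (M^(n i) \<phi>), M^(k i) \<psi>, each with error c / 3.\<close>
  have "decays (\<lambda>z. \<phi> z - \<psi> z)"
  proof (rule near_limit_diff[OF \<phi> \<psi>])
    fix c :: real assume c: "c > 0"
    obtain N1 where N1: "\<And>i. i \<ge> N1 \<Longrightarrow> near (c / 3) ((M ^^ k i) \<phi>) \<psi>0" using lim0[of "c / 3"] c by auto
    obtain N2 where N2: "\<And>i. i \<ge> N2 \<Longrightarrow> near (c / 3) ((M ^^ n (r i)) \<phi>) \<psi>" using lim[of "c / 3"] c by auto
    define i where "i = r (max N1 N2)"
    have i: "i \<ge> N1" using seq_suble[OF r, of "max N1 N2"] by (simp add: i_def)
    have 1: "near (c / 3) ((M ^^ k i) \<phi>) \<psi>0" by (rule N1[OF i])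
    have 2: "near (c / 3) \<psi>0 ((M ^^ k (2 * i)) \<phi>)" by (rule near_sym[OF N1]) (use i in simp)
    have "near (c / 3) ((M ^^ n i) \<phi>) \<psi>" unfolding i_def by (rule N2) simp
    then have "near (c / 3) ((M ^^ k i) ((M ^^ n i) \<phi>)) ((M ^^ k i) \<psi>)" by (rule near_Mn[OF Mn_Ccont[OF \<phi>] \<psi>])
    moreover have "k i + n i = k (2 * i)" using ni(2)[of i] by simp
    ultimately have 3: "near (c / 3) ((M ^^ k (2 * i)) \<phi>) ((M ^^ k i) \<psi>)" by (simp only: Mn_Mn)
    have "near (c / 3 + c / 3 + c / 3) ((M ^^ k i) \<phi>) ((M ^^ k i) \<psi>)"
      by (rule near_trans[OF near_trans[OF 1 2] 3])
    then show "\<exists>N. near c ((M ^^ N) \<phi>) ((M ^^ N) \<psi>)" by (intro exI[of _ "k i"]) simp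
  qed
  moreover have "\<psi> \<in> Rec \<nu>"
    unfolding Rec_def
  proof (intro CollectI conjI \<psi> allI impI)
    fix c :: real assume c: "c > 0"
    \<comment> \<open>Five errors: one at each end for replacing \<psi> by an iterate of \<phi>, and
      three for the near return of M^(k N1) \<phi>, which is close to \<psi>0.\<close>
    define d where "d = c / 5"
    have d: "d > 0" using c by (simp add: d_def)
    obtain J where J: "\<And>i. i \<ge> J \<Longrightarrow> near d ((M ^^ n i) \<psi>0) \<psi>0" using rec0[OF d] by blast
    obtain N1 where N1: "\<And>i. i \<ge> N1 \<Longrightarrow> near d ((M ^^ k i) \<phi>) \<psi>0" using lim0[OF d] by blast
    obtain N2 where N2: "\<And>i. i \<ge> N2 \<Longrightarrow> near d ((M ^^ \<nu> i) \<phi>) \<psi>" using lim[OF d] \<nu>_def by auto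
    have "near c ((M ^^ \<nu> j) \<psi>) \<psi>" if j: "j \<ge> J" for j
    proof -
      let ?K = "k N1"
      \<comment> \<open>Large enough that M^(\<nu> l) \<phi> is close to \<psi> and that it is a
        further iterate of M^(k N1) \<phi>, from which it inherits the near return.\<close>
      define l where "l = max N2 ?K"
      have lK: "?K \<le> \<nu> l" using \<nu>i[of l] by (simp add: l_def)
      have l: "near d ((M ^^ \<nu> l) \<phi>) \<psi>" by (rule N2) (simp add: l_def)
      have a: "near d ((M ^^ \<nu> j) \<psi>) ((M ^^ \<nu> j) ((M ^^ \<nu> l) \<phi>))"
        by (rule near_Mn[OF \<psi> Mn_Ccont[OF \<phi>] near_sym[OF l]])
      have p1: "near d ((M ^^ \<nu> j) ((M ^^ ?K) \<phi>)) ((M ^^ \<nu> j) \<psi>0)"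
        by (rule near_Mn[OF Mn_Ccont[OF \<phi>] \<psi>0 N1]) simp
      have p2: "near d ((M ^^ \<nu> j) \<psi>0) \<psi>0"
        unfolding \<nu>_def by (rule J) (use j seq_suble[OF r, of j] in simp)
      have p3: "near d \<psi>0 ((M ^^ ?K) \<phi>)" by (rule near_sym[OF N1]) simp
      have "near (d + d + d) ((M ^^ \<nu> j) ((M ^^ ?K) \<phi>)) ((M ^^ ?K) \<phi>)"
        by (rule near_trans[OF near_trans[OF p1 p2] p3])
      then have "near (d + d + d) ((M ^^ (\<nu> l - ?K)) ((M ^^ \<nu> j) ((M ^^ ?K) \<phi>))) ((M ^^ (\<nu> l - ?K)) ((M ^^ ?K) \<phi>))"
        by (intro near_Mn Mn_Ccont \<phi>)
      moreover have "\<nu> l - ?K + (\<nu> j + ?K) = \<nu> j + \<nu> l" "\<nu> l - ?K + ?K = \<nu> l" using lK by simp_all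
      ultimately have b: "near (d + d + d) ((M ^^ \<nu> j) ((M ^^ \<nu> l) \<phi>)) ((M ^^ \<nu> l) \<phi>)" by (simp only: Mn_Mn)
      have "near (d + (d + d + d) + d) ((M ^^ \<nu> j) \<psi>) \<psi>" by (rule near_trans[OF near_trans[OF a b] l])
      then show ?thesis by (simp add: d_def)
    qed
    then show "\<exists>N. \<forall>i\<ge>N. near c ((M ^^ \<nu> i) \<psi>) \<psi>" by blast
  qed
  ultimately show ?thesis using that[OF \<nu>i] by blast
qed

end

section \<open>Polynomials in the operator and families of eigenfunctions\<close>

context random_rational
begin

definition poly_op :: "complex poly \<Rightarrow> (rsphere \<Rightarrow> complex) \<Rightarrow> rsphere \<Rightarrow> complex" where
  "poly_op p \<psi> = (\<lambda>z. \<Sum>i\<le>degree p. coeff p i * (M ^^ i) \<psi> z)"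

lemma poly_op_eq:
  assumes "degree p \<le> n" shows "poly_op p \<psi> z = (\<Sum>i\<le>n. coeff p i * (M ^^ i) \<psi> z)"
  unfolding poly_op_def by (rule sum.mono_neutral_left) (use assms in \<open>auto simp: coeff_eq_0\<close>)

lemma poly_op_linear_factor:
  assumes \<psi>: "\<psi> \<in> Ccont"
  shows "poly_op ([:- a, 1:] * q) \<psi> = poly_op q (\<lambda>z. M \<psi> z - a * \<psi> z)"
proof
  fix z
  let ?n = "degree q"
  have split: "[:- a, 1:] * q = pCons 0 q - smult a q" by simp
  have "degree ([:- a, 1:] * q) \<le> Suc ?n"
    unfolding split by (intro degree_diff_le degree_pCons_le le_SucI degree_smult_le)
  then have "poly_op ([:- a, 1:] * q) \<psi> z = (\<Sum>i\<le>Suc ?n. coeff ([:- a, 1:] * q) i * (M ^^ i) \<psi> z)"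
    by (rule poly_op_eq)
  also have "\<dots> = (\<Sum>i\<le>Suc ?n. coeff (pCons 0 q) i * (M ^^ i) \<psi> z) - (\<Sum>i\<le>Suc ?n. a * coeff q i * (M ^^ i) \<psi> z)"
    unfolding split coeff_diff coeff_smult left_diff_distrib by (rule sum_subtractf)
  also have "(\<Sum>i\<le>Suc ?n. coeff (pCons 0 q) i * (M ^^ i) \<psi> z) = (\<Sum>i\<le>?n. coeff q i * (M ^^ Suc i) \<psi> z)"
    by (subst sum.atMost_Suc_shift) simp
  also have "(\<Sum>i\<le>Suc ?n. a * coeff q i * (M ^^ i) \<psi> z) = (\<Sum>i\<le>?n. a * coeff q i * (M ^^ i) \<psi> z)"
    by (simp add: coeff_eq_0)
  also have "(\<Sum>i\<le>?n. coeff q i * (M ^^ Suc i) \<psi> z) - (\<Sum>i\<le>?n. a * coeff q i * (M ^^ i) \<psi> z)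
      = (\<Sum>i\<le>?n. coeff q i * (M ^^ i) (\<lambda>z. M \<psi> z - a * \<psi> z) z)"
  proof -
    have e: "(M ^^ i) (\<lambda>z. M \<psi> z - a * \<psi> z) z = (M ^^ Suc i) \<psi> z - a * (M ^^ i) \<psi> z" for i
      using Mn_lincomb[OF M_Ccont[OF \<psi>] \<psi>, of i 1 "- a"] by (simp add: funpow_swap1)
    show ?thesis
      unfolding sum_subtractf[symmetric] e by (intro sum.cong refl) (simp only: right_diff_distrib mult_ac)
  qed
  finally show "poly_op ([:- a, 1:] * q) \<psi> z = poly_op q (\<lambda>z. M \<psi> z - a * \<psi> z) z" by (simp add: poly_op_def)
qed

text \<open>A term with eigenvalue b different from a is solved by dividing by b - a. Resonant terms
  with b = a cannot be solved and are collected in \<xi>, an eigenfunction for a that vanishes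
  unless a is unimodular.\<close>

lemma solve_in_span:
  assumes "h \<in> lspan (Uf \<tau> \<inter> Rec \<nu>)"
  shows "\<exists>v\<in>lspan (Uf \<tau> \<inter> Rec \<nu>). \<exists>\<xi>\<in>Ccont. M \<xi> = (\<lambda>z. a * \<xi> z) \<and> (cmod a = 1 \<or> (\<forall>z. \<xi> z = 0))
     \<and> (\<forall>z. M v z - a * v z = h z - \<xi> z)"
  using assms
proof induction
  case zero
  show ?case
    by (rule bexI[OF _ lspan.zero], rule bexI[OF _ Ccont_0]) (simp add: M_0)
next
  case (add u f c)
  then obtain v \<xi> where v: "v \<in> lspan (Uf \<tau> \<inter> Rec \<nu>)" and \<xi>: "\<xi> \<in> Ccont" "M \<xi> = (\<lambda>z. a * \<xi> z)" "cmod a = 1 \<or> (\<forall>z. \<xi> z = 0)"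
    and eq: "\<And>z. M v z - a * v z = f z - \<xi> z" by blast
  have uC: "u \<in> Ccont" using add.hyps by (auto simp: Uf_def)
  have vC: "v \<in> Ccont" using lspan_Ccont[OF v] Uf_Ccont by blast
  obtain b where b: "cmod b = 1" "M u = (\<lambda>z. b * u z)" using add.hyps by (auto simp: Uf_def)
  show ?case
  proof (cases "b = a")
    case True
    have 1: "(\<lambda>z. c * u z + 1 * \<xi> z) \<in> Ccont" by (rule Ccont_lincomb[OF uC \<xi>(1)])
    have 2: "M (\<lambda>z. c * u z + 1 * \<xi> z) = (\<lambda>z. a * (c * u z + 1 * \<xi> z))"
      unfolding M_lincomb[OF uC \<xi>(1)] \<xi>(2) b(2) True by (simp add: fun_eq_iff algebra_simps)
    have 3: "M v z - a * v z = c * u z + f z - (c * u z + 1 * \<xi> z)" for z using eq[of z] by simp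
    show ?thesis
      by (rule bexI[OF _ v], rule bexI[OF _ 1], intro conjI 2 allI 3) (use b True in auto)
  next
    case False
    have 1: "(\<lambda>z. c / (b - a) * u z + v z) \<in> lspan (Uf \<tau> \<inter> Rec \<nu>)" using lspan.add[OF add.hyps(1) v] .
    have Mv: "M (\<lambda>z. c / (b - a) * u z + v z) z = c / (b - a) * (b * u z) + M v z" for z
      using M_lincomb[OF uC vC, of "c / (b - a)" 1] b(2) by simp
    have 3: "M (\<lambda>z. c / (b - a) * u z + v z) z - a * (c / (b - a) * u z + v z) = c * u z + f z - \<xi> z" for z
    proof -
      have "t * (b * u z) + M v z - a * (t * u z + v z) = t * (b - a) * u z + (M v z - a * v z)" for t
        by (simp add: algebra_simps)
      then have "M (\<lambda>z. c / (b - a) * u z + v z) z - a * (c / (b - a) * u z + v z)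
          = c / (b - a) * (b - a) * u z + (M v z - a * v z)" unfolding Mv .
      also have "c / (b - a) * (b - a) = c" using False by simp
      finally show ?thesis using eq[of z] by simp
    qed
    show ?thesis
      by (rule bexI[OF _ 1], rule bexI[OF _ \<xi>(1)], intro conjI \<xi>(2,3) allI 3)
  qed
qed

text \<open>A Jordan block of size two at a unimodular eigenvalue would make the iterates grow
  linearly, against the sup norm bound.\<close>

lemma jordan_growth:
  assumes \<theta>: "\<theta> \<in> Ccont" and \<xi>: "\<xi> \<in> Ccont" "M \<xi> = (\<lambda>z. a * \<xi> z)" and a: "cmod a = 1"
    and M: "\<And>z. M \<theta> z = a * \<theta> z + \<xi> z"
  shows "\<xi> z = 0"
proof (rule ccontr)
  assume "\<xi> z \<noteq> 0"
  have M': "M \<theta> = (\<lambda>z. a * \<theta> z + 1 * \<xi> z)" using M by (simp add: fun_eq_iff)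
  \<comment> \<open>Multiplied by a to avoid the exponent n - 1.\<close>
  have Mn: "a * (M ^^ n) \<theta> z = a ^ Suc n * \<theta> z + of_nat n * a ^ n * \<xi> z" for n z
  proof (induction n)
    case (Suc n)
    have "(M ^^ Suc n) \<theta> z = (M ^^ n) (M \<theta>) z" by (simp add: funpow_swap1)
    also have "\<dots> = a * (M ^^ n) \<theta> z + a ^ n * \<xi> z"
      unfolding M' by (simp add: Mn_lincomb[OF \<theta> \<xi>(1), of n a 1, simplified] Mn_eigen[OF \<xi>])
    finally show ?case using Suc by (simp add: algebra_simps)
  qed simp
  have "real n * cmod (\<xi> z) \<le> 2 * sup_norm \<theta>" for n
  proof -
    have "real n * cmod (\<xi> z) = cmod (of_nat n * a ^ n * \<xi> z)" by (simp add: norm_mult norm_power a)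
    also have "\<dots> = cmod (a * (M ^^ n) \<theta> z - a ^ Suc n * \<theta> z)" by (simp add: Mn)
    also have "\<dots> \<le> cmod (a * (M ^^ n) \<theta> z) + cmod (a ^ Suc n * \<theta> z)" by (rule norm_triangle_ineq4)
    also have "\<dots> = cmod ((M ^^ n) \<theta> z) + cmod (\<theta> z)" by (simp add: norm_mult norm_power a)
    also have "\<dots> \<le> 2 * sup_norm \<theta>"
      using Mn_bound[OF \<theta> sup_norm_upper[OF \<theta>], of n z] sup_norm_upper[OF \<theta>, of z] by simp
    finally show ?thesis .
  qed
  moreover obtain n where "2 * sup_norm \<theta> / cmod (\<xi> z) < real n" using reals_Archimedean2 by blast
  ultimately show False using \<open>\<xi> z \<noteq> 0\<close> by (simp add: field_simps) (metis not_less)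
qed

text \<open>Split off a root a of p. By induction (M - a) h is in the span; subtracting a solution v
  leaves \<theta> with M \<theta> = a \<theta> + \<xi>, and \<open>jordan_growth\<close> removes
  \<xi>. So \<theta> is zero or an eigenfunction.\<close>

lemma poly_kernel_in_span:
  assumes \<nu>: "\<And>i. i \<le> \<nu> i" and "p \<noteq> 0" "h \<in> Rec \<nu>" "\<And>z. poly_op p h z = 0"
  shows "h \<in> lspan (Uf \<tau> \<inter> Rec \<nu>)"
  using assms(2-)
proof (induction "degree p" arbitrary: p h)
  case 0
  then obtain c where c: "p = [:c:]" by (metis degree_0_id)
  then have "c \<noteq> 0" using 0 by auto
  then have "h = (\<lambda>_. 0)" using 0(4) c by (simp add: poly_op_def fun_eq_iff)
  then show ?case using lspan.zero by simp
next
  case (Suc d)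
  have "coeff p (degree p) \<noteq> 0" using Suc.prems(1) by simp
  then have "coeff p 0 = 0 \<or> (\<exists>i\<in>{1..degree p}. coeff p i \<noteq> 0)"
    using Suc.hyps(2) by (intro disjI2 bexI[of _ "degree p"]) auto
  then obtain a where "(\<Sum>i\<le>degree p. coeff p i * a ^ i) = 0" by (rule fundamental_theorem_of_algebra)
  then have "poly p a = 0" by (simp add: poly_altdef)
  then obtain q where q: "p = [:- a, 1:] * q" by (auto simp: poly_eq_0_iff_dvd)
  have q0: "q \<noteq> 0" using q Suc.prems(1) by auto
  have "degree p = Suc (degree q)" unfolding q using q0 by (subst degree_mult_eq) auto
  then have dq: "d = degree q" using Suc.hyps(2) by simp
  have hC: "h \<in> Ccont" using Suc.prems(2) Rec_Ccont by blast
  let ?h' = "\<lambda>z. M h z - a * h z"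
  have h'R: "?h' \<in> Rec \<nu>" using Rec_lincomb[OF Rec_M[OF Suc.prems(2)] Suc.prems(2), of 1 "- a"] by simp
  have "poly_op q ?h' z = 0" for z using Suc.prems(3)[of z] unfolding q poly_op_linear_factor[OF hC] .
  then have "?h' \<in> lspan (Uf \<tau> \<inter> Rec \<nu>)" by (rule Suc.hyps(1)[OF dq q0 h'R])
  from solve_in_span[OF this, of a] obtain v \<xi> where v: "v \<in> lspan (Uf \<tau> \<inter> Rec \<nu>)"
    and \<xi>: "\<xi> \<in> Ccont" "M \<xi> = (\<lambda>z. a * \<xi> z)" "cmod a = 1 \<or> (\<forall>z. \<xi> z = 0)"
    and eq: "\<And>z. M v z - a * v z = ?h' z - \<xi> z" by blast
  have vC: "v \<in> Ccont" using lspan_Ccont[OF v] Uf_Ccont by blast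
  have vR: "v \<in> Rec \<nu>" using v
  proof induction
    case (add u f c)
    then show ?case using Rec_lincomb[of u \<nu> f c 1] by simp
  qed (rule Rec_0)
  define \<theta> where "\<theta> z = h z - v z" for z
  have \<theta>R: "\<theta> \<in> Rec \<nu>" unfolding \<theta>_def by (rule Rec_diff[OF Suc.prems(2) vR])
  have \<theta>C: "\<theta> \<in> Ccont" using \<theta>R Rec_Ccont by blast
  have M\<theta>: "M \<theta> z = a * \<theta> z + \<xi> z" for z
  proof -
    have "M \<theta> z = M h z - M v z" unfolding \<theta>_def by (simp add: M_diff hC vC)
    moreover have "M v z = M h z - a * h z - \<xi> z + a * v z" using eq[of z] by (metis diff_add_cancel)
    ultimately show ?thesis by (simp add: \<theta>_def right_diff_distrib)
  qed
  have "\<xi> z = 0" for z using \<xi>(3) jordan_growth[OF \<theta>C \<xi>(1,2) _ M\<theta>] by blast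
  then have M\<theta>: "M \<theta> = (\<lambda>z. a * \<theta> z)" using M\<theta> by (simp add: fun_eq_iff)
  have "\<theta> \<in> lspan (Uf \<tau> \<inter> Rec \<nu>)"
  proof (cases "\<theta> = (\<lambda>_. 0)")
    case True
    then show ?thesis using lspan.zero by simp
  next
    case False
    \<comment> \<open>A decaying recurrent function is zero, which rules out eigenvalues inside the
      disc; boundedness of the iterates rules out those outside.\<close>
    have "\<not> cmod a < 1"
    proof
      assume "cmod a < 1"
      then have "\<theta> z = 0" for z using Rec_decays_0[OF \<nu> \<theta>R eigen_decays[OF \<theta>C M\<theta>]] by blast
      then show False using False by (simp add: fun_eq_iff)
    qed
    then have "cmod a = 1" using eigen_norm_le_1[OF \<theta>C M\<theta> False] by simp
    then have "\<theta> \<in> Uf \<tau>" using False \<theta>C M\<theta> unfolding Uf_def by blast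
    then show ?thesis using \<theta>R by (intro lspan_base) blast
  qed
  from lspan_add[OF this v] show ?case by (simp add: \<theta>_def)
qed

text \<open>Eigenfunctions are indexed by their own eigenvalue and may be zero, so one index set
  serves every element of the span.\<close>

definition eigen_family :: "complex set \<Rightarrow> (complex \<Rightarrow> rsphere \<Rightarrow> complex) \<Rightarrow> bool" where
  "eigen_family A f = (\<forall>a\<in>A. cmod a = 1 \<and> f a \<in> Ccont \<and> M (f a) = (\<lambda>z. a * f a z))"

lemma eigen_family_sum:
  assumes "finite A" "eigen_family A f"
  shows "(\<lambda>z. \<Sum>a\<in>A. f a z) \<in> Ccont" "M (\<lambda>z. \<Sum>a\<in>A. f a z) = (\<lambda>z. \<Sum>a\<in>A. a * f a z)"
  using assms
proof (induction A rule: finite_induct)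
  case empty
  { case 1 show ?case using Ccont_0 by simp }
  { case 2 show ?case by (simp add: M_0) }
next
  case (insert b A)
  have fb: "f b \<in> Ccont" "M (f b) = (\<lambda>z. b * f b z)" if "eigen_family (insert b A) f"
    using that by (auto simp: eigen_family_def)
  have sub: "eigen_family A f" if "eigen_family (insert b A) f"
    using that by (auto simp: eigen_family_def)
  { case 1
    show ?case using Ccont_add[OF fb(1)[OF 1] insert.IH(1)[OF sub[OF 1]]] insert.hyps by simp }
  { case 2
    show ?case
      using M_add[OF fb(1)[OF 2] insert.IH(1)[OF sub[OF 2]]] insert.hyps insert.IH(2)[OF sub[OF 2]] fb(2)[OF 2] by simp }
qed

text \<open>Applying M - b deletes the component at b and multiplies the others by a - b, which is
  nonzero. Inductions over the set of eigenvalues rest on this.\<close>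

lemma eigen_family_minus:
  assumes "finite A" "b \<notin> A" "eigen_family (insert b A) f" "cmod b = 1"
  shows "eigen_family A (\<lambda>a z. (a - b) * f a z)"
    "(\<lambda>z. 1 * M (\<lambda>z. \<Sum>a\<in>insert b A. f a z) z + (- b) * (\<Sum>a\<in>insert b A. f a z)) = (\<lambda>z. \<Sum>a\<in>A. (a - b) * f a z)"
proof -
  show "eigen_family A (\<lambda>a z. (a - b) * f a z)"
    unfolding eigen_family_def
  proof (intro ballI conjI)
    fix a assume a: "a \<in> A"
    then have f: "cmod a = 1" "f a \<in> Ccont" "M (f a) = (\<lambda>z. a * f a z)" using assms(3) by (auto simp: eigen_family_def)
    show "cmod a = 1" by (rule f)
    show "(\<lambda>z. (a - b) * f a z) \<in> Ccont" by (rule Ccont_scale[OF f(2)])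
    show "M (\<lambda>z. (a - b) * f a z) = (\<lambda>z. a * ((a - b) * f a z))" unfolding M_scale[OF f(2)] f(3) by (simp add: mult_ac)
  qed
  have fin: "finite (insert b A)" using assms(1) by simp
  show "(\<lambda>z. 1 * M (\<lambda>z. \<Sum>a\<in>insert b A. f a z) z + (- b) * (\<Sum>a\<in>insert b A. f a z)) = (\<lambda>z. \<Sum>a\<in>A. (a - b) * f a z)"
    unfolding eigen_family_sum(2)[OF fin assms(3)] using assms(1,2)
    by (simp add: fun_eq_iff sum_distrib_left sum_subtractf left_diff_distrib distrib_left sum_negf)
qed

text \<open>Asymptotic independence of eigenvalues: M - b preserves decay and removes one component
  at a time, and a single unimodular eigenfunction cannot decay.\<close>

lemma eigen_sum_decays_0:
  assumes "finite A" "eigen_family A f" "decays (\<lambda>z. \<Sum>a\<in>A. f a z)" "a \<in> A"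
  shows "f a z = 0"
  using assms
proof (induction A arbitrary: f a z rule: finite_induct)
  case (insert b A)
  have fin: "finite (insert b A)" using insert.hyps by simp
  have b: "cmod b = 1" "f b \<in> Ccont" "M (f b) = (\<lambda>z. b * f b z)" using insert.prems(1) by (auto simp: eigen_family_def)
  let ?g = "\<lambda>z. \<Sum>a\<in>insert b A. f a z"
  have gC: "?g \<in> Ccont" by (rule eigen_family_sum(1)[OF fin insert.prems(1)])
  have "decays (\<lambda>z. 1 * M ?g z + (- b) * ?g z)"
    by (rule decays_lincomb[OF M_Ccont[OF gC] gC decays_M insert.prems(2)]) (rule insert.prems(2))
  then have "decays (\<lambda>z. \<Sum>a\<in>A. (a - b) * f a z)"
    unfolding eigen_family_minus(2)[OF insert.hyps insert.prems(1) b(1)] .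
  then have "(a' - b) * f a' z = 0" if "a' \<in> A" for a' z
    by (rule insert.IH[OF eigen_family_minus(1)[OF insert.hyps insert.prems(1) b(1)] _ that])
  then have A0: "f a' z = 0" if "a' \<in> A" for a' z using that insert.hyps(2) by force
  have "?g = f b" using insert.hyps A0 by (simp add: fun_eq_iff)
  then have "decays (f b)" using insert.prems(2) by simp
  then have "f b z = 0" for z by (rule eigen_decays_0[OF b(2,3,1)])
  then show ?case using A0 insert.prems(3) by auto
qed simp

end

section \<open>Existence of the decomposition and finiteness of the unimodular eigenvalues\<close>

context mean_stable
begin

text \<open>The second premise says that h depends only on the values of the functions in
  \<open>F\<close>. So for a combination of rigid functions, zeros on the test set \<open>P\<close>
  give zeros on \<open>S_of \<tau>\<close>, without h itself having to be rigid.\<close>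

lemma rigid_sum_determined:
  assumes "h \<in> Ccont" "\<And>x y. (\<And>\<psi>. \<psi> \<in> F \<Longrightarrow> \<psi> x = \<psi> y) \<Longrightarrow> h x = h y" "\<And>\<psi>. \<psi> \<in> F \<Longrightarrow> \<psi> \<in> Ccont \<and> rigid \<psi>"
    and P: "\<And>x. x \<in> S_of \<tau> \<Longrightarrow> \<exists>s\<in>P. \<forall>\<psi>\<in>Ccont. rigid \<psi> \<longrightarrow> \<psi> x = \<psi> s" and 0: "\<And>s. s \<in> P \<Longrightarrow> h s = 0"
  shows "decays h"
  unfolding decays_def
proof (intro allI impI)
  fix c :: real assume c: "c > 0"
  have "h x = 0" if x: "x \<in> S_of \<tau>" for x
  proof -
    obtain s where s: "s \<in> P" "\<forall>\<psi>\<in>Ccont. rigid \<psi> \<longrightarrow> \<psi> x = \<psi> s" using P[OF x] by blast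
    have "h x = h s" by (rule assms(2)) (use s(2) assms(3) in blast)
    then show ?thesis using 0[OF s(1)] by simp
  qed
  then show "\<exists>N. \<forall>n\<ge>N. \<forall>z. cmod ((M ^^ n) h z) \<le> c" by (rule vanishing_on_S_decays[OF assms(1) _ c])
qed

text \<open>The card P + 1 first iterates of \<psi>, restricted to the test set \<open>P\<close>,
  are linearly dependent. This gives a nonzero polynomial p such that p(M) \<psi> vanishes on
  \<open>P\<close>, hence decays, and being recurrent is zero.\<close>

lemma recurrent_in_span:
  assumes \<nu>: "\<And>i. i \<le> \<nu> i" and \<psi>: "\<psi> \<in> Rec \<nu>"
  shows "\<psi> \<in> lspan (Uf \<tau> \<inter> Rec \<nu>)"
proof -
  obtain P where P: "finite P" "P \<subseteq> S_of \<tau>" "\<And>x. x \<in> S_of \<tau> \<Longrightarrow> \<exists>s\<in>P. \<forall>\<psi>\<in>Ccont. rigid \<psi> \<longrightarrow> \<psi> x = \<psi> s"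
    using finite_test_set by blast
  define N where "N = card P"
  obtain c where c: "\<exists>i\<in>{..N}. c i \<noteq> 0" "\<forall>s\<in>P. (\<Sum>i\<in>{..N}. c i * (M ^^ i) \<psi> s) = 0"
    using linear_dependence[OF P(1), of "{..N}" "\<lambda>i s. (M ^^ i) \<psi> s"] by (auto simp: N_def)
  define p where "p = (\<Sum>i\<le>N. monom (c i) i)"
  have cp: "coeff p i = (if i \<le> N then c i else 0)" for i
    by (simp add: p_def coeff_sum)
  have "p \<noteq> 0" using c(1) cp by (metis atMost_iff coeff_0)
  have dp: "degree p \<le> N" by (rule degree_le) (simp add: cp)
  have op: "poly_op p \<psi> z = (\<Sum>i\<le>N. c i * (M ^^ i) \<psi> z)" for z
    unfolding poly_op_eq[OF dp] by (intro sum.cong) (auto simp: cp)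
  have sumR: "(\<lambda>z. \<Sum>i\<in>I. c i * (M ^^ i) \<psi> z) \<in> Rec \<nu>" if "finite I" for I
    using that
  proof (induction I rule: finite_induct)
    case (insert x I)
    then show ?case using Rec_lincomb[OF Rec_Mn[OF \<psi>, of x] insert.IH, of "c x" 1] by simp
  qed (simp add: Rec_0)
  have "poly_op p \<psi> = (\<lambda>z. \<Sum>i\<le>N. c i * (M ^^ i) \<psi> z)" using op by (rule ext)
  then have R: "poly_op p \<psi> \<in> Rec \<nu>" using sumR[of "{..N}"] by simp
  have "decays (poly_op p \<psi>)"
    by (rule rigid_sum_determined[where F = "{poly_op p \<psi>}" and P = P])
       (use R Rec_Ccont Rec_rigid[OF \<nu> R] P(3) op c(2) in auto)
  then have "poly_op p \<psi> z = 0" for z by (rule Rec_decays_0[OF \<nu> R])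
  then show ?thesis by (rule poly_kernel_in_span[OF \<nu> \<open>p \<noteq> 0\<close> \<psi>])
qed

lemma decomposition:
  assumes "\<phi> \<in> Ccont" obtains \<psi> where "\<psi> \<in> LS (Uf \<tau>)" "(\<lambda>z. \<phi> z - \<psi> z) \<in> Zsp \<tau>"
proof -
  obtain \<nu> \<psi> where \<nu>: "\<And>i. i \<le> \<nu> i" and \<psi>: "\<psi> \<in> Rec \<nu>" "decays (\<lambda>z. \<phi> z - \<psi> z)"
    by (rule recurrent_part[OF assms]) blast
  have "\<psi> \<in> LS (Uf \<tau>)"
    unfolding LS_eq_lspan by (rule lspan_mono[OF recurrent_in_span[OF \<nu> \<psi>(1)]]) blast
  then show ?thesis using that \<psi>(2) Ccont_diff[OF assms Rec_Ccont[OF \<psi>(1)]] by (simp add: Zsp_iff)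
qed

text \<open>Eigenfunctions for card P + 1 distinct eigenvalues would have a nontrivial combination
  vanishing on the test set; it decays, against \<open>eigen_sum_decays_0\<close>.\<close>

lemma finite_Uv: "finite (Uv \<tau>)"
proof (rule ccontr)
  assume inf: "infinite (Uv \<tau>)"
  obtain P where P: "finite P" "P \<subseteq> S_of \<tau>" "\<And>x. x \<in> S_of \<tau> \<Longrightarrow> \<exists>s\<in>P. \<forall>\<psi>\<in>Ccont. rigid \<psi> \<longrightarrow> \<psi> x = \<psi> s"
    using finite_test_set by blast
  obtain B where B: "B \<subseteq> Uv \<tau>" "finite B" "card B = Suc (card P)"
    using infinite_arbitrarily_large[OF inf] by metis
  have "\<forall>b\<in>B. \<exists>u. cmod b = 1 \<and> u \<in> Ccont \<and> u \<noteq> (\<lambda>_. 0) \<and> M u = (\<lambda>z. b * u z)"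
    using B(1) unfolding Uv_def by blast
  then obtain u where u: "\<And>b. b \<in> B \<Longrightarrow> cmod b = 1 \<and> u b \<in> Ccont \<and> u b \<noteq> (\<lambda>_. 0) \<and> M (u b) = (\<lambda>z. b * u b z)" by metis
  obtain c where c: "\<exists>i\<in>B. c i \<noteq> 0" "\<forall>s\<in>P. (\<Sum>i\<in>B. c i * u i s) = 0"
    using linear_dependence[OF P(1) B(2), of u] B(3) by auto
  let ?f = "\<lambda>b z. c b * u b z"
  have ef: "eigen_family B ?f"
    unfolding eigen_family_def using u by (auto simp: M_scale Ccont_scale mult_ac)
  have "decays (\<lambda>z. \<Sum>b\<in>B. ?f b z)"
  proof (rule rigid_sum_determined[where F = "u ` B" and P = P])
    show "(\<lambda>z. \<Sum>b\<in>B. ?f b z) \<in> Ccont" by (rule eigen_family_sum(1)[OF B(2) ef])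
    show "\<psi> \<in> Ccont \<and> rigid \<psi>" if "\<psi> \<in> u ` B" for \<psi> using that u eigen_rigid by blast
    show "(\<Sum>b\<in>B. ?f b x) = (\<Sum>b\<in>B. ?f b y)" if "\<And>\<psi>. \<psi> \<in> u ` B \<Longrightarrow> \<psi> x = \<psi> y" for x y
      by (intro sum.cong refl) (simp add: that)
  qed (use P(3) c(2) in auto)
  then have 0: "c b * u b z = 0" if "b \<in> B" for b z by (rule eigen_sum_decays_0[OF B(2) ef _ that])
  obtain b where b: "b \<in> B" "c b \<noteq> 0" using c(1) by blast
  then have "u b z = 0" for z using 0[OF b(1), of z] by simp
  then show False using u[OF b(1)] by (simp add: fun_eq_iff)
qed

end

section \<open>The resolvent\<close>

text \<open>The factor 2 arises because \<open>a n\<close> bounds both the sup norm and the Hoelder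
  constant of the n-th term.\<close>

lemma holder_suminf:
  assumes f: "\<And>n. f n \<in> Calpha \<alpha>" and a: "\<And>n. holder_norm \<alpha> (f n) \<le> a n" "summable a"
  shows "(\<lambda>z. \<Sum>n. f n z) \<in> Calpha \<alpha>" "holder_norm \<alpha> (\<lambda>z. \<Sum>n. f n z) \<le> 2 * suminf a"
    "summable (\<lambda>n. f n z)"
proof -
  have le: "cmod (f n z) \<le> a n" for n z using Calpha_upper(2)[OF f, of n z] a(1)[of n] by linarith
  have le2: "cmod (f n x - f n y) \<le> a n * dist x y powr \<alpha>" for n x y
    using Calpha_upper(3)[OF f, of n x y] mult_right_mono[OF a(1)[of n], of "dist x y powr \<alpha>"] by simp
  show s: "summable (\<lambda>n. f n z)" for z
    by (rule summable_norm_cancel, rule summable_comparison_test'[OF a(2), of 0]) (simp add: le)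
  have 1: "cmod (\<Sum>n. f n z) \<le> suminf a" for z
    by (rule norm_suminf_le[OF le a(2)])
  have 2: "cmod ((\<Sum>n. f n x) - (\<Sum>n. f n y)) \<le> suminf a * dist x y powr \<alpha>" for x y
  proof -
    have "(\<Sum>n. f n x) - (\<Sum>n. f n y) = (\<Sum>n. f n x - f n y)" by (rule suminf_diff[OF s s])
    moreover have "cmod (\<Sum>n. f n x - f n y) \<le> (\<Sum>n. a n * dist x y powr \<alpha>)"
      by (rule norm_suminf_le[OF le2 summable_mult2[OF a(2)]])
    ultimately show ?thesis using suminf_mult2[OF a(2), of "dist x y powr \<alpha>"] by simp
  qed
  show "(\<lambda>z. \<Sum>n. f n z) \<in> Calpha \<alpha>" by (rule CalphaI(1)[OF 1 2])
  show "holder_norm \<alpha> (\<lambda>z. \<Sum>n. f n z) \<le> 2 * suminf a" using CalphaI(4)[OF 1 2] by simp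
qed

context random_rational
begin

lemma shift_op_lincomb:
  assumes "\<phi> \<in> Ccont" "\<psi> \<in> Ccont"
  shows "shift_op \<zeta> \<tau> (\<lambda>z. c * \<phi> z + d * \<psi> z) = (\<lambda>z. c * shift_op \<zeta> \<tau> \<phi> z + d * shift_op \<zeta> \<tau> \<psi> z)"
  unfolding shift_op_def M_lincomb[OF assms] by (simp add: fun_eq_iff algebra_simps)

lemma shift_op_add:
  "\<phi> \<in> Ccont \<Longrightarrow> \<psi> \<in> Ccont \<Longrightarrow> shift_op \<zeta> \<tau> (\<lambda>z. \<phi> z + \<psi> z) = (\<lambda>z. shift_op \<zeta> \<tau> \<phi> z + shift_op \<zeta> \<tau> \<psi> z)"
  using shift_op_lincomb[of \<phi> \<psi> \<zeta> 1 1] by simp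

lemma shift_op_diff:
  "\<phi> \<in> Ccont \<Longrightarrow> \<psi> \<in> Ccont \<Longrightarrow> shift_op \<zeta> \<tau> (\<lambda>z. \<phi> z - \<psi> z) = (\<lambda>z. shift_op \<zeta> \<tau> \<phi> z - shift_op \<zeta> \<tau> \<psi> z)"
  using shift_op_lincomb[of \<phi> \<psi> \<zeta> 1 "-1"] by simp

lemma shift_op_Calpha:
  assumes "\<alpha> > 0" "\<phi> \<in> Calpha \<alpha>" shows "shift_op \<zeta> \<tau> \<phi> \<in> Calpha \<alpha>"
  unfolding shift_op_def
  using Mn_Calpha[OF assms, of 1] by (intro Calpha_diff(1) Calpha_scale(1) assms(2)) simp

lemma shift_op_M: "\<phi> \<in> Ccont \<Longrightarrow> shift_op \<zeta> \<tau> (M \<phi>) = M (shift_op \<zeta> \<tau> \<phi>)"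
  unfolding shift_op_def using M_lincomb[of \<phi> "M \<phi>" \<zeta> "-1"] by (simp add: M_Ccont)

text \<open>On a sum of eigenfunctions, \<open>\<zeta> - M\<close> is bounded below: apply \<open>M - b\<close> to remove the eigenvalue \<open>b\<close>.\<close>

lemma shift_op_bounded_below:
  assumes \<alpha>: "\<alpha> > 0" and "finite A" "A \<subseteq> {a. cmod a = 1}" "\<zeta> \<notin> A"
  shows "\<exists>K\<ge>0. \<forall>f. eigen_family A f \<longrightarrow> (\<forall>a\<in>A. f a \<in> Calpha \<alpha>) \<longrightarrow>
    holder_norm \<alpha> (\<lambda>z. \<Sum>a\<in>A. f a z) \<le> K * holder_norm \<alpha> (shift_op \<zeta> \<tau> (\<lambda>z. \<Sum>a\<in>A. f a z))"
  using assms(2-)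
proof (induction A rule: finite_induct)
  case empty
  have "holder_norm \<alpha> (\<lambda>_. 0) \<le> 0 + 0"
    by (rule CalphaI(4)) auto
  then show ?case by (intro exI[of _ 0]) simp
next
  case (insert b A)
  obtain K where K: "K \<ge> 0" and IH: "\<And>f. eigen_family A f \<Longrightarrow> (\<forall>a\<in>A. f a \<in> Calpha \<alpha>) \<Longrightarrow>
    holder_norm \<alpha> (\<lambda>z. \<Sum>a\<in>A. f a z) \<le> K * holder_norm \<alpha> (shift_op \<zeta> \<tau> (\<lambda>z. \<Sum>a\<in>A. f a z))"
    using insert.IH insert.prems by auto
  obtain L where L: "L \<ge> 1" "\<And>\<phi>. \<phi> \<in> Calpha \<alpha> \<Longrightarrow> M \<phi> \<in> Calpha \<alpha> \<and> holder_norm \<alpha> (M \<phi>) \<le> L * holder_norm \<alpha> \<phi>"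
    using M_Calpha[OF \<alpha>] by blast
  have b: "cmod b = 1" "\<zeta> \<noteq> b" using insert.prems by auto
  \<comment> \<open>With g' = (M - b) g, the identity (\<zeta> - M) g + g' = (\<zeta> - b) g bounds
    g by its image and g'. The induction bounds g' by K times the norm of (M - b) (\<zeta> - M) g,
    where M - b costs at most L + 1.\<close>
  define K' where "K' = cmod (1 / (\<zeta> - b)) * (1 + K * (L + 1))"
  have "holder_norm \<alpha> (\<lambda>z. \<Sum>a\<in>insert b A. f a z) \<le> K' * holder_norm \<alpha> (shift_op \<zeta> \<tau> (\<lambda>z. \<Sum>a\<in>insert b A. f a z))"
    if ef: "eigen_family (insert b A) f" and fX: "\<forall>a\<in>insert b A. f a \<in> Calpha \<alpha>" for f
  proof -
    let ?g = "\<lambda>z. \<Sum>a\<in>insert b A. f a z"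
    let ?T = "shift_op \<zeta> \<tau>"
    let ?N = "holder_norm \<alpha>"
    have fin: "finite (insert b A)" using insert.hyps by simp
    have gC: "?g \<in> Ccont" by (rule eigen_family_sum(1)[OF fin ef])
    have sumX: "(\<lambda>z. \<Sum>a\<in>B. f a z) \<in> Calpha \<alpha>" if "B \<subseteq> insert b A" for B
    proof -
      have "finite B" using \<open>B \<subseteq> insert b A\<close> fin finite_subset by blast
      then show ?thesis using \<open>B \<subseteq> insert b A\<close>
      proof (induction B rule: finite_induct)
        case empty
        show ?case using CalphaI(1)[of "\<lambda>_. 0" 0 0] by simp
      next
        case (insert x B)
        then show ?case using Calpha_add(1)[of "f x" \<alpha> "\<lambda>z. \<Sum>a\<in>B. f a z"] fX by simp
      qed
    qed
    have gX: "?g \<in> Calpha \<alpha>" by (rule sumX) simp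
    have TgX: "?T ?g \<in> Calpha \<alpha>" by (rule shift_op_Calpha[OF \<alpha> gX])
    have TgC: "?T ?g \<in> Ccont" by (rule Calpha_Ccont[OF TgX \<alpha>])
    let ?g' = "\<lambda>z. 1 * M ?g z + (- b) * ?g z"
    have g': "?g' = (\<lambda>z. \<Sum>a\<in>A. (a - b) * f a z)" by (rule eigen_family_minus(2)[OF insert.hyps ef b(1)])
    have "\<forall>a\<in>A. (\<lambda>z. (a - b) * f a z) \<in> Calpha \<alpha>" using fX by (auto intro: Calpha_scale(1))
    from IH[OF eigen_family_minus(1)[OF insert.hyps ef b(1)] this]
    have 1: "?N ?g' \<le> K * ?N (?T ?g')" unfolding g' .
    have Tg': "?T ?g' = (\<lambda>z. M (?T ?g) z + (- b) * ?T ?g z)"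
      unfolding shift_op_lincomb[OF M_Ccont[OF gC] gC] shift_op_M[OF gC] by simp
    have "?N (?T ?g') \<le> ?N (M (?T ?g)) + ?N (\<lambda>z. (- b) * ?T ?g z)"
      unfolding Tg' using L(2)[OF TgX] by (intro Calpha_add(2) Calpha_scale(1) TgX) blast
    also have "\<dots> \<le> L * ?N (?T ?g) + cmod (- b) * ?N (?T ?g)"
      using L(2)[OF TgX] by (intro add_mono Calpha_scale(2)[OF TgX]) blast
    also have "\<dots> = (L + 1) * ?N (?T ?g)" using b(1) by (simp add: distrib_right)
    finally have 2: "?N (?T ?g') \<le> (L + 1) * ?N (?T ?g)" .
    have g'X: "?g' \<in> Calpha \<alpha>"
      using L(2)[OF gX] by (intro Calpha_add(1) Calpha_scale(1) gX) blast
    have "?g z = 1 / (\<zeta> - b) * (?T ?g z + ?g' z)" for z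
    proof -
      have "?T ?g z + ?g' z = (\<zeta> - b) * ?g z" by (simp only: shift_op_def) (simp add: algebra_simps)
      moreover have "\<zeta> - b \<noteq> 0" using b(2) by simp
      ultimately show ?thesis by (metis mult.assoc mult.left_neutral nonzero_eq_divide_eq times_divide_eq_left)
    qed
    then have geq: "?g = (\<lambda>z. 1 / (\<zeta> - b) * (?T ?g z + ?g' z))" by (rule ext)
    have "?N ?g = ?N (\<lambda>z. 1 / (\<zeta> - b) * (?T ?g z + ?g' z))" using geq by (rule arg_cong)
    also have "\<dots> \<le> cmod (1 / (\<zeta> - b)) * ?N (\<lambda>z. ?T ?g z + ?g' z)"
      by (rule Calpha_scale(2)[OF Calpha_add(1)[OF TgX g'X]])
    also have "?N (\<lambda>z. ?T ?g z + ?g' z) \<le> ?N (?T ?g) + ?N ?g'" by (rule Calpha_add(2)[OF TgX g'X])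
    also have "?N ?g' \<le> K * ((L + 1) * ?N (?T ?g))" using 1 mult_left_mono[OF 2 K] by linarith
    finally have "?N ?g \<le> cmod (1 / (\<zeta> - b)) * (?N (?T ?g) + K * ((L + 1) * ?N (?T ?g)))"
      by (simp add: mult_left_mono)
    also have "\<dots> = K' * ?N (?T ?g)" by (simp add: K'_def algebra_simps)
    finally show ?thesis .
  qed
  moreover have "K' \<ge> 0" using K L(1) by (simp add: K'_def)
  ultimately show ?case by blast
qed

text \<open>Terms with equal eigenvalue are merged; finiteness of \<open>Uv \<tau>\<close> allows a
  sum over all eigenvalues, with zero components where none occurs.\<close>

lemma lspan_eigen_family:
  assumes fin: "finite (Uv \<tau>)" and "\<psi> \<in> lspan (Uf \<tau>)"
  shows "\<exists>f. eigen_family (Uv \<tau>) f \<and> (\<forall>z. \<psi> z = (\<Sum>a\<in>Uv \<tau>. f a z))"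
  using assms(2)
proof induction
  case zero
  have "eigen_family (Uv \<tau>) (\<lambda>_ _. 0)" by (auto simp: eigen_family_def Uv_def Ccont_0 M_0)
  then show ?case by (intro exI[of _ "\<lambda>_ _. 0"]) simp
next
  case (add u g c)
  then obtain f where f: "eigen_family (Uv \<tau>) f" "\<And>z. g z = (\<Sum>a\<in>Uv \<tau>. f a z)" by blast
  obtain b where b: "cmod b = 1" "u \<in> Ccont" "M u = (\<lambda>z. b * u z)" "u \<noteq> (\<lambda>_. 0)" using add.hyps by (auto simp: Uf_def)
  have bU: "b \<in> Uv \<tau>" using b by (auto simp: Uv_def)
  have fb: "f b \<in> Ccont" "M (f b) = (\<lambda>z. b * f b z)" using f(1) bU by (auto simp: eigen_family_def)
  let ?f = "f(b := (\<lambda>z. c * u z + 1 * f b z))"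
  have "M (\<lambda>z. c * u z + 1 * f b z) = (\<lambda>z. b * (c * u z + 1 * f b z))"
    unfolding M_lincomb[OF b(2) fb(1)] b(3) fb(2) by (simp add: fun_eq_iff algebra_simps)
  then have "eigen_family (Uv \<tau>) ?f"
    using f(1) b(1) Ccont_lincomb[OF b(2) fb(1), of c 1] by (auto simp: eigen_family_def)
  moreover have "c * u z + g z = (\<Sum>a\<in>Uv \<tau>. ?f a z)" for z
  proof -
    have "(\<Sum>a\<in>Uv \<tau>. ?f a z) = ?f b z + (\<Sum>a\<in>Uv \<tau> - {b}. ?f a z)" by (rule sum.remove[OF fin bU])
    also have "(\<Sum>a\<in>Uv \<tau> - {b}. ?f a z) = (\<Sum>a\<in>Uv \<tau> - {b}. f a z)" by (intro sum.cong) auto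
    finally show ?thesis using sum.remove[OF fin bU, of "\<lambda>a. f a z"] by (simp add: f(2))
  qed
  ultimately show ?case by blast
qed

text \<open>Each generator with eigenvalue b is divided by \<zeta> - b, which is nonzero off
  \<open>Uv \<tau>\<close>.\<close>

lemma lspan_shift_op_inverse:
  assumes "\<zeta> \<notin> Uv \<tau>" "\<psi> \<in> lspan (Uf \<tau>)" shows "\<exists>\<rho>\<in>lspan (Uf \<tau>). shift_op \<zeta> \<tau> \<rho> = \<psi>"
  using assms(2)
proof induction
  case zero
  show ?case by (rule bexI[OF _ lspan.zero]) (simp add: shift_op_def M_0)
next
  case (add u f c)
  then obtain \<rho> where \<rho>: "\<rho> \<in> lspan (Uf \<tau>)" "shift_op \<zeta> \<tau> \<rho> = f" by blast
  have \<rho>C: "\<rho> \<in> Ccont" using lspan_Ccont[OF \<rho>(1) Uf_Ccont] .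
  obtain b where b: "cmod b = 1" "u \<in> Ccont" "M u = (\<lambda>z. b * u z)" "u \<noteq> (\<lambda>_. 0)" using add.hyps by (auto simp: Uf_def)
  then have "b \<in> Uv \<tau>" by (auto simp: Uv_def)
  then have ne: "\<zeta> - b \<noteq> 0" using assms(1) by auto
  have "shift_op \<zeta> \<tau> (\<lambda>z. c / (\<zeta> - b) * u z + 1 * \<rho> z) = (\<lambda>z. c * u z + f z)"
    unfolding shift_op_lincomb[OF b(2) \<rho>C] \<rho>(2)
  proof
    fix z
    have "c / (\<zeta> - b) * shift_op \<zeta> \<tau> u z = c / (\<zeta> - b) * ((\<zeta> - b) * u z)"
      unfolding shift_op_def b(3) by (simp only: left_diff_distrib)
    also have "\<dots> = c * u z" unfolding mult.assoc[symmetric] using ne by simp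
    finally show "c / (\<zeta> - b) * shift_op \<zeta> \<tau> u z + 1 * f z = c * u z + f z" by simp
  qed
  moreover have "(\<lambda>z. c / (\<zeta> - b) * u z + 1 * \<rho> z) \<in> lspan (Uf \<tau>)" using lspan.add[OF add.hyps(1) \<rho>(1), of "c / (\<zeta> - b)"] by (simp only: mult_1)
  ultimately show ?case by blast
qed

end

section \<open>Uniqueness of the projection\<close>

context mean_stable
begin

text \<open>Directness of the sum. With \<open>decomposition\<close>, it makes the definite
  description in \<open>proj\<close> denote.\<close>

lemma span_decays_0: assumes "\<psi> \<in> lspan (Uf \<tau>)" "decays \<psi>" shows "\<psi> = (\<lambda>_. 0)"
proof -
  obtain f where f: "eigen_family (Uv \<tau>) f" "\<And>z. \<psi> z = (\<Sum>a\<in>Uv \<tau>. f a z)"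
    using lspan_eigen_family[OF finite_Uv assms(1)] by blast
  have "\<psi> = (\<lambda>z. \<Sum>a\<in>Uv \<tau>. f a z)" using f(2) by (rule ext)
  then have "decays (\<lambda>z. \<Sum>a\<in>Uv \<tau>. f a z)" using assms(2) by simp
  then have "f a z = 0" if "a \<in> Uv \<tau>" for a z using eigen_sum_decays_0[OF finite_Uv f(1)] that by blast
  then show ?thesis using f(2) by (simp add: fun_eq_iff)
qed

lemma proj_eqI:
  assumes "\<phi> \<in> Ccont" "\<psi> \<in> lspan (Uf \<tau>)" "decays (\<lambda>z. \<phi> z - \<psi> z)" shows "proj \<tau> \<phi> = \<psi>"
  unfolding proj_def LS_eq_lspan
proof (rule the_equality)
  have \<psi>C: "\<psi> \<in> Ccont" by (rule lspan_Ccont[OF assms(2) Uf_Ccont])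
  show "\<psi> \<in> lspan (Uf \<tau>) \<and> (\<lambda>z. \<phi> z - \<psi> z) \<in> Zsp \<tau>"
    using assms Ccont_diff[OF assms(1) \<psi>C] by (simp add: Zsp_iff)
  fix \<psi>' assume \<psi>': "\<psi>' \<in> lspan (Uf \<tau>) \<and> (\<lambda>z. \<phi> z - \<psi>' z) \<in> Zsp \<tau>"
  then have d': "(\<lambda>z. \<phi> z - \<psi>' z) \<in> Ccont" "decays (\<lambda>z. \<phi> z - \<psi>' z)" by (simp_all add: Zsp_iff)
  have "decays (\<lambda>z. 1 * (\<phi> z - \<psi> z) + (-1) * (\<phi> z - \<psi>' z))"
    by (rule decays_lincomb[OF Ccont_diff[OF assms(1) \<psi>C] d'(1) assms(3) d'(2)])
  then have "decays (\<lambda>z. \<psi>' z - \<psi> z)" by simp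
  moreover have "(\<lambda>z. \<psi>' z - \<psi> z) \<in> lspan (Uf \<tau>)" using \<psi>' assms(2) by (intro lspan_diff) auto
  ultimately have "(\<lambda>z. \<psi>' z - \<psi> z) = (\<lambda>_. 0)" by (rule span_decays_0[rotated])
  then show "\<psi>' = \<psi>" by (simp add: fun_eq_iff)
qed

lemma proj_span: assumes "\<phi> \<in> Ccont" shows "proj \<tau> \<phi> \<in> lspan (Uf \<tau>)"
proof -
  obtain \<psi> where \<psi>: "\<psi> \<in> LS (Uf \<tau>)" "(\<lambda>z. \<phi> z - \<psi> z) \<in> Zsp \<tau>" by (rule decomposition[OF assms]) blast
  have "proj \<tau> \<phi> = \<psi>"
    by (rule proj_eqI[OF assms]) (use \<psi> in \<open>simp_all add: LS_eq_lspan Zsp_iff\<close>)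
  then show ?thesis using \<psi>(1) by (simp add: LS_eq_lspan)
qed

end

section \<open>Solving the resolvent equation in the Hoelder space\<close>

locale exponential_convergence = mean_stable +
  fixes \<alpha> lam C :: real
  assumes \<alpha>: "0 < \<alpha>" and lam: "0 < lam" and C: "0 < C"
    and conv: "\<And>\<phi> n. \<phi> \<in> Calpha \<alpha> \<Longrightarrow> holder_norm \<alpha> ((M ^^ n) (\<lambda>z. \<phi> z - proj \<tau> \<phi> z)) \<le> C * lam ^ n * holder_norm \<alpha> \<phi>"
    and LS_Calpha: "LS (Uf \<tau>) \<subseteq> Calpha \<alpha>"
begin

abbreviation "resolvent_set \<equiv> - ({z. cmod z \<le> lam} \<union> Uv \<tau>)"

text \<open>An eigenvalue has modulus at most 1, and modulus 1 is excluded by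
  \<open>Uv \<tau>\<close>. So the eigenfunction decays, its projection is zero, and the assumed
  convergence rate contradicts growth like the powers of \<zeta>, whose modulus exceeds
  \<open>lam\<close>.\<close>

lemma shift_op_injective_0:
  assumes \<zeta>: "\<zeta> \<in> resolvent_set" and \<phi>: "\<phi> \<in> Calpha \<alpha>" and 0: "shift_op \<zeta> \<tau> \<phi> = (\<lambda>_. 0)"
  shows "\<phi> = (\<lambda>_. 0)"
proof (rule ccontr)
  assume ne: "\<phi> \<noteq> (\<lambda>_. 0)"
  have \<phi>C: "\<phi> \<in> Ccont" by (rule Calpha_Ccont[OF \<phi> \<alpha>])
  have M\<phi>: "M \<phi> = (\<lambda>z. \<zeta> * \<phi> z)" using 0 by (simp add: shift_op_def fun_eq_iff)
  have "cmod \<zeta> \<le> 1" by (rule eigen_norm_le_1[OF \<phi>C M\<phi> ne])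
  moreover have "cmod \<zeta> \<noteq> 1" using \<zeta> \<phi>C M\<phi> ne by (auto simp: Uv_def)
  ultimately have "decays \<phi>" by (intro eigen_decays[OF \<phi>C M\<phi>]) simp
  then have p0: "proj \<tau> \<phi> = (\<lambda>_. 0)" by (intro proj_eqI[OF \<phi>C lspan.zero]) simp
  obtain z where z: "\<phi> z \<noteq> 0" using ne by auto
  have \<zeta>l: "lam < cmod \<zeta>" using \<zeta> by auto
  then have "1 < cmod \<zeta> / lam" using lam by simp
  then obtain n where n: "C * holder_norm \<alpha> \<phi> / cmod (\<phi> z) < (cmod \<zeta> / lam) ^ n" using real_arch_pow by blast
  have "cmod \<zeta> ^ n * cmod (\<phi> z) = cmod ((M ^^ n) \<phi> z)" by (simp add: Mn_eigen[OF \<phi>C M\<phi>] norm_mult norm_power)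
  also have "\<dots> \<le> holder_norm \<alpha> ((M ^^ n) \<phi>)" by (rule Calpha_upper(2)[OF Mn_Calpha[OF \<alpha> \<phi>]])
  also have "\<dots> \<le> C * lam ^ n * holder_norm \<alpha> \<phi>" using conv[OF \<phi>, of n] by (simp add: p0)
  finally show False using n z lam by (simp add: field_simps power_divide)
qed

lemma shift_op_inj:
  assumes "\<zeta> \<in> resolvent_set" "\<phi> \<in> Calpha \<alpha>" "\<psi> \<in> Calpha \<alpha>" "shift_op \<zeta> \<tau> \<phi> = shift_op \<zeta> \<tau> \<psi>"
  shows "\<phi> = \<psi>"
proof -
  have "shift_op \<zeta> \<tau> (\<lambda>z. \<phi> z - \<psi> z) = (\<lambda>_. 0)"
    using assms(4) by (simp add: shift_op_diff Calpha_Ccont[OF _ \<alpha>] assms(2,3))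
  then have "(\<lambda>z. \<phi> z - \<psi> z) = (\<lambda>_. 0)" by (rule shift_op_injective_0[OF assms(1) Calpha_diff(1)[OF assms(2,3)]])
  then show ?thesis by (simp add: fun_eq_iff)
qed

lemma span_Calpha: "\<psi> \<in> lspan (Uf \<tau>) \<Longrightarrow> \<psi> \<in> Calpha \<alpha>"
  using LS_Calpha by (auto simp: LS_eq_lspan)

lemma span_bounded_below:
  assumes "\<zeta> \<in> resolvent_set"
  shows "\<exists>K\<ge>0. \<forall>\<rho>\<in>lspan (Uf \<tau>). holder_norm \<alpha> \<rho> \<le> K * holder_norm \<alpha> (shift_op \<zeta> \<tau> \<rho>)"
proof -
  have "Uv \<tau> \<subseteq> {a. cmod a = 1}" "\<zeta> \<notin> Uv \<tau>" using assms by (auto simp: Uv_def)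
  from shift_op_bounded_below[OF \<alpha> finite_Uv this]
  obtain K where K: "K \<ge> 0" "\<And>f. eigen_family (Uv \<tau>) f \<Longrightarrow> (\<forall>a\<in>Uv \<tau>. f a \<in> Calpha \<alpha>) \<Longrightarrow>
    holder_norm \<alpha> (\<lambda>z. \<Sum>a\<in>Uv \<tau>. f a z) \<le> K * holder_norm \<alpha> (shift_op \<zeta> \<tau> (\<lambda>z. \<Sum>a\<in>Uv \<tau>. f a z))" by blast
  have "holder_norm \<alpha> \<rho> \<le> K * holder_norm \<alpha> (shift_op \<zeta> \<tau> \<rho>)" if \<rho>: "\<rho> \<in> lspan (Uf \<tau>)" for \<rho>
  proof -
    obtain f where f: "eigen_family (Uv \<tau>) f" "\<And>z. \<rho> z = (\<Sum>a\<in>Uv \<tau>. f a z)"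
      using lspan_eigen_family[OF finite_Uv \<rho>] by blast
    \<comment> \<open>A nonzero component is an eigenfunction, hence in the span, whose elements are
      assumed to be Hoelder.\<close>
    have "f a \<in> Calpha \<alpha>" if a: "a \<in> Uv \<tau>" for a
    proof (cases "f a = (\<lambda>_. 0)")
      case True
      then show ?thesis using span_Calpha[OF lspan.zero] by simp
    next
      case False
      then have "f a \<in> Uf \<tau>" using f(1) a unfolding Uf_def eigen_family_def by blast
      then show ?thesis by (intro span_Calpha lspan_base)
    qed
    moreover have "\<rho> = (\<lambda>z. \<Sum>a\<in>Uv \<tau>. f a z)" using f(2) by (rule ext)
    ultimately show ?thesis using K(2)[OF f(1)] by simp
  qed
  then show ?thesis using K(1) by blast
qed

definition series :: "complex \<Rightarrow> (rsphere \<Rightarrow> complex) \<Rightarrow> rsphere \<Rightarrow> complex" where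
  "series \<zeta> \<phi> z = (\<Sum>n. (M ^^ n) (\<lambda>w. \<phi> w - proj \<tau> \<phi> w) z / \<zeta> ^ (n + 1))"

text \<open>The Neumann series converges after the projection is subtracted, since there the
  iterates shrink like lam^n and lam < |\<zeta>|.\<close>

lemma series:
  assumes \<zeta>: "\<zeta> \<in> resolvent_set" and \<phi>: "\<phi> \<in> Calpha \<alpha>"
  shows "series \<zeta> \<phi> \<in> Calpha \<alpha>"
    "holder_norm \<alpha> (series \<zeta> \<phi>) \<le> 2 * C / (cmod \<zeta> - lam) * holder_norm \<alpha> \<phi>"
    "(\<lambda>N. holder_norm \<alpha> (\<lambda>z. series \<zeta> \<phi> z - (\<Sum>n<N. (M ^^ n) (\<lambda>w. \<phi> w - proj \<tau> \<phi> w) z / \<zeta> ^ (n + 1)))) \<longlonglongrightarrow> 0"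
    "shift_op \<zeta> \<tau> (series \<zeta> \<phi>) = (\<lambda>z. \<phi> z - proj \<tau> \<phi> z)"
proof -
  let ?N = "holder_norm \<alpha>"
  let ?h = "\<lambda>w. \<phi> w - proj \<tau> \<phi> w"
  define f where "f n z = (M ^^ n) ?h z / \<zeta> ^ (n + 1)" for n z
  have \<phi>C: "\<phi> \<in> Ccont" by (rule Calpha_Ccont[OF \<phi> \<alpha>])
  have hX: "?h \<in> Calpha \<alpha>" by (rule Calpha_diff(1)[OF \<phi> span_Calpha[OF proj_span[OF \<phi>C]]])
  have hC: "?h \<in> Ccont" by (rule Calpha_Ccont[OF hX \<alpha>])
  have \<zeta>l: "lam < cmod \<zeta>" using \<zeta> by auto
  then have \<zeta>0: "\<zeta> \<noteq> 0" "cmod \<zeta> > 0" using lam by auto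
  have f_eq: "f n = (\<lambda>z. 1 / \<zeta> ^ (n + 1) * (M ^^ n) ?h z)" for n by (simp add: f_def fun_eq_iff)
  have fX: "f n \<in> Calpha \<alpha>" for n unfolding f_eq by (rule Calpha_scale(1)[OF Mn_Calpha[OF \<alpha> hX]])
  \<comment> \<open>The bound C * lam^n divided by |\<zeta>|^(n+1), arranged as a geometric
    sequence.\<close>
  define a where "a n = C * ?N \<phi> / cmod \<zeta> * (lam / cmod \<zeta>) ^ n" for n
  have fa: "?N (f n) \<le> a n" for n
  proof -
    have "?N (f n) \<le> cmod (1 / \<zeta> ^ (n + 1)) * ?N ((M ^^ n) ?h)"
      unfolding f_eq by (rule Calpha_scale(2)[OF Mn_Calpha[OF \<alpha> hX]])
    also have "\<dots> \<le> cmod (1 / \<zeta> ^ (n + 1)) * (C * lam ^ n * ?N \<phi>)"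
      by (intro mult_left_mono conv \<phi>) simp
    also have "\<dots> = a n" by (simp add: a_def norm_divide norm_power norm_mult power_divide)
    finally show ?thesis .
  qed
  have q: "norm (lam / cmod \<zeta>) < 1" using lam \<zeta>l \<zeta>0 by (simp add: divide_less_eq)
  have sa: "summable a" unfolding a_def by (intro summable_mult summable_geometric q)
  have ser: "series \<zeta> \<phi> = (\<lambda>z. \<Sum>n. f n z)" by (simp add: series_def f_def fun_eq_iff)
  show FX: "series \<zeta> \<phi> \<in> Calpha \<alpha>" unfolding ser by (rule holder_suminf(1)[OF fX fa sa])
  have "suminf a = C * ?N \<phi> / cmod \<zeta> * (1 / (1 - lam / cmod \<zeta>))"
    unfolding a_def suminf_mult[OF summable_geometric[OF q]] suminf_geometric[OF q] ..
  also have "\<dots> = C * ?N \<phi> / (cmod \<zeta> - lam)" using \<zeta>0 \<zeta>l by (simp add: field_simps)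
  finally have "2 * suminf a = 2 * C / (cmod \<zeta> - lam) * ?N \<phi>" by simp
  then show "?N (series \<zeta> \<phi>) \<le> 2 * C / (cmod \<zeta> - lam) * ?N \<phi>"
    using holder_suminf(2)[OF fX fa sa] unfolding ser by simp
  define P where "P m = (\<lambda>z. \<Sum>n<m. f n z)" for m
  have s: "summable (\<lambda>n. f n z)" for z by (rule holder_suminf(3)[OF fX fa sa])
  have tail: "(\<lambda>z. series \<zeta> \<phi> z - P m z) = (\<lambda>z. \<Sum>n. f (n + m) z)" for m
    unfolding ser P_def using suminf_minus_initial_segment[OF s] by simp
  have sam: "summable (\<lambda>n. a (n + m))" for m using sa by (simp add: summable_iff_shift)
  have tailX: "(\<lambda>z. series \<zeta> \<phi> z - P m z) \<in> Calpha \<alpha>" for m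
    unfolding tail by (rule holder_suminf(1)[OF fX fa sam])
  have tail_le: "?N (\<lambda>z. series \<zeta> \<phi> z - P m z) \<le> 2 * (\<Sum>n. a (n + m))" for m
    unfolding tail by (rule holder_suminf(2)[OF fX fa sam])
  have "(\<lambda>m. 2 * (\<Sum>n. a (n + m))) \<longlonglongrightarrow> 2 * 0"
    by (intro tendsto_mult tendsto_const suminf_exist_split2 sa)
  then have up: "(\<lambda>m. 2 * (\<Sum>n. a (n + m))) \<longlonglongrightarrow> 0" by simp
  have lim: "(\<lambda>m. ?N (\<lambda>z. series \<zeta> \<phi> z - P m z)) \<longlonglongrightarrow> 0"
  proof (rule real_tendsto_sandwich[OF _ _ tendsto_const up])
    show "\<forall>\<^sub>F m in sequentially. 0 \<le> ?N (\<lambda>z. series \<zeta> \<phi> z - P m z)"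
      by (rule always_eventually) (rule allI, rule Calpha_upper(4)[OF tailX])
    show "\<forall>\<^sub>F m in sequentially. ?N (\<lambda>z. series \<zeta> \<phi> z - P m z) \<le> 2 * (\<Sum>n. a (n + m))"
      by (rule always_eventually) (rule allI, rule tail_le)
  qed
  then show "(\<lambda>N. ?N (\<lambda>z. series \<zeta> \<phi> z - (\<Sum>n<N. (M ^^ n) ?h z / \<zeta> ^ (n + 1)))) \<longlonglongrightarrow> 0"
    by (simp add: P_def f_def)
  have fC: "f n \<in> Ccont" for n by (rule Calpha_Ccont[OF fX \<alpha>])
  have PC: "P m \<in> Ccont" for m
  proof (induction m)
    case 0
    show ?case using Ccont_0 by (simp add: P_def)
  next
    case (Suc m)
    show ?case using Ccont_add[OF Suc fC[of m]] by (simp add: P_def)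
  qed
  \<comment> \<open>Telescoping: \<zeta> - M maps the n-th term to \<zeta> times the difference of
    the n-th and the next term.\<close>
  have TP: "shift_op \<zeta> \<tau> (P m) z = ?h z - \<zeta> * f m z" for m z
  proof (induction m)
    case 0
    show ?case using \<zeta>0 by (simp add: P_def shift_op_def M_0 f_def)
  next
    case (Suc m)
    have "P (Suc m) = (\<lambda>z. P m z + f m z)" by (simp add: P_def)
    then have "shift_op \<zeta> \<tau> (P (Suc m)) z = shift_op \<zeta> \<tau> (P m) z + shift_op \<zeta> \<tau> (f m) z"
      by (simp add: shift_op_add[OF PC fC])
    moreover have "M (f m) z = \<zeta> * f (Suc m) z"
      unfolding f_eq M_scale[OF Mn_Ccont[OF hC]] using \<zeta>0 by simp
    ultimately show ?case using Suc by (simp add: shift_op_def)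
  qed
  show "shift_op \<zeta> \<tau> (series \<zeta> \<phi>) = ?h"
  proof
    fix z
    \<comment> \<open>\<zeta> - M is passed through the infinite sum: it is bounded by |\<zeta>| + 1
      in the sup norm, and the tails tend to 0 even in the Hoelder norm.\<close>
    have "(\<lambda>m. shift_op \<zeta> \<tau> (series \<zeta> \<phi>) z - shift_op \<zeta> \<tau> (P m) z) \<longlonglongrightarrow> 0"
    proof (rule Lim_null_comparison)
      show "\<forall>\<^sub>F m in sequentially. norm (shift_op \<zeta> \<tau> (series \<zeta> \<phi>) z - shift_op \<zeta> \<tau> (P m) z)
          \<le> (cmod \<zeta> + 1) * ?N (\<lambda>z. series \<zeta> \<phi> z - P m z)"
      proof (intro always_eventually allI)
        fix m
        let ?t = "\<lambda>z. series \<zeta> \<phi> z - P m z"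
        have tC: "?t \<in> Ccont" by (rule Calpha_Ccont[OF tailX \<alpha>])
        have "shift_op \<zeta> \<tau> (series \<zeta> \<phi>) z - shift_op \<zeta> \<tau> (P m) z = \<zeta> * ?t z - M ?t z"
          using shift_op_diff[OF Calpha_Ccont[OF FX \<alpha>] PC[of m], of \<zeta>] by (simp add: shift_op_def fun_eq_iff)
        also have "cmod \<dots> \<le> cmod \<zeta> * cmod (?t z) + cmod (M ?t z)" by (metis norm_mult norm_triangle_ineq4)
        also have "\<dots> \<le> cmod \<zeta> * ?N ?t + ?N ?t"
          by (intro add_mono mult_left_mono Calpha_upper(2)[OF tailX] M_bound[OF tC] norm_ge_zero)
        finally show "norm (shift_op \<zeta> \<tau> (series \<zeta> \<phi>) z - shift_op \<zeta> \<tau> (P m) z) \<le> (cmod \<zeta> + 1) * ?N ?t"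
          by (simp add: distrib_right)
      qed
      show "(\<lambda>m. (cmod \<zeta> + 1) * ?N (\<lambda>z. series \<zeta> \<phi> z - P m z)) \<longlonglongrightarrow> 0"
        using tendsto_mult[OF tendsto_const lim] by simp
    qed
    moreover have "(\<lambda>m. \<zeta> * f m z) \<longlonglongrightarrow> \<zeta> * 0" by (intro tendsto_mult tendsto_const summable_LIMSEQ_zero s)
    ultimately have "(\<lambda>m. (shift_op \<zeta> \<tau> (series \<zeta> \<phi>) z - shift_op \<zeta> \<tau> (P m) z) - \<zeta> * f m z) \<longlonglongrightarrow> 0 - \<zeta> * 0"
      by (rule tendsto_diff)
    moreover have "(shift_op \<zeta> \<tau> (series \<zeta> \<phi>) z - shift_op \<zeta> \<tau> (P m) z) - \<zeta> * f m z
        = shift_op \<zeta> \<tau> (series \<zeta> \<phi>) z - ?h z" for m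
      unfolding TP by (simp add: algebra_simps)
    ultimately have "(\<lambda>m::nat. shift_op \<zeta> \<tau> (series \<zeta> \<phi>) z - ?h z) \<longlonglongrightarrow> 0"
      by (simp only: mult_zero_right diff_zero)
    then show "shift_op \<zeta> \<tau> (series \<zeta> \<phi>) z = ?h z" by (simp add: LIMSEQ_const_iff)
  qed
qed

lemma resolvent_solution:
  assumes \<zeta>: "\<zeta> \<in> resolvent_set" and \<phi>: "\<phi> \<in> Calpha \<alpha>"
    and \<rho>: "\<rho> \<in> lspan (Uf \<tau>)" "shift_op \<zeta> \<tau> \<rho> = proj \<tau> \<phi>"
  shows "(\<lambda>z. \<rho> z + series \<zeta> \<phi> z) \<in> Calpha \<alpha>" "shift_op \<zeta> \<tau> (\<lambda>z. \<rho> z + series \<zeta> \<phi> z) = \<phi>"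
proof -
  have \<rho>X: "\<rho> \<in> Calpha \<alpha>" by (rule span_Calpha[OF \<rho>(1)])
  show "(\<lambda>z. \<rho> z + series \<zeta> \<phi> z) \<in> Calpha \<alpha>" by (rule Calpha_add(1)[OF \<rho>X series(1)[OF \<zeta> \<phi>]])
  show "shift_op \<zeta> \<tau> (\<lambda>z. \<rho> z + series \<zeta> \<phi> z) = \<phi>"
    unfolding shift_op_add[OF Calpha_Ccont[OF \<rho>X \<alpha>] Calpha_Ccont[OF series(1)[OF \<zeta> \<phi>] \<alpha>]] \<rho>(2) series(4)[OF \<zeta> \<phi>]
    by simp
qed

lemma resolvent_exists:
  assumes \<zeta>: "\<zeta> \<in> resolvent_set"
  shows "\<exists>R. bdd_inverse_on (Calpha \<alpha>) (holder_norm \<alpha>) (shift_op \<zeta> \<tau>) R"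
proof -
  let ?N = "holder_norm \<alpha>"
  obtain K where K: "K \<ge> 0" "\<And>\<rho>. \<rho> \<in> lspan (Uf \<tau>) \<Longrightarrow> ?N \<rho> \<le> K * ?N (shift_op \<zeta> \<tau> \<rho>)"
    using span_bounded_below[OF \<zeta>] by blast
  \<comment> \<open>The rate at n = 0 bounds the norm of I minus the projection by C, hence that of
    the projection by 1 + C; K bounds the inverse on the span. The last term bounds the
    series.\<close>
  define B where "B = K * (1 + C) + 2 * C / (cmod \<zeta> - lam)"
  have sol: "\<exists>\<psi>\<in>Calpha \<alpha>. shift_op \<zeta> \<tau> \<psi> = \<phi> \<and> ?N \<psi> \<le> B * ?N \<phi>" if \<phi>: "\<phi> \<in> Calpha \<alpha>" for \<phi>
  proof -
    have \<phi>C: "\<phi> \<in> Ccont" by (rule Calpha_Ccont[OF \<phi> \<alpha>])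
    have pX: "proj \<tau> \<phi> \<in> Calpha \<alpha>" by (rule span_Calpha[OF proj_span[OF \<phi>C]])
    obtain \<rho> where \<rho>: "\<rho> \<in> lspan (Uf \<tau>)" "shift_op \<zeta> \<tau> \<rho> = proj \<tau> \<phi>"
      using lspan_shift_op_inverse[OF _ proj_span[OF \<phi>C], of \<zeta>] \<zeta> by blast
    have "?N (\<lambda>z. \<phi> z - (\<phi> z - proj \<tau> \<phi> z)) \<le> ?N \<phi> + ?N (\<lambda>z. \<phi> z - proj \<tau> \<phi> z)"
      by (rule Calpha_diff(2)[OF \<phi> Calpha_diff(1)[OF \<phi> pX]])
    then have "?N (proj \<tau> \<phi>) \<le> ?N \<phi> + ?N (\<lambda>z. \<phi> z - proj \<tau> \<phi> z)" by simp
    also have "\<dots> \<le> ?N \<phi> + C * ?N \<phi>" using conv[OF \<phi>, of 0] by simp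
    finally have p: "?N (proj \<tau> \<phi>) \<le> (1 + C) * ?N \<phi>" by (simp add: distrib_right)
    have "?N (\<lambda>z. \<rho> z + series \<zeta> \<phi> z) \<le> ?N \<rho> + ?N (series \<zeta> \<phi>)"
      by (rule Calpha_add(2)[OF span_Calpha[OF \<rho>(1)] series(1)[OF \<zeta> \<phi>]])
    also have "\<dots> \<le> K * ((1 + C) * ?N \<phi>) + 2 * C / (cmod \<zeta> - lam) * ?N \<phi>"
      using K(2)[OF \<rho>(1)] mult_left_mono[OF p K(1)] series(2)[OF \<zeta> \<phi>] \<rho>(2) by simp
    also have "\<dots> = B * ?N \<phi>" by (simp add: B_def distrib_right mult.assoc)
    finally have "?N (\<lambda>z. \<rho> z + series \<zeta> \<phi> z) \<le> B * ?N \<phi>" .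
    then show ?thesis using resolvent_solution[OF \<zeta> \<phi> \<rho>] by blast
  qed
  define R where "R \<phi> = (SOME \<psi>. \<psi> \<in> Calpha \<alpha> \<and> shift_op \<zeta> \<tau> \<psi> = \<phi> \<and> ?N \<psi> \<le> B * ?N \<phi>)" for \<phi>
  have R: "R \<phi> \<in> Calpha \<alpha> \<and> shift_op \<zeta> \<tau> (R \<phi>) = \<phi> \<and> ?N (R \<phi>) \<le> B * ?N \<phi>" if "\<phi> \<in> Calpha \<alpha>" for \<phi>
  proof -
    have "\<exists>\<psi>. \<psi> \<in> Calpha \<alpha> \<and> shift_op \<zeta> \<tau> \<psi> = \<phi> \<and> ?N \<psi> \<le> B * ?N \<phi>" using sol[OF that] by blast
    from someI_ex[OF this] show ?thesis unfolding R_def .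
  qed
  have "R (shift_op \<zeta> \<tau> \<phi>) = \<phi>" if \<phi>: "\<phi> \<in> Calpha \<alpha>" for \<phi>
    using R[OF shift_op_Calpha[OF \<alpha> \<phi>]] by (intro shift_op_inj[OF \<zeta> _ \<phi>]) auto
  then have "bdd_inverse_on (Calpha \<alpha>) ?N (shift_op \<zeta> \<tau>) R"
    unfolding bdd_inverse_on_def using R by blast
  then show ?thesis by blast
qed

text \<open>\<open>R\<close> is an arbitrary inverse, so its value at \<phi> is read off from
  \<open>R (shift_op \<zeta> \<tau> \<psi>) = \<psi>\<close> at the explicit solution. The definite
  description is the inverse on the span applied to the projection; it denotes by injectivity of
  \<zeta> - M.\<close>

lemma resolvent_expansion:
  assumes \<zeta>: "\<zeta> \<in> resolvent_set" and \<phi>: "\<phi> \<in> Calpha \<alpha>"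
    and R: "bdd_inverse_on (Calpha \<alpha>) (holder_norm \<alpha>) (shift_op \<zeta> \<tau>) R"
  shows "R \<phi> z - (THE \<psi>. \<psi> \<in> LS (Uf \<tau>) \<and> shift_op \<zeta> \<tau> \<psi> = proj \<tau> \<phi>) z = series \<zeta> \<phi> z"
proof -
  have \<phi>C: "\<phi> \<in> Ccont" by (rule Calpha_Ccont[OF \<phi> \<alpha>])
  obtain \<rho> where \<rho>: "\<rho> \<in> lspan (Uf \<tau>)" "shift_op \<zeta> \<tau> \<rho> = proj \<tau> \<phi>"
    using lspan_shift_op_inverse[OF _ proj_span[OF \<phi>C], of \<zeta>] \<zeta> by blast
  have "(THE \<psi>. \<psi> \<in> LS (Uf \<tau>) \<and> shift_op \<zeta> \<tau> \<psi> = proj \<tau> \<phi>) = \<rho>"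
  proof (rule the_equality)
    show "\<rho> \<in> LS (Uf \<tau>) \<and> shift_op \<zeta> \<tau> \<rho> = proj \<tau> \<phi>" using \<rho> by (simp add: LS_eq_lspan)
    show "\<psi> = \<rho>" if "\<psi> \<in> LS (Uf \<tau>) \<and> shift_op \<zeta> \<tau> \<psi> = proj \<tau> \<phi>" for \<psi>
      by (rule shift_op_inj[OF \<zeta>]) (use that \<rho> span_Calpha LS_eq_lspan in auto)
  qed
  moreover have "R (shift_op \<zeta> \<tau> (\<lambda>z. \<rho> z + series \<zeta> \<phi> z)) = (\<lambda>z. \<rho> z + series \<zeta> \<phi> z)"
    using R resolvent_solution(1)[OF \<zeta> \<phi> \<rho>] unfolding bdd_inverse_on_def by blast
  ultimately show ?thesis by (simp add: resolvent_solution(2)[OF \<zeta> \<phi> \<rho>])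
qed

end

theorem mainTheorem13:
  fixes \<tau> :: "(rsphere \<Rightarrow> rsphere) measure" and \<alpha> lam :: real
  assumes "\<tau> \<in> prob_meas_cpt"
    and "Julia_ker (G_of \<tau>) = {}"
    and "Julia (G_of \<tau>) \<noteq> {}"
    and "S_of \<tau> \<subseteq> Fatou (G_of \<tau>)"
    and "0 < \<alpha>" "\<alpha> < 1" "0 < lam" "lam < 1"
    and "\<exists>C>0. \<forall>\<phi>\<in>Calpha \<alpha>. \<forall>n. holder_norm \<alpha> ((Mop \<tau> ^^ n) (\<lambda>z. \<phi> z - proj \<tau> \<phi> z))
             \<le> C * lam ^ n * holder_norm \<alpha> \<phi>"
    and "LS (Uf \<tau>) \<subseteq> Calpha \<alpha>"
  shows "spec_alpha \<alpha> \<tau> \<subseteq> {z. cmod z \<le> lam} \<union> Uv \<tau>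
    \<and> (\<forall>\<zeta> R \<phi>. \<zeta> \<notin> {z. cmod z \<le> lam} \<union> Uv \<tau> \<longrightarrow>
           bdd_inverse_on (Calpha \<alpha>) (holder_norm \<alpha>) (shift_op \<zeta> \<tau>) R \<longrightarrow> \<phi> \<in> Calpha \<alpha> \<longrightarrow>
           (\<lambda>N. holder_norm \<alpha> (\<lambda>z. R \<phi> z
               - (THE \<psi>. \<psi> \<in> LS (Uf \<tau>) \<and> shift_op \<zeta> \<tau> \<psi> = proj \<tau> \<phi>) z
               - (\<Sum>n<N. (Mop \<tau> ^^ n) (\<lambda>w. \<phi> w - proj \<tau> \<phi> w) z / \<zeta> ^ (n + 1))))
           \<longlonglongrightarrow> 0)"
proof -
  obtain C where "C > 0" "\<And>\<phi> n. \<phi> \<in> Calpha \<alpha> \<Longrightarrow> holder_norm \<alpha> ((Mop \<tau> ^^ n) (\<lambda>z. \<phi> z - proj \<tau> \<phi> z))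
             \<le> C * lam ^ n * holder_norm \<alpha> \<phi>" using assms(9) by blast
  then interpret exponential_convergence \<tau> \<alpha> lam C
    using assms by unfold_locales
  show ?thesis
  proof (intro conjI allI impI)
    show "spec_alpha \<alpha> \<tau> \<subseteq> {z. cmod z \<le> lam} \<union> Uv \<tau>"
      using resolvent_exists unfolding spec_alpha_def by blast
    fix \<zeta> R \<phi> assume "\<zeta> \<notin> {z. cmod z \<le> lam} \<union> Uv \<tau>"
      and R: "bdd_inverse_on (Calpha \<alpha>) (holder_norm \<alpha>) (shift_op \<zeta> \<tau>) R" and \<phi>: "\<phi> \<in> Calpha \<alpha>"
    then have \<zeta>: "\<zeta> \<in> resolvent_set" by simp
    show "(\<lambda>N. holder_norm \<alpha> (\<lambda>z. R \<phi> z
               - (THE \<psi>. \<psi> \<in> LS (Uf \<tau>) \<and> shift_op \<zeta> \<tau> \<psi> = proj \<tau> \<phi>) z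
               - (\<Sum>n<N. (Mop \<tau> ^^ n) (\<lambda>w. \<phi> w - proj \<tau> \<phi> w) z / \<zeta> ^ (n + 1)))) \<longlonglongrightarrow> 0"
      unfolding resolvent_expansion[OF \<zeta> \<phi> R] by (rule series(3)[OF \<zeta> \<phi>])
  qed
qed

end
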